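(* Suppose that $c$ is $C^4$, in the sense that mixed derivatives of $c$ of order 2 in both variables simultaneously are continuous on $\Omega^{\mathrm{cl}}\times\bar\Omega^{\mathrm{cl}}$. If $c$, $\Omega$ and $\bar\Omega$ satisfy (Twist), (Nondeg) and (DomConv), then $c$ satisfies (A3w) if and only if it satisfies (QQConv).
   Context: Setting. $(M,g)$ and $(\bar M,\bar g)$ are $n$-dimensional Riemannian manifolds, $\Omega\subset M$ and $\bar\Omega\subset\bar M$ are bounded subdomains with compact closures $\Omega^{\mathrm{cl}},\bar\Omega^{\mathrm{cl}}$. $\bar\rho\geq 0$ is a measurable function on $\bar M$ (a probability density) with support $\operatorname{spt}\bar\rho\subset\bar\Omega$. The cost $c:\Omega^{\mathrm{cl}}\times\bar\Omega^{\mathrm{cl}}\to\mathbb R$ is throughout "$C^3$" in the sense that all mixed derivatives of order 2 in one variable and order 1 in the other are continuous on $\Omega^{\mathrm{cl}}\times\bar\Omega^{\mathrm{cl}}$. $D$ and $\bar D$ denote the differentials in the first and second variable. Notation: $p_{(x,\bar x)}:=-\bar Dc(x,\bar x)\in T^*_{\bar x}\bar M$, $\bar p_{(x,\bar x)}:=-Dc(x,\bar x)\in T^*_xM$; for $A\subset\Omega$, $[A]_{\bar x}:=-\bar Dc(A,\bar x)$; for $\bar A\subset\bar\Omega$, $[\bar A]_x:=-Dc(x,\bar A)$. (Twist): $\bar x\mapsto -Dc(x_0,\bar x)$ is injective on $\bar\Omega$ for each $x_0\in\Omega$, and $x\mapsto-\bar Dc(x,\bar x_0)$ is injective on $\Omega$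 for each $\bar x_0\in\bar\Omega$. For $\bar p\in[\bar\Omega]_{x_0}$, $exp^c_{x_0}(\bar p)\in\bar\Omega$ is the unique point with $-Dc(x_0,exp^c_{x_0}(\bar p))=\bar p$; for $p\in[\Omega]_{\bar x_0}$, $exp^c_{\bar x_0}(p)\in\Omega$ is the unique point with $-\bar Dc(exp^c_{\bar x_0}(p),\bar x_0)=p$. (Nondeg): for every $(x,\bar x)\in\Omega^{\mathrm{cl}}\times\bar\Omega^{\mathrm{cl}}$ the linear maps $-\bar DDc(x,\bar x):T_{\bar x}\bar M\to T^*_xM$ and its adjoint $-D\bar Dc(x,\bar x):T_xM\to T^*_{\bar x}\bar M$ are invertible. $c$-segments: for $x_0,x_1\in\Omega$ and $\bar x\in\bar\Omega$ the $c$-segment with respect to $\bar x$ from $x_0$ to $x_1$ is $s\mapsto exp^c_{\bar x}((1-s)p_{(x_0,\bar x)}+s\,p_{(x_1,\bar x)})$, $s\in[0,1]$; for $\bar x_0,\bar x_1\in\bar\Omega$ and $x\in\Omega$ the $c$-segment with respect to $x$ from $\bar x_0$ to $\bar x_1$ is $t\mapsto exp^c_x((1-t)\bar p_{(x,\bar x_0)}+t\,\bar p_{(x,\bar x_1)})$. A set $A\subset\Omega$ is $c$-convex with respect to $\bar x$ if it contains all $c$-segments with respect to $\bar x$ between its points; similarly for $\bar A\subset\bar\Omega$ with respect to $x\in\Omega$; $c$-convex with respect to a set means with respect to each of its points. (DomConv): $\Omega$ and $\bar\Omega$ are $c$-convex with respect to each other, $\operatorname{spt}\bar\rho$ is $c$-convex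 with respect to $\Omega$, and $\operatorname{spt}\bar\rho\subset\bar\Omega^{\mathrm{int}}$ (compact containment). (QQConv): there is a constant $M_0\ge1$ such that for all $x,x_0,x_1\in\Omega$, $\bar x,\bar x_0,\bar x_1\in\bar\Omega$ and $s,t\in[0,1]$, $$-c(x,\bar x(t))+c(x,\bar x_0)-(-c(x_0,\bar x(t))+c(x_0,\bar x_0))\le M_0t\,\big(-c(x,\bar x_1)+c(x,\bar x_0)-(-c(x_0,\bar x_1)+c(x_0,\bar x_0))\big)_+,$$ $$-c(x(s),\bar x)+c(x_0,\bar x)-(-c(x(s),\bar x_0)+c(x_0,\bar x_0))\le M_0s\,\big(-c(x_1,\bar x)+c(x_0,\bar x)-(-c(x_1,\bar x_0)+c(x_0,\bar x_0))\big)_+,$$ where $\bar x(t)$ is the $c$-segment with respect to $x_0$ from $\bar x_0$ to $\bar x_1$, and $x(s)$ is the $c$-segment with respect to $\bar x_0$ from $x_0$ to $x_1$. (A3w): in local coordinates near $(x,\bar x)$, for $V,W\in T_xM$ and $\eta,\zeta\in T_x^*M$ put $$\mathrm{MTW}_{(x,\bar x)}(V,W,\eta,\zeta):=-(c_{ij,\bar r\bar s}-c_{ij,\bar t}\,c^{\bar t,s}\,c_{s,\bar r\bar s})\,c^{\bar r,k}c^{\bar s,l}(x,\bar x)\,V^iW^j\eta_k\zeta_l$$ (summation convention), where unbarred indices denote derivatives in the first variable, barred indices derivatives in the second variable, and a pair of raised indices denotes the inverse matrix of $(c_{i,\bar j})$. Then $c$ satisfies (A3w) if $\mathrm{MTW}_{(x,\bar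 x)}(V,V,\eta,\eta)\ge0$ for all $x\in\Omega$, $\bar x\in\bar\Omega$, $V\in T_xM$, $\eta\in T^*_xM$ with $\langle\eta,V\rangle=0$. *)

theory Defs
  imports "HOL-Analysis.Analysis" "HOL-Library.Sublist"
begin

section \<open>Iterated partial derivatives\<close>

text \<open>The directions are applied from right to left: the last entry of the list is
  differentiated first.\<close>

fun iter_partial ::
  "'e::real_normed_vector list \<Rightarrow> ('e \<Rightarrow> 'f::real_normed_vector) \<Rightarrow> 'e \<Rightarrow> 'f" where
  "iter_partial [] f = f"
| "iter_partial (v # vs) f =
     (\<lambda>p. vector_derivative (\<lambda>t. iter_partial vs f (p + t *\<^sub>R v)) (at 0))"

fun iter_partial_exists ::
  "'e::real_normed_vector list \<Rightarrow> ('e \<Rightarrow> 'f::real_normed_vector) \<Rightarrow> 'e set \<Rightarrow> bool" where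
  "iter_partial_exists [] f S \<longleftrightarrow> True"
| "iter_partial_exists (v # vs) f S \<longleftrightarrow>
     iter_partial_exists vs f S \<and>
     (\<forall>p\<in>S. (\<lambda>t. iter_partial vs f (p + t *\<^sub>R v)) differentiable (at 0))"

definition smooth_map_on ::
  "'e::euclidean_space set \<Rightarrow> ('e \<Rightarrow> 'f::real_normed_vector) \<Rightarrow> bool" where
  "smooth_map_on S f \<longleftrightarrow>
     (\<forall>vs. set vs \<subseteq> Basis \<longrightarrow> iter_partial_exists vs f S \<and> continuous_on S (iter_partial vs f))"


section \<open>Smooth and Riemannian manifolds\<close>

text \<open>The points of a manifold are the elements of a Hausdorff, second countable type; the
  smooth structure is given by an atlas. A chart is a pair of its domain and its coordinate map,
  whose values outside the domain are irrelevant.\<close>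

type_synonym ('a, 'n) chart = "'a set \<times> ('a \<Rightarrow> real ^ 'n)"

abbreviation cdom :: "('a, 'n) chart \<Rightarrow> 'a set" where
  "cdom \<kappa> \<equiv> fst \<kappa>"

abbreviation cmap :: "('a, 'n) chart \<Rightarrow> 'a \<Rightarrow> real ^ 'n" where
  "cmap \<kappa> \<equiv> snd \<kappa>"

definition cinv :: "('a, 'n) chart \<Rightarrow> real ^ 'n \<Rightarrow> 'a" where
  "cinv \<kappa> = inv_into (cdom \<kappa>) (cmap \<kappa>)"

definition charts_at :: "('a, 'n) chart set \<Rightarrow> 'a \<Rightarrow> ('a, 'n) chart set" where
  "charts_at \<A> x = {\<kappa> \<in> \<A>. x \<in> cdom \<kappa>}"

definition smooth_manifold ::
  "('a::{t2_space, second_countable_topology}, 'n::finite) chart set \<Rightarrow> bool" where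
  "smooth_manifold \<A> \<longleftrightarrow>
     (\<Union>\<kappa>\<in>\<A>. cdom \<kappa>) = UNIV \<and>
     (\<forall>\<kappa>\<in>\<A>. open (cdom \<kappa>) \<and> open (cmap \<kappa> ` cdom \<kappa>) \<and>
        homeomorphism (cdom \<kappa>) (cmap \<kappa> ` cdom \<kappa>) (cmap \<kappa>) (cinv \<kappa>)) \<and>
     (\<forall>\<kappa>\<in>\<A>. \<forall>\<kappa>'\<in>\<A>. smooth_map_on (cmap \<kappa> ` (cdom \<kappa> \<inter> cdom \<kappa>')) (cmap \<kappa>' \<circ> cinv \<kappa>))"

definition transition_jacobian ::
  "('a, 'n::finite) chart \<Rightarrow> ('a, 'n) chart \<Rightarrow> 'a \<Rightarrow> real ^ 'n ^ 'n" where
  "transition_jacobian \<kappa> \<kappa>' x =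
     (\<chi> a i. iter_partial [axis i 1] (cmap \<kappa>' \<circ> cinv \<kappa>) (cmap \<kappa> x) $ a)"

text \<open>A metric is given by its component matrices \<open>g \<kappa> x\<close> in every chart \<open>\<kappa>\<close> around \<open>x\<close>.\<close>

type_synonym ('a, 'n) metric = "('a, 'n) chart \<Rightarrow> 'a \<Rightarrow> real ^ 'n ^ 'n"

definition riemannian_manifold ::
  "('a::{t2_space, second_countable_topology}, 'n::finite) chart set \<Rightarrow> ('a, 'n) metric \<Rightarrow> bool"
where
  "riemannian_manifold \<A> g \<longleftrightarrow>
     smooth_manifold \<A> \<and>
     (\<forall>\<kappa>\<in>\<A>. smooth_map_on (cmap \<kappa> ` cdom \<kappa>) (g \<kappa> \<circ> cinv \<kappa>)) \<and>
     (\<forall>x. \<forall>\<kappa>\<in>charts_at \<A> x.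
        transpose (g \<kappa> x) = g \<kappa> x \<and> (\<forall>v. v \<noteq> 0 \<longrightarrow> v \<bullet> (g \<kappa> x *v v) > 0)) \<and>
     (\<forall>x. \<forall>\<kappa>\<in>charts_at \<A> x. \<forall>\<kappa>'\<in>charts_at \<A> x.
        g \<kappa> x = transpose (transition_jacobian \<kappa> \<kappa>' x) ** g \<kappa>' x ** transition_jacobian \<kappa> \<kappa>' x)"

text \<open>The chart chosen for computing the speed of a curve is immaterial.\<close>

definition speed ::
  "('a, 'n::finite) chart set \<Rightarrow> ('a, 'n) metric \<Rightarrow> (real \<Rightarrow> 'a) \<Rightarrow> real \<Rightarrow> real" where
  "speed \<A> g \<gamma> t =
     (let \<kappa> = (SOME \<kappa>. \<kappa> \<in> charts_at \<A> (\<gamma> t)); v = vector_derivative (cmap \<kappa> \<circ> \<gamma>) (at t)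
      in sqrt (v \<bullet> (g \<kappa> (\<gamma> t) *v v)))"

definition piecewise_C1_curve ::
  "('a::topological_space, 'n::finite) chart set \<Rightarrow> (real \<Rightarrow> 'a) \<Rightarrow> bool" where
  "piecewise_C1_curve \<A> \<gamma> \<longleftrightarrow>
     continuous_on {0..1} \<gamma> \<and>
     (\<exists>N. finite N \<and>
        (\<forall>\<kappa>\<in>\<A>. (cmap \<kappa> \<circ> \<gamma>) C1_differentiable_on ({t\<in>{0..1}. \<gamma> t \<in> cdom \<kappa>} - N)))"

definition riemannian_bounded ::
  "('a::topological_space, 'n::finite) chart set \<Rightarrow> ('a, 'n) metric \<Rightarrow> 'a set \<Rightarrow> bool" where
  "riemannian_bounded \<A> g S \<longleftrightarrow>
     (\<exists>R. \<forall>x\<in>S. \<forall>y\<in>S. \<exists>\<gamma>. piecewise_C1_curve \<A> \<gamma> \<and> \<gamma> 0 = x \<and> \<gamma> 1 = y \<and>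
        speed \<A> g \<gamma> integrable_on {0..1} \<and> integral {0..1} (speed \<A> g \<gamma>) \<le> R)"

definition bounded_subdomain ::
  "('a::topological_space, 'n::finite) chart set \<Rightarrow> ('a, 'n) metric \<Rightarrow> 'a set \<Rightarrow> bool" where
  "bounded_subdomain \<A> g \<Omega> \<longleftrightarrow>
     open \<Omega> \<and> connected \<Omega> \<and> \<Omega> \<noteq> {} \<and> riemannian_bounded \<A> g \<Omega> \<and> compact (closure \<Omega>)"

definition riemannian_volume ::
  "('a::topological_space, 'n::finite) chart set \<Rightarrow> ('a, 'n) metric \<Rightarrow> 'a measure" where
  "riemannian_volume \<A> g = completion (THE \<mu>.
     sets \<mu> = sets borel \<and>
     (\<forall>\<kappa>\<in>\<A>. \<forall>E\<in>sets borel. E \<subseteq> cdom \<kappa> \<longrightarrow>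
        emeasure \<mu> E =
          (\<integral>\<^sup>+u. ennreal (sqrt (det (g \<kappa> (cinv \<kappa> u)))) * indicator (cmap \<kappa> ` E) u \<partial>lborel)))"

definition probability_density ::
  "('a::topological_space, 'n::finite) chart set \<Rightarrow> ('a, 'n) metric \<Rightarrow> ('a \<Rightarrow> real) \<Rightarrow> bool" where
  "probability_density \<A> g \<rho> \<longleftrightarrow>
     \<rho> \<in> borel_measurable (riemannian_volume \<A> g) \<and> (\<forall>x. 0 \<le> \<rho> x) \<and>
     (\<integral>\<^sup>+x. ennreal (\<rho> x) \<partial>riemannian_volume \<A> g) = 1"

text \<open>The support of a measurable density is that of the measure it defines: the complement of
  the largest open set on which the density vanishes almost everywhere.\<close>

definition spt ::
  "('a::topological_space, 'n::finite) chart set \<Rightarrow> ('a, 'n) metric \<Rightarrow> ('a \<Rightarrow> real) \<Rightarrow> 'a set" where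
  "spt \<A> g \<rho> =
     {x. \<forall>U. open U \<and> x \<in> U \<longrightarrow>
        (\<integral>\<^sup>+y. ennreal (\<rho> y) * indicator U y \<partial>riemannian_volume \<A> g) > 0}"


section \<open>Covectors\<close>

text \<open>A cotangent vector at \<open>x\<close> is represented by the family of its components in all charts
  around \<open>x\<close> (and \<open>0\<close> in the other charts), with pointwise linear structure. In particular
  two differentials at \<open>x\<close> are equal iff they are equal as elements of the cotangent space.\<close>

type_synonym ('a, 'n) covector = "('a, 'n) chart \<Rightarrow> real ^ 'n"

definition differential ::
  "('a, 'n::finite) chart set \<Rightarrow> ('a \<Rightarrow> real) \<Rightarrow> 'a \<Rightarrow> ('a, 'n) covector" where
  "differential \<A> f x =
     (\<lambda>\<kappa>. if \<kappa> \<in> charts_at \<A> x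
           then (\<chi> i. iter_partial [axis i 1] (f \<circ> cinv \<kappa>) (cmap \<kappa> x)) else 0)"

definition covector_interp ::
  "('a, 'n::finite) covector \<Rightarrow> ('a, 'n) covector \<Rightarrow> real \<Rightarrow> ('a, 'n) covector" where
  "covector_interp p0 p1 s = (\<lambda>\<kappa>. (1 - s) *\<^sub>R p0 \<kappa> + s *\<^sub>R p1 \<kappa>)"


section \<open>The cost: regularity and nondegeneracy\<close>

definition local_cost ::
  "('a \<Rightarrow> 'b \<Rightarrow> real) \<Rightarrow> ('a, 'n::finite) chart \<Rightarrow> ('b, 'n) chart \<Rightarrow> (real ^ 'n) \<times> (real ^ 'n) \<Rightarrow> real" where
  "local_cost c \<kappa> \<psi> = (\<lambda>(u, v). c (cinv \<kappa> u) (cinv \<psi> v))"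

text \<open>\<open>Inl i\<close> is the \<open>i\<close>-th coordinate direction of the first variable, \<open>Inr r\<close> the \<open>r\<close>-th one
  of the second variable (a barred index).\<close>

definition coord_dir :: "'n + 'n \<Rightarrow> (real ^ 'n::finite) \<times> (real ^ 'n)" where
  "coord_dir d = (case d of Inl i \<Rightarrow> (axis i 1, 0) | Inr r \<Rightarrow> (0, axis r 1))"

definition cost_partial ::
  "('a \<Rightarrow> 'b \<Rightarrow> real) \<Rightarrow> ('a, 'n::finite) chart \<Rightarrow> ('b, 'n) chart \<Rightarrow> ('n + 'n) list \<Rightarrow>
   'a \<Rightarrow> 'b \<Rightarrow> real" where
  "cost_partial c \<kappa> \<psi> w x y =
     iter_partial (map coord_dir w) (local_cost c \<kappa> \<psi>) (cmap \<kappa> x, cmap \<psi> y)"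

text \<open>Orders of differentiation with at most \<open>k\<close> derivatives in the first and at most \<open>l\<close> in the
  second variable that never form a pure derivative of order two or more, so that only \<open>c\<close>, its
  first differentials and genuinely mixed derivatives are involved.\<close>

definition mixed_orders :: "nat \<Rightarrow> nat \<Rightarrow> ('n + 'n) list set" where
  "mixed_orders k l =
     {w. length (filter isl w) \<le> k \<and> length (filter (\<lambda>d. \<not> isl d) w) \<le> l \<and>
         (\<forall>v. suffix v w \<and> 2 \<le> length v \<longrightarrow> (\<exists>d\<in>set v. isl d) \<and> (\<exists>d\<in>set v. \<not> isl d))}"

text \<open>Continuity of a derivative on the closures means that it exists in the (open) domains and
  extends continuously to their closures.\<close>

definition mixed_regular ::
  "('a::topological_space, 'n::finite) chart set \<Rightarrow> ('b::topological_space, 'n) chart set \<Rightarrow>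
   'a set \<Rightarrow> 'b set \<Rightarrow> ('a \<Rightarrow> 'b \<Rightarrow> real) \<Rightarrow> nat \<Rightarrow> nat \<Rightarrow> bool" where
  "mixed_regular \<A> \<B> \<Omega> \<Omega>' c k l \<longleftrightarrow>
     continuous_on (closure \<Omega> \<times> closure \<Omega>') (\<lambda>(x, y). c x y) \<and>
     (\<forall>\<kappa>\<in>\<A>. \<forall>\<psi>\<in>\<B>. \<forall>w\<in>mixed_orders k l.
        let D = iter_partial (map coord_dir w) (local_cost c \<kappa> \<psi>);
            S = (cmap \<kappa> ` (cdom \<kappa> \<inter> \<Omega>)) \<times> (cmap \<psi> ` (cdom \<psi> \<inter> \<Omega>'))
        in iter_partial_exists (map coord_dir w) (local_cost c \<kappa> \<psi>) S \<and>
           (\<exists>G. continuous_on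
                  ((cmap \<kappa> ` (cdom \<kappa> \<inter> closure \<Omega>)) \<times> (cmap \<psi> ` (cdom \<psi> \<inter> closure \<Omega>'))) G \<and>
                (\<forall>p\<in>S. G p = D p)))"

text \<open>The matrix \<open>c\<^sub>i\<^sub>,\<^sub>j\<close> (\<open>j\<close> barred) of the mixed second derivative, on the closures, as the value
  of the continuous extension from the domains.\<close>

definition mixed_hessian_cl ::
  "'a set \<Rightarrow> 'b set \<Rightarrow> ('a \<Rightarrow> 'b \<Rightarrow> real) \<Rightarrow> ('a, 'n::finite) chart \<Rightarrow> ('b, 'n) chart \<Rightarrow>
   'a \<Rightarrow> 'b \<Rightarrow> real ^ 'n ^ 'n" where
  "mixed_hessian_cl \<Omega> \<Omega>' c \<kappa> \<psi> x y =
     (\<chi> i j. Lim (at (cmap \<kappa> x, cmap \<psi> y)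
                   within (cmap \<kappa> ` (cdom \<kappa> \<inter> \<Omega>)) \<times> (cmap \<psi> ` (cdom \<psi> \<inter> \<Omega>')))
              (iter_partial (map coord_dir [Inl i, Inr j]) (local_cost c \<kappa> \<psi>)))"

definition nondeg ::
  "('a::topological_space, 'n::finite) chart set \<Rightarrow> ('b::topological_space, 'n) chart set \<Rightarrow>
   'a set \<Rightarrow> 'b set \<Rightarrow> ('a \<Rightarrow> 'b \<Rightarrow> real) \<Rightarrow> bool" where
  "nondeg \<A> \<B> \<Omega> \<Omega>' c \<longleftrightarrow>
     (\<forall>x\<in>closure \<Omega>. \<forall>y\<in>closure \<Omega>'. \<forall>\<kappa>\<in>charts_at \<A> x. \<forall>\<psi>\<in>charts_at \<B> y.
        invertible (- mixed_hessian_cl \<Omega> \<Omega>' c \<kappa> \<psi> x y) \<and>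
        invertible (transpose (- mixed_hessian_cl \<Omega> \<Omega>' c \<kappa> \<psi> x y)))"


section \<open>Twist, segments and convexity\<close>

text \<open>The notions with respect to points of the second manifold are stated below; those with
  respect to points of the first manifold are obtained by exchanging the variables of \<open>c\<close>.\<close>

definition swap_cost :: "('a \<Rightarrow> 'b \<Rightarrow> real) \<Rightarrow> 'b \<Rightarrow> 'a \<Rightarrow> real" where
  "swap_cost c = (\<lambda>y x. c x y)"

text \<open>The covector \<open>p\<close> at \<open>(x, y)\<close>, i.e. minus the differential of \<open>c\<close> in the second variable.\<close>

definition pvec ::
  "('b, 'n::finite) chart set \<Rightarrow> ('a \<Rightarrow> 'b \<Rightarrow> real) \<Rightarrow> 'a \<Rightarrow> 'b \<Rightarrow> ('b, 'n) covector" where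
  "pvec \<B> c x y = (\<lambda>\<psi>. - differential \<B> (c x) y \<psi>)"

definition twist ::
  "('a, 'n::finite) chart set \<Rightarrow> ('b, 'n) chart set \<Rightarrow> 'a set \<Rightarrow> 'b set \<Rightarrow>
   ('a \<Rightarrow> 'b \<Rightarrow> real) \<Rightarrow> bool" where
  "twist \<A> \<B> \<Omega> \<Omega>' c \<longleftrightarrow>
     (\<forall>x\<in>\<Omega>. inj_on (\<lambda>y. pvec \<A> (swap_cost c) y x) \<Omega>') \<and>
     (\<forall>y\<in>\<Omega>'. inj_on (\<lambda>x. pvec \<B> c x y) \<Omega>)"

definition c_exp ::
  "('b, 'n::finite) chart set \<Rightarrow> ('a \<Rightarrow> 'b \<Rightarrow> real) \<Rightarrow> 'a set \<Rightarrow> 'b \<Rightarrow> ('b, 'n) covector \<Rightarrow> 'a" where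
  "c_exp \<B> c \<Omega> y p = (THE x. x \<in> \<Omega> \<and> pvec \<B> c x y = p)"

definition c_segment ::
  "('b, 'n::finite) chart set \<Rightarrow> ('a \<Rightarrow> 'b \<Rightarrow> real) \<Rightarrow> 'a set \<Rightarrow> 'b \<Rightarrow> 'a \<Rightarrow> 'a \<Rightarrow> real \<Rightarrow> 'a" where
  "c_segment \<B> c \<Omega> y x0 x1 s =
     c_exp \<B> c \<Omega> y (covector_interp (pvec \<B> c x0 y) (pvec \<B> c x1 y) s)"

text \<open>The first conjunct says that the segment is defined, i.e. that \<open>c_exp\<close> is only applied to
  covectors in its domain.\<close>

definition c_convex_wrt ::
  "('b, 'n::finite) chart set \<Rightarrow> ('a \<Rightarrow> 'b \<Rightarrow> real) \<Rightarrow> 'a set \<Rightarrow> 'a set \<Rightarrow> 'b set \<Rightarrow> bool" where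
  "c_convex_wrt \<B> c \<Omega> E Y \<longleftrightarrow>
     (\<forall>y\<in>Y. \<forall>x0\<in>E. \<forall>x1\<in>E. \<forall>s\<in>{0..1}.
        covector_interp (pvec \<B> c x0 y) (pvec \<B> c x1 y) s \<in> (\<lambda>x. pvec \<B> c x y) ` \<Omega> \<and>
        c_segment \<B> c \<Omega> y x0 x1 s \<in> E)"

definition dom_conv ::
  "('a::topological_space, 'n::finite) chart set \<Rightarrow> ('b::topological_space, 'n) chart set \<Rightarrow>
   'a set \<Rightarrow> 'b set \<Rightarrow> ('a \<Rightarrow> 'b \<Rightarrow> real) \<Rightarrow> ('b, 'n) metric \<Rightarrow> ('b \<Rightarrow> real) \<Rightarrow> bool" where
  "dom_conv \<A> \<B> \<Omega> \<Omega>' c g' \<rho>' \<longleftrightarrow>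
     c_convex_wrt \<B> c \<Omega> \<Omega> \<Omega>' \<and>
     c_convex_wrt \<A> (swap_cost c) \<Omega>' \<Omega>' \<Omega> \<and>
     c_convex_wrt \<A> (swap_cost c) \<Omega>' (spt \<B> g' \<rho>') \<Omega> \<and>
     spt \<B> g' \<rho>' \<subseteq> interior \<Omega>' \<and> compact (spt \<B> g' \<rho>')"

definition qq_conv ::
  "('a, 'n::finite) chart set \<Rightarrow> ('b, 'n) chart set \<Rightarrow> 'a set \<Rightarrow> 'b set \<Rightarrow>
   ('a \<Rightarrow> 'b \<Rightarrow> real) \<Rightarrow> bool" where
  "qq_conv \<A> \<B> \<Omega> \<Omega>' c \<longleftrightarrow>
     (\<exists>M0\<ge>1. \<forall>x\<in>\<Omega>. \<forall>x0\<in>\<Omega>. \<forall>x1\<in>\<Omega>. \<forall>y\<in>\<Omega>'. \<forall>y0\<in>\<Omega>'. \<forall>y1\<in>\<Omega>'. \<forall>s\<in>{0..1}. \<forall>t\<in>{0..1}.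
        (let yt = c_segment \<A> (swap_cost c) \<Omega>' x0 y0 y1 t in
           - c x yt + c x y0 - (- c x0 yt + c x0 y0)
             \<le> M0 * t * max 0 (- c x y1 + c x y0 - (- c x0 y1 + c x0 y0))) \<and>
        (let xs = c_segment \<B> c \<Omega> y0 x0 x1 s in
           - c xs y + c x0 y - (- c xs y0 + c x0 y0)
             \<le> M0 * s * max 0 (- c x1 y + c x0 y - (- c x1 y0 + c x0 y0))))"


section \<open>The Ma--Trudinger--Wang tensor\<close>

text \<open>\<open>c\<^sub>i\<^sub>,\<^sub>j\<close> has the unbarred index as row and the barred index as column, so its inverse has the
  barred index as row. The fourth derivative is written in an order that starts with a mixed
  second derivative (see \<open>mixed_orders\<close>). The arguments \<open>V W \<eta> \<zeta>\<close> are components of (co)vectors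
  at \<open>x\<close> in the chart \<open>\<kappa>\<close>.\<close>

definition MTW ::
  "('a \<Rightarrow> 'b \<Rightarrow> real) \<Rightarrow> ('a, 'n::finite) chart \<Rightarrow> ('b, 'n) chart \<Rightarrow> 'a \<Rightarrow> 'b \<Rightarrow>
   real ^ 'n \<Rightarrow> real ^ 'n \<Rightarrow> real ^ 'n \<Rightarrow> real ^ 'n \<Rightarrow> real" where
  "MTW c \<kappa> \<psi> x y V W \<eta> \<zeta> =
     (let d = (\<lambda>w. cost_partial c \<kappa> \<psi> w x y);
          Ci = matrix_inv (\<chi> i j. d [Inl i, Inr j])
      in \<Sum>i\<in>UNIV. \<Sum>j\<in>UNIV. \<Sum>r\<in>UNIV. \<Sum>s\<in>UNIV. \<Sum>k\<in>UNIV. \<Sum>l\<in>UNIV.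
           - (d [Inl i, Inr r, Inl j, Inr s]
              - (\<Sum>t\<in>UNIV. \<Sum>m\<in>UNIV.
                   d [Inl i, Inl j, Inr t] * Ci $ t $ m * d [Inr r, Inr s, Inl m]))
           * Ci $ r $ k * Ci $ s $ l * V $ i * W $ j * \<eta> $ k * \<zeta> $ l)"

definition A3w ::
  "('a, 'n::finite) chart set \<Rightarrow> ('b, 'n) chart set \<Rightarrow> 'a set \<Rightarrow> 'b set \<Rightarrow>
   ('a \<Rightarrow> 'b \<Rightarrow> real) \<Rightarrow> bool" where
  "A3w \<A> \<B> \<Omega> \<Omega>' c \<longleftrightarrow>
     (\<forall>x\<in>\<Omega>. \<forall>y\<in>\<Omega>'. \<forall>\<kappa>\<in>charts_at \<A> x. \<forall>\<psi>\<in>charts_at \<B> y. \<forall>V \<eta>.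
        \<eta> \<bullet> V = 0 \<longrightarrow> MTW c \<kappa> \<psi> x y V V \<eta> \<eta> \<ge> 0)"

end

theory Submission
  imports Defs
begin

text \<open>Fix a point \<open>x0\<close>, a curve \<open>\<delta>\<close> that is a \<open>c\<close>-segment with respect to \<open>x0\<close>, and another point \<open>x\<close>. The first
inequality of quantitative quasi-convexity speaks about the values at \<open>0\<close>, \<open>t\<close> and \<open>1\<close> of the function
\<open>f t = c x0 (\<delta> t) - c x (\<delta> t)\<close>, so everything depends on how \<open>f\<close> can bend.

To compute \<open>f''\<close> at a parameter \<open>\<tau>\<close>, join \<open>x0\<close> to \<open>x\<close> by the \<open>c\<close>-segment \<open>\<gamma>\<close> with respect to the single point
\<open>y = \<delta> \<tau>\<close> and put \<open>F s t = - c (\<gamma> s) (\<delta> t)\<close>. Then \<open>f = F 1 - F 0\<close>, so \<open>f' t\<close> is the integral over \<open>s\<close> of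
the mixed derivative of \<open>F\<close>, and \<open>f'' \<tau>\<close> is the integral of a function \<open>k s\<close>, the derivative of \<open>F\<close> in \<open>t\<close>,
\<open>s\<close>, \<open>t\<close> at \<open>(s, \<tau>)\<close>. Since \<open>\<delta>\<close> is a \<open>c\<close>-segment with respect to \<open>\<gamma> 0 = x0\<close>, \<open>k 0 = 0\<close>. Differentiating once more in
\<open>s\<close> produces the accelerations of both curves; because \<open>\<gamma>\<close> is a \<open>c\<close>-segment with respect to \<open>y\<close>, they combine to
exactly the Ma--Trudinger--Wang tensor, evaluated at the velocities of \<open>\<gamma>\<close> and \<open>\<delta>\<close>. The pairing of these
velocities under the mixed Hessian is the same for all \<open>s\<close>, and up to sign it is \<open>f' \<tau>\<close>. This is
\<open>second_variation\<close>, together with \<open>MTW_eq_curv\<close>. Taking the derivatives in the order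
\<open>t, s, t, s\<close> never uses a pure second derivative of \<open>c\<close>, which need not exist.

If (A3w) holds, the tensor is nonnegative on pairs with vanishing pairing, hence bounded below by a
constant times the pairing (\<open>curv_lower_bound\<close>). Compactness of the closures and nondegeneracy up to the
boundary make the constant and the velocities uniformly bounded (\<open>uniform_charts\<close>), which gives
\<open>f'' \<ge> - L \<bar>f'\<bar>\<close>. Such a function can only turn from decreasing to increasing, and it then keeps a definite
fraction of its slope, so \<open>f t - f 0 \<le> e\<^sup>L t (f 1 - f 0)\<^sub>+\<close> (\<open>quasi_convex_growth\<close>). The second inequality
is the first one for the cost with exchanged variables: the tensor is symmetric under this exchange
because partial derivatives commute (\<open>curv_swap\<close>).

Conversely, quasi-convexity forbids \<open>f\<close> to exceed both of its end values on a \<open>c\<close>-segment. If the tensor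
were negative at some pair of vectors with vanishing pairing, then for short \<open>\<gamma>\<close> in the first direction and
\<open>\<delta>\<close> through \<open>y\<close> in the second one, \<open>f' \<tau> = 0\<close> and \<open>f'' \<tau> < 0\<close>, a strict interior maximum
(\<open>curv_nonneg_of_max_principle\<close>).\<close>

section \<open>Partial derivatives in Euclidean space\<close>

text \<open>The increment of \<open>f\<close> is decomposed into increments along the basis directions, one after the other. Each of
them is a one-dimensional mean value estimate, in which the partial derivative may be
frozen at \<open>p\<close> up to \<open>e\<close> because it is continuous there.\<close>

lemma has_derivative_of_continuous_partials:
  fixes f :: "'e::euclidean_space \<Rightarrow> 'f::real_normed_vector"
  assumes "open S"
    and part: "\<And>p b. p \<in> S \<Longrightarrow> b \<in> Basis \<Longrightarrow>
      ((\<lambda>t. f (p + t *\<^sub>R b)) has_vector_derivative D b p) (at 0)"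
    and cont: "\<And>b. b \<in> Basis \<Longrightarrow> continuous_on S (D b)"
    and "p \<in> S"
  shows "(f has_derivative (\<lambda>h. \<Sum>b\<in>Basis. (h \<bullet> b) *\<^sub>R D b p)) (at p)"
proof -
  have line: "((\<lambda>t. f (q + t *\<^sub>R b)) has_vector_derivative D b (q + s *\<^sub>R b)) (at s)"
    if "q + s *\<^sub>R b \<in> S" "b \<in> Basis" for q b s
  proof -
    have "((\<lambda>t. f ((q + s *\<^sub>R b) + t *\<^sub>R b)) \<circ> (\<lambda>t. t - s) has_vector_derivative
        1 *\<^sub>R D b (q + s *\<^sub>R b)) (at s)"
      using part[OF that] by (intro vector_diff_chain_at) (auto intro!: derivative_eq_intros)
    then show ?thesis
      by (simp add: o_def algebra_simps)
  qed
  \<comment> \<open>The starting point \<open>q\<close> varies, since the next increment starts where the previous one ended.\<close>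
  have "\<exists>\<delta>>0. \<forall>q h. norm (q - p) < \<delta> \<longrightarrow> norm h < \<delta> \<longrightarrow>
      norm (f (q + (\<Sum>b\<in>B. (h \<bullet> b) *\<^sub>R b)) - f q - (\<Sum>b\<in>B. (h \<bullet> b) *\<^sub>R D b p))
        \<le> e * (\<Sum>b\<in>B. \<bar>h \<bullet> b\<bar>)" if "e > 0" "finite B" "B \<subseteq> Basis" for B e
    using that(2,3)
  proof (induction B rule: finite_induct)
    case empty
    then show ?case by (auto intro: exI[of _ 1])
  next
    case (insert b B)
    then have b: "b \<in> Basis" by auto
    obtain d1 where d1: "d1 > 0" "\<And>q h. norm (q - p) < d1 \<Longrightarrow> norm h < d1 \<Longrightarrow>
      norm (f (q + (\<Sum>b\<in>B. (h \<bullet> b) *\<^sub>R b)) - f q - (\<Sum>b\<in>B. (h \<bullet> b) *\<^sub>R D b p))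
        \<le> e * (\<Sum>b\<in>B. \<bar>h \<bullet> b\<bar>)"
      using insert by auto
    have "isCont (D b) p"
      using cont[OF b] \<open>open S\<close> \<open>p \<in> S\<close> continuous_on_eq_continuous_at by blast
    then obtain d2 where d2: "d2 > 0" "\<And>q. dist q p < d2 \<Longrightarrow> dist (D b q) (D b p) < e"
      using \<open>e > 0\<close> unfolding continuous_at_eps_delta dist_norm by blast
    obtain d3 where d3: "d3 > 0" "ball p d3 \<subseteq> S"
      using \<open>open S\<close> \<open>p \<in> S\<close> openE by blast
    define d where "d = min d1 (min d2 d3) / 2"
    have "d > 0" using d1 d2 d3 by (simp add: d_def)
    moreover have "norm (f (q + (\<Sum>b\<in>insert b B. (h \<bullet> b) *\<^sub>R b)) - f q
        - (\<Sum>b\<in>insert b B. (h \<bullet> b) *\<^sub>R D b p)) \<le> e * (\<Sum>b\<in>insert b B. \<bar>h \<bullet> b\<bar>)"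
      if q: "norm (q - p) < d" and h: "norm h < d" for q h
    proof -
      define q' where "q' = q + (h \<bullet> b) *\<^sub>R b"
      have hb: "\<bar>h \<bullet> b\<bar> \<le> norm h" using b by (simp add: Basis_le_norm)
      have near: "dist (q + t *\<^sub>R b) p < 2 * d" if "\<bar>t\<bar> \<le> \<bar>h \<bullet> b\<bar>" for t
      proof -
        have "dist (q + t *\<^sub>R b) p \<le> norm (q - p) + norm (t *\<^sub>R b)"
          unfolding dist_norm by (metis add_diff_eq diff_add_eq norm_triangle_ineq)
        also have "norm (t *\<^sub>R b) \<le> norm h" using that hb b by simp
        finally show ?thesis using q h by linarith
      qed
      have 1: "norm (f (q' + (\<Sum>b\<in>B. (h \<bullet> b) *\<^sub>R b)) - f q' - (\<Sum>b\<in>B. (h \<bullet> b) *\<^sub>R D b p))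
        \<le> e * (\<Sum>b\<in>B. \<bar>h \<bullet> b\<bar>)"
        using near[of "h \<bullet> b"] h order.strict_trans1[OF norm_ge_zero h]
        by (intro d1) (auto simp: q'_def d_def dist_norm)
      define I where "I = closed_segment 0 (h \<bullet> b)"
      have I: "\<bar>t\<bar> \<le> \<bar>h \<bullet> b\<bar>" if "t \<in> I" for t
        using that by (auto simp: I_def closed_segment_eq_real_ivl split: if_splits)
      have "norm ((f (q + (h \<bullet> b) *\<^sub>R b) - (h \<bullet> b) *\<^sub>R D b p)
            - (f (q + 0 *\<^sub>R b) - 0 *\<^sub>R D b p)) \<le> e * norm (h \<bullet> b - 0)"
      proof (rule differentiable_bound[where S=I and f="\<lambda>t. f (q + t *\<^sub>R b) - t *\<^sub>R D b p"
            and f'="\<lambda>t r. r *\<^sub>R (D b (q + t *\<^sub>R b) - D b p)"])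
        fix t assume t: "t \<in> I"
        have tS: "dist (q + t *\<^sub>R b) p < d2" "q + t *\<^sub>R b \<in> S"
          using near[OF I[OF t]] d3 by (auto simp: d_def dist_commute subset_eq)
        have "((\<lambda>t. f (q + t *\<^sub>R b) - t *\<^sub>R D b p) has_vector_derivative
            D b (q + t *\<^sub>R b) - D b p) (at t)"
          by (rule derivative_eq_intros line tS b refl)+ simp
        then show "((\<lambda>t. f (q + t *\<^sub>R b) - t *\<^sub>R D b p) has_derivative
            (\<lambda>r. r *\<^sub>R (D b (q + t *\<^sub>R b) - D b p))) (at t within I)"
          unfolding has_vector_derivative_def using has_derivative_at_withinI by blast
        show "onorm (\<lambda>r. r *\<^sub>R (D b (q + t *\<^sub>R b) - D b p)) \<le> e"
          using d2(2)[OF tS(1)] 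
          by (intro onorm_le) (simp add: dist_norm mult.commute[of e] mult_left_mono)
      qed (auto simp: I_def)
      then have 2: "norm (f q' - f q - (h \<bullet> b) *\<^sub>R D b p) \<le> e * \<bar>h \<bullet> b\<bar>"
        by (simp add: q'_def algebra_simps)
      have "norm (f (q + (\<Sum>b\<in>insert b B. (h \<bullet> b) *\<^sub>R b)) - f q
          - (\<Sum>b\<in>insert b B. (h \<bullet> b) *\<^sub>R D b p)) =
        norm ((f (q' + (\<Sum>b\<in>B. (h \<bullet> b) *\<^sub>R b)) - f q' - (\<Sum>b\<in>B. (h \<bullet> b) *\<^sub>R D b p))
          + (f q' - f q - (h \<bullet> b) *\<^sub>R D b p))"
        using insert by (simp add: q'_def algebra_simps)
      also have "\<dots> \<le> e * (\<Sum>b\<in>B. \<bar>h \<bullet> b\<bar>) + e * \<bar>h \<bullet> b\<bar>"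
        using 1 2 norm_triangle_le by (smt (verit))
      finally show ?thesis using insert by (simp add: algebra_simps)
    qed
    ultimately show ?case by blast
  qed note main = this
  show ?thesis
  proof (rule has_derivativeI)
    show "bounded_linear (\<lambda>h. \<Sum>b\<in>Basis. (h \<bullet> b) *\<^sub>R D b p)"
      by (intro bounded_linear_sum bounded_linear_scaleR_const bounded_linear_inner_left)
    show "((\<lambda>y. (f y - f p - (\<Sum>b\<in>Basis. ((y - p) \<bullet> b) *\<^sub>R D b p)) /\<^sub>R norm (y - p)) \<longlongrightarrow> 0) (at p)"
      unfolding tendsto_iff
    proof safe
      fix e :: real assume "e > 0"
      define e' where "e' = e / (2 * DIM('e))"
      have "e' > 0" using \<open>e > 0\<close> by (simp add: e'_def)
      from main[OF this finite_Basis] obtain d where d: "d > 0"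
        "\<And>q h. norm (q - p) < d \<Longrightarrow> norm h < d \<Longrightarrow>
        norm (f (q + (\<Sum>b\<in>Basis. (h \<bullet> b) *\<^sub>R b)) - f q - (\<Sum>b\<in>Basis. (h \<bullet> b) *\<^sub>R D b p))
        \<le> e' * (\<Sum>b\<in>Basis. \<bar>h \<bullet> b\<bar>)" by blast
      have "dist ((f y - f p - (\<Sum>b\<in>Basis. ((y - p) \<bullet> b) *\<^sub>R D b p)) /\<^sub>R norm (y - p)) 0 < e"
        if "dist y p < d" "y \<noteq> p" for y
      proof -
        have "norm (f y - f p - (\<Sum>b\<in>Basis. ((y - p) \<bullet> b) *\<^sub>R D b p))
          \<le> e' * (\<Sum>b\<in>Basis. \<bar>(y - p) \<bullet> b\<bar>)"
          using d(2)[of p "y - p"] d(1) that by (simp add: euclidean_representation dist_norm)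
        also have "\<dots> \<le> e' * (DIM('e) * norm (y - p))"
          using \<open>e' > 0\<close> by (intro mult_left_mono sum_bounded_above) (auto simp: Basis_le_norm)
        also have "\<dots> = e / 2 * norm (y - p)" by (simp add: e'_def)
        also have "\<dots> < e * norm (y - p)" using that \<open>e > 0\<close> by simp
        finally show ?thesis using that
          by (simp add: inverse_eq_divide pos_divide_less_eq del: scaleR_right_diff_distrib)
      qed
      then show "\<forall>\<^sub>F x in at p. dist ((f x - f p - (\<Sum>b\<in>Basis. ((x - p) \<bullet> b) *\<^sub>R D b p)) /\<^sub>R norm (x - p)) 0 < e"
        using d(1) unfolding eventually_at by auto
    qed
  qed
qed

text \<open>The second difference is symmetric in the two directions, whereas the mean value theorem, applied first in
direction \<open>a\<close> and then in direction \<open>b\<close>, expresses it by one of the two mixed derivatives. This asymmetry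
is what proves that mixed derivatives commute.\<close>

lemma second_difference_mean_value:
  fixes f :: "'e::real_normed_vector \<Rightarrow> real"
  assumes h: "h > 0"
    and box: "\<And>s t. 0 \<le> s \<Longrightarrow> s \<le> h \<Longrightarrow> 0 \<le> t \<Longrightarrow> t \<le> h \<Longrightarrow> p + s *\<^sub>R a + t *\<^sub>R b \<in> S"
    and Da: "\<And>q. q \<in> S \<Longrightarrow> ((\<lambda>t. f (q + t *\<^sub>R a)) has_real_derivative Da q) (at 0)"
    and Dba: "\<And>q. q \<in> S \<Longrightarrow> ((\<lambda>t. Da (q + t *\<^sub>R b)) has_real_derivative Dba q) (at 0)"
  shows "\<exists>s t. 0 < s \<and> s < h \<and> 0 < t \<and> t < h \<and>
    f (p + h *\<^sub>R a + h *\<^sub>R b) - f (p + h *\<^sub>R a) - f (p + h *\<^sub>R b) + f p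
      = h\<^sup>2 * Dba (p + s *\<^sub>R a + t *\<^sub>R b)"
proof -
  have shift: "((\<lambda>t. F (q + t *\<^sub>R a)) has_real_derivative F' (q + s *\<^sub>R a)) (at s)"
    if "q + s *\<^sub>R a \<in> S" and F: "\<And>q. q \<in> S \<Longrightarrow> ((\<lambda>t. F (q + t *\<^sub>R a)) has_real_derivative F' q) (at 0)"
    for q s a F F'
  proof -
    have "(((\<lambda>t. F ((q + s *\<^sub>R a) + t *\<^sub>R a)) \<circ> (\<lambda>t. t - s)) has_real_derivative
        F' (q + s *\<^sub>R a) * 1) (at s)"
      using F[OF that(1)] by (intro DERIV_chain) (auto intro!: derivative_eq_intros)
    then show ?thesis by (simp add: o_def algebra_simps)
  qed
  define \<phi> where "\<phi> = (\<lambda>t. f ((p + h *\<^sub>R b) + t *\<^sub>R a) - f (p + t *\<^sub>R a))"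
  have d\<phi>: "(\<phi> has_real_derivative Da ((p + h *\<^sub>R b) + t *\<^sub>R a) - Da (p + t *\<^sub>R a)) (at t)"
    if "0 \<le> t" "t \<le> h" for t
    unfolding \<phi>_def
    using box[OF that, of h] box[OF that, of 0] h
    by (intro DERIV_diff shift[where F=f and F'=Da, OF _ Da]) (auto simp: algebra_simps)
  obtain s where s: "0 < s" "s < h"
    "\<phi> h - \<phi> 0 = (h - 0) * (Da ((p + h *\<^sub>R b) + s *\<^sub>R a) - Da (p + s *\<^sub>R a))"
    using MVT2[OF h, of \<phi> "\<lambda>s. Da ((p + h *\<^sub>R b) + s *\<^sub>R a) - Da (p + s *\<^sub>R a)"] d\<phi>
    by blast
  have d2: "((\<lambda>t. Da ((p + s *\<^sub>R a) + t *\<^sub>R b)) has_real_derivative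
      Dba ((p + s *\<^sub>R a) + t *\<^sub>R b)) (at t)" if "0 \<le> t" "t \<le> h" for t
    using box[of s t] that s by (intro shift[where F=Da and F'=Dba, OF _ Dba]) auto
  obtain t where t: "0 < t" "t < h"
    "Da ((p + s *\<^sub>R a) + h *\<^sub>R b) - Da ((p + s *\<^sub>R a) + 0 *\<^sub>R b) = (h - 0) * Dba ((p + s *\<^sub>R a) + t *\<^sub>R b)"
    using MVT2[OF h, of "\<lambda>t. Da ((p + s *\<^sub>R a) + t *\<^sub>R b)" "\<lambda>t. Dba ((p + s *\<^sub>R a) + t *\<^sub>R b)"] d2
    by blast
  have "f (p + h *\<^sub>R a + h *\<^sub>R b) - f (p + h *\<^sub>R a) - f (p + h *\<^sub>R b) + f p
      = h\<^sup>2 * Dba (p + s *\<^sub>R a + t *\<^sub>R b)"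
    using s(3) t(3) by (simp add: \<phi>_def power2_eq_square algebra_simps)
  with s t show ?thesis by blast
qed

lemma mixed_partials_commute:
  fixes f :: "'e::real_normed_vector \<Rightarrow> real"
  assumes S: "open S" "p \<in> S"
    and Da: "\<And>q. q \<in> S \<Longrightarrow> ((\<lambda>t. f (q + t *\<^sub>R a)) has_real_derivative Da q) (at 0)"
    and Db: "\<And>q. q \<in> S \<Longrightarrow> ((\<lambda>t. f (q + t *\<^sub>R b)) has_real_derivative Db q) (at 0)"
    and Dba: "\<And>q. q \<in> S \<Longrightarrow> ((\<lambda>t. Da (q + t *\<^sub>R b)) has_real_derivative Dba q) (at 0)"
    and Dab: "\<And>q. q \<in> S \<Longrightarrow> ((\<lambda>t. Db (q + t *\<^sub>R a)) has_real_derivative Dab q) (at 0)"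
    and cont: "continuous_on S Dba" "continuous_on S Dab"
  shows "Dba p = Dab p"
proof (rule ccontr)
  assume ne: "Dba p \<noteq> Dab p"
  define e where "e = \<bar>Dba p - Dab p\<bar> / 2"
  have "e > 0" using ne by (simp add: e_def)
  have "isCont Dba p" "isCont Dab p"
    using cont S continuous_on_eq_continuous_at by blast+
  then obtain d1 d2 where d1: "d1 > 0" "\<And>q. norm (q - p) < d1 \<Longrightarrow> norm (Dba q - Dba p) < e"
    and d2: "d2 > 0" "\<And>q. norm (q - p) < d2 \<Longrightarrow> norm (Dab q - Dab p) < e"
    using \<open>e > 0\<close> unfolding continuous_at_eps_delta by (auto simp: dist_norm) blast
  obtain d3 where d3: "d3 > 0" "ball p d3 \<subseteq> S" using S openE by blast
  define d where "d = min d1 (min d2 d3)"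
  define N where "N = norm a + norm b + 1"
  define h where "h = d / (2 * N)"
  have "d > 0" using d1 d2 d3 by (simp add: d_def)
  have N: "N > 0" by (simp add: N_def add_nonneg_pos)
  with \<open>d > 0\<close> have "h > 0" by (simp add: h_def)
  have near: "norm (s *\<^sub>R a + t *\<^sub>R b) < d" if "0 \<le> s" "s \<le> h" "0 \<le> t" "t \<le> h" for s t
  proof -
    have "norm (s *\<^sub>R a + t *\<^sub>R b) \<le> s * norm a + t * norm b"
      using norm_triangle_ineq[of "s *\<^sub>R a" "t *\<^sub>R b"] that by simp
    also have "\<dots> \<le> h * norm a + h * norm b"
      using that by (intro add_mono mult_right_mono) auto
    also have "\<dots> < h * norm a + h * norm b + h" using \<open>h > 0\<close> by simp
    also have "\<dots> = h * N" by (simp add: N_def algebra_simps)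
    also have "\<dots> = d / 2" using N by (simp add: h_def)
    finally show ?thesis using \<open>d > 0\<close> by simp
  qed
  have inS: "p + s *\<^sub>R a + t *\<^sub>R b \<in> S" if "0 \<le> s" "s \<le> h" "0 \<le> t" "t \<le> h" for s t
  proof -
    have "p + s *\<^sub>R a + t *\<^sub>R b \<in> ball p d3"
    proof -
      have "dist p (p + s *\<^sub>R a + t *\<^sub>R b) = norm (s *\<^sub>R a + t *\<^sub>R b)"
        by (metis add.assoc add_diff_cancel_left' dist_commute dist_norm)
      then show ?thesis using near[OF that] by (simp add: d_def)
    qed
    then show ?thesis using d3 by blast
  qed
  obtain s t where st: "0 < s" "s < h" "0 < t" "t < h"
    "f (p + h *\<^sub>R a + h *\<^sub>R b) - f (p + h *\<^sub>R a) - f (p + h *\<^sub>R b) + f p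
      = h\<^sup>2 * Dba (p + s *\<^sub>R a + t *\<^sub>R b)"
    using second_difference_mean_value[where f=f and S=S and Da=Da and Dba=Dba, OF \<open>h > 0\<close> inS Da Dba] by blast
  have inS': "p + s *\<^sub>R b + t *\<^sub>R a \<in> S" if "0 \<le> s" "s \<le> h" "0 \<le> t" "t \<le> h" for s t
    using inS[of t s] that by (simp add: add.assoc add.commute[of "s *\<^sub>R b"])
  obtain s' t' where st': "0 < s'" "s' < h" "0 < t'" "t' < h"
    "f (p + h *\<^sub>R b + h *\<^sub>R a) - f (p + h *\<^sub>R b) - f (p + h *\<^sub>R a) + f p
      = h\<^sup>2 * Dab (p + s' *\<^sub>R b + t' *\<^sub>R a)"
    using second_difference_mean_value[where f=f and S=S and Da=Db and Dba=Dab, OF \<open>h > 0\<close> inS' Db Dab] by blast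
  have "h\<^sup>2 * Dba (p + s *\<^sub>R a + t *\<^sub>R b) = h\<^sup>2 * Dab (p + s' *\<^sub>R b + t' *\<^sub>R a)"
    using st(5) st'(5) add.commute[of "h *\<^sub>R b"]
    by (smt (verit) add.assoc)
  then have eq: "Dba (p + s *\<^sub>R a + t *\<^sub>R b) = Dab (p + s' *\<^sub>R b + t' *\<^sub>R a)"
    using \<open>h > 0\<close> by simp
  have "norm (Dba (p + s *\<^sub>R a + t *\<^sub>R b) - Dba p) < e"
    using near[of s t] st by (intro d1) (auto simp: d_def add.assoc)
  moreover have "norm (Dab (p + s' *\<^sub>R b + t' *\<^sub>R a) - Dab p) < e"
    using near[of t' s'] st' by (intro d2) (auto simp: d_def add.assoc add.commute[of "t' *\<^sub>R a"])
  moreover have "\<bar>Dba p - Dab p\<bar> = 2 * e" by (simp add: e_def)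
  ultimately show False using eq by (simp add: abs_if split: if_splits)
qed

lemma iter_partial_has_vector_derivative:
  assumes "iter_partial_exists (v # vs) f S" "p \<in> S"
  shows "((\<lambda>t. iter_partial vs f (p + t *\<^sub>R v)) has_vector_derivative iter_partial (v # vs) f p) (at 0)"
  using assms by (simp add: vector_derivative_works)

lemma Basis_vec_real: "(Basis :: (real ^ 'n::finite) set) = range (\<lambda>i. axis i 1)"
  by (auto simp: Basis_vec_def)

lemma sum_Basis_vec_real:
  "(\<Sum>b\<in>(Basis :: (real ^ 'n::finite) set). F b) = (\<Sum>i\<in>UNIV. F (axis i 1))"
  unfolding Basis_vec_real
  by (subst sum.reindex) (auto simp: inj_on_def axis_eq_axis)

lemma has_derivative_of_coordinate_partials:
  fixes f :: "real ^ 'n::finite \<Rightarrow> 'f::real_normed_vector"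
  assumes "open S"
    and "\<And>p i. p \<in> S \<Longrightarrow> ((\<lambda>t. f (p + t *\<^sub>R axis i 1)) has_vector_derivative D i p) (at 0)"
    and "\<And>i. continuous_on S (D i)" and "p \<in> S"
  shows "(f has_derivative (\<lambda>h. \<Sum>i\<in>UNIV. h $ i *\<^sub>R D i p)) (at p)"
proof -
  define E where "E b = D (SOME i. b = axis i 1)" for b :: "real ^ 'n"
  have E: "E (axis i 1) = D i" for i
    by (simp add: E_def axis_eq_axis)
  have "(f has_derivative (\<lambda>h. \<Sum>b\<in>Basis. (h \<bullet> b) *\<^sub>R E b p)) (at p)"
    using assms by (intro has_derivative_of_continuous_partials[where S=S]) (auto simp: Basis_vec_real E)
  then show ?thesis
    by (simp add: sum_Basis_vec_real E inner_axis)
qed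

lemma has_vector_derivative_components:
  fixes x :: "real \<Rightarrow> real ^ 'n::finite"
  assumes "\<And>k. ((\<lambda>t. x t $ k) has_real_derivative x' $ k) (at s)"
  shows "(x has_vector_derivative x') (at s)"
  unfolding has_vector_derivative_def
  by (subst has_derivative_componentwise_within)
     (use assms in \<open>auto simp: Basis_vec_real inner_axis has_field_derivative_def mult_commute_abs\<close>)

section \<open>Linear systems and quadratic forms\<close>

lemma matrix_inv_inverse:
  fixes A :: "real ^ 'n::finite ^ 'n"
  assumes "invertible A"
  shows "A ** matrix_inv A = mat 1" "matrix_inv A ** A = mat 1"
proof -
  have "A ** matrix_inv A = mat 1 \<and> matrix_inv A ** A = mat 1"
    using assms unfolding invertible_def matrix_inv_def by (rule someI_ex)
  then show "A ** matrix_inv A = mat 1" "matrix_inv A ** A = mat 1" by blast+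
qed

lemma continuous_on_det:
  fixes M :: "'s::topological_space \<Rightarrow> real ^ 'n::finite ^ 'n"
  assumes "\<And>i j. continuous_on S (\<lambda>s. M s $ i $ j)"
  shows "continuous_on S (\<lambda>s. det (M s))"
  unfolding det_def
  by (intro continuous_on_sum continuous_on_mult continuous_on_const continuous_on_prod assms)

text \<open>Cramer's rule writes the solution as a quotient of polynomials in the data, with nonvanishing denominator.\<close>

lemma continuous_on_linear_solution:
  fixes A :: "'s::topological_space \<Rightarrow> real ^ 'n::finite ^ 'n"
  assumes A: "\<And>i j. continuous_on I (\<lambda>s. A s $ i $ j)" and b: "\<And>i. continuous_on I (\<lambda>s. b s $ i)"
    and det: "\<And>s. s \<in> I \<Longrightarrow> det (A s) \<noteq> 0" and eq: "\<And>s. s \<in> I \<Longrightarrow> A s *v x s = b s"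
  shows "continuous_on I x"
proof -
  have "continuous_on I (\<lambda>s. \<chi> k. det (\<chi> i j. if j = k then b s $ i else A s $ i $ j) / det (A s))"
  proof (intro continuous_on_vec_lambda continuous_on_divide continuous_on_det ballI)
    show "continuous_on I (\<lambda>s. (\<chi> i j. if j = k then b s $ i else A s $ i $ j) $ i $ j)" for i j k
      using A b by (cases "j = k") auto
  qed (use A det in auto)
  then show ?thesis
  proof (rule continuous_on_eq)
    fix s assume "s \<in> I"
    from cramer[OF det[OF this], THEN iffD1, OF eq[OF this]]
    show "(\<chi> k. det (\<chi> i j. if j = k then b s $ i else A s $ i $ j) / det (A s)) = x s" ..
  qed
qed

text \<open>Subtracting the equations at \<open>t\<close> and \<open>s\<close> shows that the difference quotient of \<open>x\<close> solves a linear system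
whose matrix is the constant \<open>A s\<close>; its limit exists because \<open>x\<close> is already known to be continuous. The
derivative solves a system of the same kind, which gives its continuity. For the
velocity of a \<open>c\<close>-segment this provides the acceleration and the equation that it satisfies.\<close>

lemma linear_solution_C1:
  fixes A A' :: "real \<Rightarrow> real ^ 'n::finite ^ 'n"
  assumes "open I"
    and A: "\<And>s i j. s \<in> I \<Longrightarrow> ((\<lambda>s. A s $ i $ j) has_real_derivative A' s $ i $ j) (at s)"
    and A': "\<And>i j. continuous_on I (\<lambda>s. A' s $ i $ j)"
    and det: "\<And>s. s \<in> I \<Longrightarrow> det (A s) \<noteq> 0" and eq: "\<And>s. s \<in> I \<Longrightarrow> A s *v x s = b"
  obtains x' where "\<And>s. s \<in> I \<Longrightarrow> (x has_vector_derivative x' s) (at s)" "continuous_on I x'"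
    "\<And>s. s \<in> I \<Longrightarrow> A s *v x' s = - (A' s *v x s)"
proof -
  have contA: "continuous_on I (\<lambda>s. A s $ i $ j)" for i j
    using A \<open>open I\<close> by (meson DERIV_isCont continuous_at_imp_continuous_on)
  have contx: "continuous_on I x"
    using contA det eq by (intro continuous_on_linear_solution[where A=A and b="\<lambda>_. b"]) auto
  define x' where "x' s = matrix_inv (A s) *v (- (A' s *v x s))" for s
  have inv: "A s ** matrix_inv (A s) = mat 1" "matrix_inv (A s) ** A s = mat 1" if "s \<in> I" for s
    using det[OF that] matrix_inv_inverse[of "A s"] by (simp_all add: invertible_det_nz)
  have deriv: "(x has_vector_derivative x' s) (at s)" if s: "s \<in> I" for s
  proof -
    define B where "B = matrix_inv (A s)"
    have quot: "(x t $ k - x s $ k) / (t - s)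
        = - (\<Sum>m\<in>UNIV. B $ k $ m * (\<Sum>j\<in>UNIV. (A t $ m $ j - A s $ m $ j) / (t - s) * x t $ j))"
      if t: "t \<in> I" "t \<noteq> s" for t k
    proof -
      have "A s *v (x t - x s) = - ((A t - A s) *v x t)"
        using eq[OF s] eq[OF t(1)]
        by (simp add: matrix_vector_mult_diff_distrib matrix_vector_mult_diff_rdistrib)
      then have "B *v (A s *v (x t - x s)) = - (B *v ((A t - A s) *v x t))"
        by (simp add: vec_eq_iff matrix_vector_mult_def sum_negf)
      then have "x t - x s = - (B *v ((A t - A s) *v x t))"
        using inv(2)[OF s] by (simp add: matrix_vector_mul_assoc B_def)
      then have "x t $ k - x s $ k = - (\<Sum>m\<in>UNIV. B $ k $ m * (\<Sum>j\<in>UNIV. (A t $ m $ j - A s $ m $ j) * x t $ j))"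
        by (simp add: vec_eq_iff matrix_vector_mult_def)
      then show ?thesis
        by (simp add: sum_divide_distrib sum_distrib_left)
    qed
    have "((\<lambda>t. x t $ k) has_real_derivative x' s $ k) (at s)" for k
    proof -
      have xlim: "((\<lambda>t. x t $ j) \<longlongrightarrow> x s $ j) (at s)" for j
        using continuous_on_eq_continuous_at[OF \<open>open I\<close>, of x] contx s
        by (intro tendsto_vec_nth) (auto simp: isCont_def)
      have Alim: "((\<lambda>t. (A t $ m $ j - A s $ m $ j) / (t - s)) \<longlongrightarrow> A' s $ m $ j) (at s)" for m j
        using A[OF s] by (simp add: has_field_derivative_iff)
      have "((\<lambda>t. - (\<Sum>m\<in>UNIV. B $ k $ m * (\<Sum>j\<in>UNIV. (A t $ m $ j - A s $ m $ j) / (t - s) * x t $ j)))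
          \<longlongrightarrow> - (\<Sum>m\<in>UNIV. B $ k $ m * (\<Sum>j\<in>UNIV. A' s $ m $ j * x s $ j))) (at s)"
        by (intro tendsto_intros xlim Alim)
      also have "- (\<Sum>m\<in>UNIV. B $ k $ m * (\<Sum>j\<in>UNIV. A' s $ m $ j * x s $ j)) = x' s $ k"
        by (simp add: x'_def B_def matrix_vector_mult_def sum_negf)
      finally have lim: "((\<lambda>t. - (\<Sum>m\<in>UNIV. B $ k $ m * (\<Sum>j\<in>UNIV. (A t $ m $ j - A s $ m $ j) / (t - s) * x t $ j)))
          \<longlongrightarrow> x' s $ k) (at s)" .
      have "\<forall>\<^sub>F t in at s. t \<in> I \<and> t \<noteq> s"
        using \<open>open I\<close> s unfolding eventually_at_topological by blast
      then have "\<forall>\<^sub>F t in at s. - (\<Sum>m\<in>UNIV. B $ k $ m * (\<Sum>j\<in>UNIV. (A t $ m $ j - A s $ m $ j) / (t - s) * x t $ j))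
          = (x t $ k - x s $ k) / (t - s)"
        by eventually_elim (use quot in auto)
      then show ?thesis
        unfolding has_field_derivative_iff using lim by (rule Lim_transform_eventually[rotated])
    qed
    then show ?thesis by (rule has_vector_derivative_components)
  qed
  have eq': "A s *v x' s = - (A' s *v x s)" if "s \<in> I" for s
    using inv(1)[OF that] by (simp add: x'_def matrix_vector_mul_assoc)
  have "continuous_on I x'"
  proof (rule continuous_on_linear_solution[where A=A and b="\<lambda>s. - (A' s *v x s)"])
    have x: "continuous_on I (\<lambda>s. x s $ j)" for j
      using contx by (intro continuous_intros)
    have "(\<lambda>s. (- (A' s *v x s)) $ i) = (\<lambda>s. - (\<Sum>j\<in>UNIV. A' s $ i $ j * x s $ j))" for i
      by (simp add: matrix_vector_mult_def)
    then show "continuous_on I (\<lambda>s. (- (A' s *v x s)) $ i)" for i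
      by (simp only:) (intro continuous_on_minus continuous_on_sum continuous_on_mult A' x)
  qed (use contA det eq' in auto)
  with deriv show ?thesis using eq' by (rule that)
qed

text \<open>On the product of a compact set with the unit sphere, \<open>norm (M s *v z)\<close> attains a positive minimum.\<close>

lemma uniform_injectivity:
  fixes M :: "'s::topological_space \<Rightarrow> real ^ 'n::finite ^ 'n"
  assumes "compact S" and M: "\<And>i j. continuous_on S (\<lambda>s. M s $ i $ j)"
    and det: "\<And>s. s \<in> S \<Longrightarrow> det (M s) \<noteq> 0"
  shows "\<exists>K>0. \<forall>s\<in>S. \<forall>z. norm z \<le> K * norm (M s *v z)"
proof (cases "S = {}")
  case False
  define f where "f = (\<lambda>(s, z). norm (M s *v z))"
  define Z where "Z = sphere 0 1 \<inter> (UNIV :: (real ^ 'n) set)"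
  have Z: "compact Z" "Z \<noteq> {}" by (auto simp: Z_def)
  have MS: "continuous_on (S \<times> Z) (\<lambda>p. M (fst p) $ i $ j)" for i j
    by (rule continuous_on_compose2[OF M]) (auto intro!: continuous_intros)
  have "continuous_on (S \<times> Z) (\<lambda>p. \<chi> i. \<Sum>j\<in>UNIV. M (fst p) $ i $ j * snd p $ j)"
    by (intro continuous_on_vec_lambda continuous_on_sum continuous_on_mult MS
        continuous_on_component continuous_on_snd continuous_on_id)
  then have "continuous_on (S \<times> Z) f"
    unfolding f_def case_prod_beta matrix_vector_mult_def by (rule continuous_on_norm)
  then obtain p where p: "p \<in> S \<times> Z" "\<And>q. q \<in> S \<times> Z \<Longrightarrow> f p \<le> f q"
    using continuous_attains_inf[of "S \<times> Z" f] compact_Times[OF \<open>compact S\<close> Z(1)] False Z(2) by auto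
  have "f p > 0"
  proof -
    obtain s z where sz: "p = (s, z)" "s \<in> S" "z \<in> Z" using p by auto
    have "M s *v z \<noteq> 0"
    proof
      assume "M s *v z = 0"
      moreover have "invertible (M s)" using det[OF sz(2)] by (simp add: invertible_det_nz)
      ultimately have "z = 0" by (metis invertible_def matrix_left_invertible_ker)
      then show False using sz(3) by (simp add: Z_def)
    qed
    then show ?thesis by (simp add: f_def sz)
  qed
  have "norm z \<le> (1 / f p) * norm (M s *v z)" if "s \<in> S" for s z
  proof (cases "z = 0")
    case False
    have "f p \<le> f (s, (1 / norm z) *\<^sub>R z)"
      using that False by (intro p) (auto simp: Z_def)
    also have "\<dots> = norm (M s *v z) / norm z"
      by (simp add: f_def matrix_vector_mult_scaleR)
    finally show ?thesis using False \<open>f p > 0\<close> by (simp add: field_simps)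
  qed simp
  then show ?thesis using \<open>f p > 0\<close> by (intro exI[of _ "1 / f p"]) auto
qed (auto intro: exI[of _ 1])

text \<open>Split \<open>V\<close> into its component along \<open>\<eta>\<close>, whose length is \<open>\<bar>V \<bullet> \<eta>\<bar> / norm \<eta>\<close>, and the orthogonal rest. Nonnegativity
is available on the rest, and all remaining terms contain the component along \<open>\<eta>\<close> as a factor.\<close>

lemma quadratic_form_lower_bound:
  fixes R :: "'n::finite \<Rightarrow> 'n \<Rightarrow> real" and V \<eta> :: "real ^ 'n"
  defines "q \<equiv> \<lambda>V :: real ^ 'n. \<Sum>i\<in>UNIV. \<Sum>k\<in>UNIV. R i k * V $ i * V $ k"
  assumes R: "\<And>i k. \<bar>R i k\<bar> \<le> E" and pos: "\<And>V. V \<bullet> \<eta> = 0 \<Longrightarrow> q V \<ge> 0" and "\<eta> \<noteq> 0"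
  shows "q V \<ge> - (2 * real CARD('n) ^ 2 * E * norm V * \<bar>V \<bullet> \<eta>\<bar> / norm \<eta>)"
proof -
  define \<delta> where "\<delta> = (V \<bullet> \<eta> / (\<eta> \<bullet> \<eta>)) *\<^sub>R \<eta>"
  define V' where "V' = V - \<delta>"
  have \<eta>: "\<eta> \<bullet> \<eta> \<noteq> 0" using \<open>\<eta> \<noteq> 0\<close> by simp
  have orth: "V' \<bullet> \<eta> = 0" using \<eta> by (simp add: V'_def \<delta>_def inner_diff_left)
  have n\<delta>: "norm \<delta> = \<bar>V \<bullet> \<eta>\<bar> / norm \<eta>"
    using \<open>\<eta> \<noteq> 0\<close> by (simp add: \<delta>_def dot_square_norm power2_eq_square)
  have "V = V' + \<delta>" by (simp add: V'_def)
  moreover have "V' \<bullet> \<delta> = 0" using orth by (simp add: \<delta>_def)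
  ultimately have "(norm V)\<^sup>2 = (norm V')\<^sup>2 + (norm \<delta>)\<^sup>2"
    by (simp add: power2_norm_eq_inner inner_add_left inner_add_right inner_commute)
  then have nV': "norm V' \<le> norm V" by (simp add: power2_le_imp_le)
  have "\<bar>q V - q V'\<bar> \<le> (\<Sum>i\<in>(UNIV::'n set). \<Sum>k\<in>(UNIV::'n set). 2 * E * norm V * norm \<delta>)"
  proof -
    have "q V - q V' = (\<Sum>i\<in>UNIV. \<Sum>k\<in>UNIV. R i k * (V $ i * \<delta> $ k + \<delta> $ i * V' $ k))"
      unfolding q_def sum_subtractf[symmetric]
      by (intro sum.cong refl) (simp add: V'_def algebra_simps)
    also have "\<bar>\<dots>\<bar> \<le> (\<Sum>i\<in>UNIV. \<Sum>k\<in>UNIV. \<bar>R i k * (V $ i * \<delta> $ k + \<delta> $ i * V' $ k)\<bar>)"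
      by (intro order_trans[OF sum_abs] sum_mono sum_abs)
    also have "\<dots> \<le> (\<Sum>i\<in>(UNIV::'n set). \<Sum>k\<in>(UNIV::'n set). 2 * E * norm V * norm \<delta>)"
    proof (intro sum_mono)
      fix i k
      have "\<bar>V $ i * \<delta> $ k + \<delta> $ i * V' $ k\<bar> \<le> \<bar>V $ i\<bar> * \<bar>\<delta> $ k\<bar> + \<bar>\<delta> $ i\<bar> * \<bar>V' $ k\<bar>"
        by (metis abs_mult abs_triangle_ineq)
      also have "\<dots> \<le> norm V * norm \<delta> + norm \<delta> * norm V"
        using component_le_norm_cart[of V' k] nV' by (intro add_mono mult_mono component_le_norm_cart) auto
      finally have "\<bar>V $ i * \<delta> $ k + \<delta> $ i * V' $ k\<bar> \<le> 2 * norm V * norm \<delta>" by (simp add: algebra_simps)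
      moreover have "E \<ge> 0" using R[of i k] by linarith
      ultimately have "\<bar>R i k\<bar> * \<bar>V $ i * \<delta> $ k + \<delta> $ i * V' $ k\<bar> \<le> E * (2 * norm V * norm \<delta>)"
        using R by (intro mult_mono) auto
      then show "\<bar>R i k * (V $ i * \<delta> $ k + \<delta> $ i * V' $ k)\<bar> \<le> 2 * E * norm V * norm \<delta>"
        by (simp add: abs_mult mult.assoc mult.left_commute)
    qed
    finally show ?thesis .
  qed
  also have "\<dots> = 2 * real CARD('n) ^ 2 * E * norm V * \<bar>V \<bullet> \<eta>\<bar> / norm \<eta>"
    by (simp add: n\<delta> power2_eq_square)
  finally show ?thesis using pos[OF orth] by linarith
qed

lemma sum_rotate:
  "(\<Sum>i\<in>I. \<Sum>j\<in>J. \<Sum>r\<in>R. \<Sum>s\<in>S. \<Sum>t\<in>T. f i j r s t)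
    = (\<Sum>t\<in>T. \<Sum>i\<in>I. \<Sum>j\<in>J. \<Sum>r\<in>R. \<Sum>s\<in>S. f i j r s t)"
proof -
  have "(\<Sum>i\<in>I. \<Sum>j\<in>J. \<Sum>r\<in>R. \<Sum>s\<in>S. \<Sum>t\<in>T. f i j r s t) = (\<Sum>i\<in>I. \<Sum>j\<in>J. \<Sum>r\<in>R. \<Sum>t\<in>T. \<Sum>s\<in>S. f i j r s t)"
    by (rule sum.cong[OF refl], rule sum.cong[OF refl], rule sum.cong[OF refl], rule sum.swap)
  also have "\<dots> = (\<Sum>i\<in>I. \<Sum>j\<in>J. \<Sum>t\<in>T. \<Sum>r\<in>R. \<Sum>s\<in>S. f i j r s t)"
    by (rule sum.cong[OF refl], rule sum.cong[OF refl], rule sum.swap)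
  also have "\<dots> = (\<Sum>i\<in>I. \<Sum>t\<in>T. \<Sum>j\<in>J. \<Sum>r\<in>R. \<Sum>s\<in>S. f i j r s t)"
    by (rule sum.cong[OF refl], rule sum.swap)
  also have "\<dots> = (\<Sum>t\<in>T. \<Sum>i\<in>I. \<Sum>j\<in>J. \<Sum>r\<in>R. \<Sum>s\<in>S. f i j r s t)"
    by (rule sum.swap)
  finally show ?thesis .
qed

text \<open>A full contraction of two tensors through the matrix \<open>C\<close> is the pairing of the two vectors that arise
by contracting each tensor with its own arguments.\<close>

lemma sum_contraction:
  fixes a b :: "'n::finite \<Rightarrow> 'n \<Rightarrow> 'n \<Rightarrow> real"
  shows "(\<Sum>i\<in>UNIV. \<Sum>j\<in>UNIV. \<Sum>r\<in>UNIV. \<Sum>s\<in>UNIV. (\<Sum>t\<in>UNIV. \<Sum>m\<in>UNIV. a t i j * C t m * b m r s) * V i * V j * w r * w s)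
    = (\<Sum>t\<in>UNIV. (\<Sum>j\<in>UNIV. (\<Sum>i\<in>UNIV. V i * a t i j) * V j) * (\<Sum>m\<in>UNIV. C t m * (\<Sum>s\<in>UNIV. (\<Sum>r\<in>UNIV. w r * b m r s) * w s)))"
proof -
  have A: "(\<Sum>j\<in>UNIV. (\<Sum>i\<in>UNIV. V i * a t i j) * V j) = (\<Sum>i\<in>UNIV. \<Sum>j\<in>UNIV. a t i j * V i * V j)" for t
    unfolding sum_distrib_right by (subst sum.swap) (simp add: ac_simps)
  have B: "(\<Sum>s\<in>UNIV. (\<Sum>r\<in>UNIV. w r * b m r s) * w s) = (\<Sum>r\<in>UNIV. \<Sum>s\<in>UNIV. b m r s * w r * w s)" for m
    unfolding sum_distrib_right by (subst sum.swap) (simp add: ac_simps)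
  have "(\<Sum>i\<in>UNIV. \<Sum>j\<in>UNIV. \<Sum>r\<in>UNIV. \<Sum>s\<in>UNIV. (\<Sum>t\<in>UNIV. \<Sum>m\<in>UNIV. a t i j * C t m * b m r s) * V i * V j * w r * w s)
    = (\<Sum>i\<in>UNIV. \<Sum>j\<in>UNIV. \<Sum>r\<in>UNIV. \<Sum>s\<in>UNIV. \<Sum>t\<in>UNIV. \<Sum>m\<in>UNIV. a t i j * C t m * b m r s * V i * V j * w r * w s)"
    by (simp only: sum_distrib_right)
  also have "\<dots> = (\<Sum>t\<in>UNIV. \<Sum>i\<in>UNIV. \<Sum>j\<in>UNIV. \<Sum>r\<in>UNIV. \<Sum>s\<in>UNIV. \<Sum>m\<in>UNIV. a t i j * C t m * b m r s * V i * V j * w r * w s)"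
    by (rule sum_rotate)
  also have "\<dots> = (\<Sum>t\<in>UNIV. \<Sum>m\<in>UNIV. \<Sum>i\<in>UNIV. \<Sum>j\<in>UNIV. \<Sum>r\<in>UNIV. \<Sum>s\<in>UNIV. a t i j * C t m * b m r s * V i * V j * w r * w s)"
    by (rule sum.cong[OF refl], rule sum_rotate)
  also have "\<dots> = (\<Sum>t\<in>UNIV. \<Sum>m\<in>UNIV. \<Sum>i\<in>UNIV. \<Sum>j\<in>UNIV. (a t i j * V i * V j) * (C t m * (\<Sum>r\<in>UNIV. \<Sum>s\<in>UNIV. b m r s * w r * w s)))"
    by (simp only: sum_distrib_left ac_simps)
  also have "\<dots> = (\<Sum>t\<in>UNIV. (\<Sum>i\<in>UNIV. \<Sum>j\<in>UNIV. a t i j * V i * V j) * (\<Sum>m\<in>UNIV. C t m * (\<Sum>r\<in>UNIV. \<Sum>s\<in>UNIV. b m r s * w r * w s)))"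
    by (simp only: sum_distrib_right[symmetric]) (simp only: sum_distrib_left[symmetric])
  finally show ?thesis unfolding A B .
qed

section \<open>A differential inequality\<close>

text \<open>While \<open>g\<close> is nonnegative, \<open>g s * exp (M * s)\<close> is nondecreasing. Hence it cannot reach \<open>0\<close>: at the
first zero of \<open>g\<close> it would still be at least its positive initial value.\<close>

lemma positive_slope_persists:
  fixes g g' :: "real \<Rightarrow> real"
  assumes d: "\<And>s. s \<in> {a..b} \<Longrightarrow> (g has_real_derivative g' s) (at s)"
    and ineq: "\<And>s. s \<in> {a..b} \<Longrightarrow> g' s \<ge> - M * \<bar>g s\<bar>" and "g a > 0" and "s \<in> {a..b}"
  shows "g s \<ge> g a * exp (- M * (s - a))"
proof -
  define h where "h s = g s * exp (M * s)" for s
  have dh: "(h has_real_derivative (g' s + M * g s) * exp (M * s)) (at s)" if "s \<in> {a..b}" for s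
    unfolding h_def using d[OF that] by (auto intro!: derivative_eq_intros simp: algebra_simps)
  have mono: "h a \<le> h t" if t: "t \<in> {a..b}" and pos: "\<And>s. a \<le> s \<Longrightarrow> s < t \<Longrightarrow> g s \<ge> 0" for t
  proof (cases "a = t")
    case False
    then have "a < t" using t by simp
    have "\<And>x. a \<le> x \<Longrightarrow> x \<le> t \<Longrightarrow> (h has_real_derivative (g' x + M * g x) * exp (M * x)) (at x)"
      using dh t by auto
    from MVT2[OF \<open>a < t\<close> this] obtain z where z: "a < z" "z < t"
      "h t - h a = (t - a) * ((g' z + M * g z) * exp (M * z))" by blast
    have "g' z + M * g z \<ge> 0" using ineq[of z] pos[of z] z t by auto
    then show ?thesis using z(3) \<open>a < t\<close> by (smt (verit) mult_nonneg_nonneg exp_ge_zero)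
  qed simp
  have pos: "g t > 0" if t: "t \<in> {a..b}" for t
  proof (rule ccontr)
    assume "\<not> g t > 0"
    \<comment> \<open>\<open>Inf Z\<close> is the first parameter at which \<open>g\<close> fails to be positive.\<close>
    define Z where "Z = {a..b} \<inter> g -` {..0}"
    have "continuous_on {a..b} g"
      by (intro continuous_at_imp_continuous_on ballI DERIV_isCont[OF d])
    then have "closed Z"
      unfolding Z_def by (intro continuous_closed_preimage closed_atLeastAtMost closed_atMost)
    moreover have "Z \<noteq> {}" "bdd_below Z"
      using t \<open>\<not> g t > 0\<close> by (auto simp: Z_def intro!: bdd_belowI[of _ a])
    ultimately have "Inf Z \<in> Z" by (intro closed_contains_Inf) auto
    then have \<tau>: "Inf Z \<in> {a..b}" "g (Inf Z) \<le> 0" by (auto simp: Z_def)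
    have "g s \<ge> 0" if "a \<le> s" "s < Inf Z" for s
    proof (rule ccontr)
      assume "\<not> g s \<ge> 0"
      then have "s \<in> Z" using that \<tau> by (auto simp: Z_def)
      then show False using cInf_lower[OF _ \<open>bdd_below Z\<close>] that by force
    qed
    from mono[OF \<tau>(1) this] have "h a \<le> h (Inf Z)" by blast
    moreover have "h a > 0" using \<open>g a > 0\<close> by (simp add: h_def)
    ultimately have "g (Inf Z) * exp (M * Inf Z) > 0" unfolding h_def by linarith
    then show False using \<tau>(2) by (simp add: zero_less_mult_iff)
  qed
  have "h a \<le> h s"
  proof (rule mono[OF assms(4)])
    show "g z \<ge> 0" if "a \<le> z" "z < s" for z using pos[of z] that assms(4) by simp
  qed
  then have "g a * exp (M * a) * exp (- M * s) \<le> g s * exp (M * s) * exp (- M * s)"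
    unfolding h_def by (intro mult_right_mono) auto
  moreover have "exp (M * a) * exp (- M * s) = exp (- M * (s - a))" "exp (M * s) * exp (- M * s) = 1"
    by (simp_all add: algebra_simps flip: exp_add)
  ultimately show ?thesis by (simp only: mult.assoc mult_1_right)
qed

text \<open>If \<open>f\<close> has grown by \<open>D > 0\<close> on \<open>[0, t]\<close>, its slope is \<open>D / t\<close> somewhere in between, and from there on
at least \<open>D / t * exp (- M)\<close>. So the growth on \<open>[t, 1]\<close> is at least \<open>(1 - t) * D / t * exp (- M)\<close>.\<close>

lemma quasi_convex_growth:
  fixes f f1 f2 :: "real \<Rightarrow> real"
  assumes f: "\<And>t. t \<in> {0..1} \<Longrightarrow> (f has_real_derivative f1 t) (at t)"
    and f1: "\<And>t. t \<in> {0..1} \<Longrightarrow> (f1 has_real_derivative f2 t) (at t)"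
    and ineq: "\<And>t. t \<in> {0..1} \<Longrightarrow> f2 t \<ge> - M * \<bar>f1 t\<bar>" and "M \<ge> 0" and t: "t \<in> {0..1}"
  shows "f t - f 0 \<le> exp M * t * max 0 (f 1 - f 0)"
proof (cases "f t - f 0 \<le> 0")
  case True
  have "0 \<le> exp M * t * max 0 (f 1 - f 0)" using t by simp
  with True show ?thesis by linarith
next
  case False
  define D where "D = f t - f 0"
  have "D > 0" using False by (simp add: D_def)
  have "t > 0" using False t by (cases "t = 0") auto
  obtain \<sigma> where \<sigma>: "0 < \<sigma>" "\<sigma> < t" "f t - f 0 = (t - 0) * f1 \<sigma>"
    using MVT2[OF \<open>t > 0\<close>, of f f1] f t by force
  have f1\<sigma>: "f1 \<sigma> = D / t" using \<sigma>(3) \<open>t > 0\<close> by (simp add: D_def)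
  with \<open>t > 0\<close> \<open>D > 0\<close> have f1\<sigma>_pos: "f1 \<sigma> > 0" by simp
  have later: "f1 s \<ge> D / t * exp (- M)" if "s \<in> {\<sigma>..1}" for s
  proof -
    have "f1 s \<ge> f1 \<sigma> * exp (- M * (s - \<sigma>))"
      by (rule positive_slope_persists[of \<sigma> 1 f1 f2 M s]) (use f1 ineq f1\<sigma>_pos that \<sigma> t in auto)
    moreover have "M * (s - \<sigma>) \<le> M * 1"
      using that \<sigma> \<open>M \<ge> 0\<close> by (intro mult_left_mono) auto
    then have "exp (- M) \<le> exp (- M * (s - \<sigma>))" unfolding exp_le_cancel_iff by linarith
    then have "f1 \<sigma> * exp (- M) \<le> f1 \<sigma> * exp (- M * (s - \<sigma>))"
      using f1\<sigma>_pos by (intro mult_left_mono) auto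
    ultimately show ?thesis using f1\<sigma> by simp
  qed
  have after: "f 1 - f t \<ge> (1 - t) * (D / t * exp (- M))"
  proof (cases "t = 1")
    case False
    then have "t < 1" using t by simp
    obtain z where z: "t < z" "z < 1" "f 1 - f t = (1 - t) * f1 z"
      using MVT2[OF \<open>t < 1\<close>, of f f1] f \<open>t > 0\<close> by force
    have "f1 z \<ge> D / t * exp (- M)" using later z \<sigma> by auto
    then show ?thesis unfolding z(3) using \<open>t < 1\<close> by (intro mult_left_mono) auto
  qed simp
  have "t * (D / t * exp (- M)) = D * exp (- M)" using \<open>t > 0\<close> by simp
  also have "\<dots> \<le> D" using \<open>M \<ge> 0\<close> \<open>D > 0\<close> by (simp add: mult_left_le)
  finally have "t * (D / t * exp (- M)) \<le> D" .
  with after have "f 1 - f 0 \<ge> D / t * exp (- M)"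
    unfolding left_diff_distrib[of 1 t "D / t * exp (- M)"] using D_def by linarith
  then have "D \<le> exp M * t * (f 1 - f 0)"
    using \<open>t > 0\<close> by (simp add: exp_minus field_simps)
  also have "\<dots> \<le> exp M * t * max 0 (f 1 - f 0)"
    using \<open>t > 0\<close> by (intro mult_left_mono) auto
  finally show ?thesis by (simp add: D_def)
qed

section \<open>Charts of a smooth manifold\<close>

abbreviation chart_img :: "('a, 'n) chart \<Rightarrow> 'a set \<Rightarrow> (real ^ 'n) set" where
  "chart_img \<kappa> S \<equiv> cmap \<kappa> ` (cdom \<kappa> \<inter> S)"

context
  fixes \<A> :: "('a::{t2_space, second_countable_topology}, 'n::finite) chart set"
  assumes mf: "smooth_manifold \<A>"
begin


lemma chart_homeomorphism:
  "\<kappa> \<in> \<A> \<Longrightarrow> homeomorphism (cdom \<kappa>) (cmap \<kappa> ` cdom \<kappa>) (cmap \<kappa>) (cinv \<kappa>)"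
  using mf by (auto simp: smooth_manifold_def)

lemma open_cdom: "\<kappa> \<in> \<A> \<Longrightarrow> open (cdom \<kappa>)"
  using mf by (auto simp: smooth_manifold_def)

lemma cinv_cmap: "\<kappa> \<in> \<A> \<Longrightarrow> x \<in> cdom \<kappa> \<Longrightarrow> cinv \<kappa> (cmap \<kappa> x) = x"
  using chart_homeomorphism homeomorphism_apply1 by blast

lemma continuous_cmap: "\<kappa> \<in> \<A> \<Longrightarrow> continuous_on (cdom \<kappa>) (cmap \<kappa>)"
  using chart_homeomorphism homeomorphism_cont1 by blast

lemma continuous_cinv: "\<kappa> \<in> \<A> \<Longrightarrow> continuous_on (cmap \<kappa> ` cdom \<kappa>) (cinv \<kappa>)"
  using chart_homeomorphism homeomorphism_cont2 by blast

lemma open_chart_img: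
  assumes "\<kappa> \<in> \<A>" "open S"
  shows "open (chart_img \<kappa> S)"
proof -
  have "openin (top_of_set (cmap \<kappa> ` cdom \<kappa>)) (cmap \<kappa> ` (cdom \<kappa> \<inter> S))"
    using chart_homeomorphism[OF assms(1)] assms(2)
    by (intro homeomorphism_imp_open_map) (auto simp: openin_open)
  moreover have "open (cmap \<kappa> ` cdom \<kappa>)"
    using mf assms by (auto simp: smooth_manifold_def)
  ultimately show ?thesis
    using openin_open_trans by blast
qed

lemma charts_at_nonempty: "\<exists>\<kappa>. \<kappa> \<in> charts_at \<A> x"
  using mf unfolding smooth_manifold_def charts_at_def by blast

lemma closure_chart_img:
  assumes "\<kappa> \<in> \<A>" "x \<in> cdom \<kappa>" "x \<in> closure S"
  shows "cmap \<kappa> x \<in> closure (chart_img \<kappa> S)"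
proof -
  have "x \<in> closure (cdom \<kappa> \<inter> S)"
    using assms open_cdom by (metis IntI open_Int_closure_subset subsetD)
  show ?thesis
  proof (rule ccontr)
    assume "cmap \<kappa> x \<notin> closure (chart_img \<kappa> S)"
    define T where "T = - closure (chart_img \<kappa> S)"
    have T: "open T" "cmap \<kappa> x \<in> T" "T \<inter> chart_img \<kappa> S = {}"
      using \<open>cmap \<kappa> x \<notin> _\<close> closure_subset[of "chart_img \<kappa> S"] by (auto simp: T_def)
    have "open (cdom \<kappa> \<inter> cmap \<kappa> -` T)"
      using continuous_cmap[OF assms(1)] open_cdom[OF assms(1)] T(1)
      by (rule continuous_open_preimage)
    moreover have "x \<in> cdom \<kappa> \<inter> cmap \<kappa> -` T" using assms T by auto
    ultimately have "(cdom \<kappa> \<inter> cmap \<kappa> -` T) \<inter> (cdom \<kappa> \<inter> S) \<noteq> {}"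
      using \<open>x \<in> closure (cdom \<kappa> \<inter> S)\<close> open_Int_closure_eq_empty by (metis disjoint_iff)
    then show False using T(3) by blast
  qed
qed

lemma transition_has_derivative:
  assumes "\<psi> \<in> charts_at \<A> y" "\<psi>' \<in> charts_at \<A> y"
  shows "\<exists>T. ((cmap \<psi>' \<circ> cinv \<psi>) has_derivative T) (at (cmap \<psi> y))"
proof -
  define \<tau> where "\<tau> = cmap \<psi>' \<circ> cinv \<psi>"
  define S where "S = cmap \<psi> ` (cdom \<psi> \<inter> cdom \<psi>')"
  have *: "\<psi> \<in> \<A>" "\<psi>' \<in> \<A>" "y \<in> cdom \<psi> \<inter> cdom \<psi>'"
    using assms by (auto simp: charts_at_def)
  have sm: "smooth_map_on S \<tau>"
    using mf * unfolding smooth_manifold_def S_def \<tau>_def by blast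
  have S: "open S" "cmap \<psi> y \<in> S"
    using * open_cdom open_chart_img by (auto simp: S_def)
  have ex: "iter_partial_exists [axis i 1] \<tau> S" and co: "continuous_on S (iter_partial [axis i 1] \<tau>)"
    for i :: 'n
  proof -
    have "set [axis i (1::real)] \<subseteq> Basis" by (simp add: Basis_vec_real)
    then show "iter_partial_exists [axis i 1] \<tau> S" "continuous_on S (iter_partial [axis i 1] \<tau>)"
      using sm unfolding smooth_map_on_def by blast+
  qed
  have "((\<lambda>t. \<tau> (p + t *\<^sub>R axis i 1)) has_vector_derivative iter_partial [axis i 1] \<tau> p) (at 0)"
    if "p \<in> S" for p i
    using iter_partial_has_vector_derivative[OF ex that] by simp
  from has_derivative_of_coordinate_partials[OF S(1) this co S(2)]
  show ?thesis unfolding \<tau>_def by blast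
qed

end


text \<open>Closed coordinate balls are compact and lie in a single chart; finitely many of their interiors cover \<open>K\<close>.\<close>

lemma compact_chart_cover:
  fixes \<A> :: "('a::{t2_space, second_countable_topology}, 'n::finite) chart set"
  assumes mf: "smooth_manifold \<A>" and "compact K"
  obtains F :: "(('a, 'n) chart \<times> 'a set) set" where "finite F"
    "\<And>\<kappa> C. (\<kappa>, C) \<in> F \<Longrightarrow> \<kappa> \<in> \<A> \<and> C \<subseteq> cdom \<kappa> \<and> compact C"
    "\<And>x. x \<in> K \<Longrightarrow> \<exists>(\<kappa>, C)\<in>F. x \<in> C"
proof -
  have "\<exists>\<kappa> C N. \<kappa> \<in> \<A> \<and> C \<subseteq> cdom \<kappa> \<and> compact C \<and> open N \<and> x \<in> N \<and> N \<subseteq> C" for x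
  proof -
    obtain \<kappa> where "\<kappa> \<in> charts_at \<A> x" using charts_at_nonempty[OF mf] by blast
    then have \<kappa>: "\<kappa> \<in> \<A>" "x \<in> cdom \<kappa>" by (auto simp: charts_at_def)
    have "open (cmap \<kappa> ` cdom \<kappa>)" using open_chart_img[OF mf \<kappa>(1) open_UNIV] by simp
    then obtain r where r: "r > 0" "cball (cmap \<kappa> x) r \<subseteq> cmap \<kappa> ` cdom \<kappa>"
      using \<kappa>(2) open_contains_cball by blast
    define C where "C = cinv \<kappa> ` cball (cmap \<kappa> x) r"
    define N where "N = cdom \<kappa> \<inter> cmap \<kappa> -` ball (cmap \<kappa> x) r"
    have "C \<subseteq> cdom \<kappa>"
      using r(2) cinv_cmap[OF mf \<kappa>(1)] unfolding C_def by force
    moreover have "compact C"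
      unfolding C_def
      by (intro compact_continuous_image compact_cball continuous_on_subset[OF continuous_cinv[OF mf \<kappa>(1)] r(2)])
    moreover have "open N"
      unfolding N_def by (intro continuous_open_preimage continuous_cmap[OF mf \<kappa>(1)] open_cdom[OF mf \<kappa>(1)] open_ball)
    moreover have "x \<in> N" using \<kappa> r by (simp add: N_def)
    moreover have "N \<subseteq> C"
    proof
      fix z assume z: "z \<in> N"
      then have "cinv \<kappa> (cmap \<kappa> z) \<in> C" unfolding C_def N_def by auto
      then show "z \<in> C" using cinv_cmap[OF mf \<kappa>(1)] z by (simp add: N_def)
    qed
    ultimately show ?thesis using \<kappa>(1) by blast
  qed
  then obtain k C N where kCO: "\<And>x. k x \<in> \<A> \<and> C x \<subseteq> cdom (k x) \<and> compact (C x) \<and> open (N x) \<and> x \<in> N x \<and> N x \<subseteq> C x"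
    by metis
  have cover: "K \<subseteq> (\<Union>x\<in>K. N x)" and op: "\<And>x. x \<in> K \<Longrightarrow> open (N x)" using kCO by auto
  obtain D where D: "D \<subseteq> K" "finite D" "K \<subseteq> (\<Union>x\<in>D. N x)"
    using compactE_image[OF \<open>compact K\<close> op cover] by blast
  show ?thesis
  proof (rule that[of "(\<lambda>x. (k x, C x)) ` D"])
    show "\<exists>(\<kappa>, C)\<in>(\<lambda>x. (k x, C x)) ` D. x \<in> C" if "x \<in> K" for x
      using D(3) that kCO by fastforce
    show "\<kappa> \<in> \<A> \<and> C' \<subseteq> cdom \<kappa> \<and> compact C'" if kC: "(\<kappa>, C') \<in> (\<lambda>x. (k x, C x)) ` D" for \<kappa> C'
    proof -
      obtain x where "\<kappa> = k x" "C' = C x" using kC by blast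
      then show ?thesis using kCO[of x] by simp
    qed
  qed (use D(2) in auto)
qed

section \<open>Words of partial derivatives and the exchange of the two variables\<close>

lemma mixed_orders_single: "1 \<le> k \<Longrightarrow> 1 \<le> l \<Longrightarrow> [d] \<in> mixed_orders k l"
  by (cases d) (auto simp: mixed_orders_def suffix_Cons)

lemma mixed_orders_Cons:
  assumes "w \<in> mixed_orders k l" "2 \<le> length w"
    and "length (filter isl (d # w)) \<le> k" "length (filter (\<lambda>d. \<not> isl d) (d # w)) \<le> l"
  shows "d # w \<in> mixed_orders k l"
  using assms by (auto simp: mixed_orders_def suffix_Cons)

lemma mixed_orders_pair:
  assumes "1 \<le> k" "1 \<le> l"
  shows "[Inl i, Inr r] \<in> mixed_orders k l" "[Inr r, Inl i] \<in> mixed_orders k l"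
  using assms by (auto simp: mixed_orders_def suffix_Cons)

text \<open>Up to reordering, these are the derivatives that enter the \<open>c\<close>-segments and the Ma--Trudinger--Wang tensor.\<close>

lemma mixed_words:
  "[d] \<in> mixed_orders 2 2"
  "[Inl i, Inr r] \<in> mixed_orders 2 2" "[Inr r, Inl i] \<in> mixed_orders 2 2"
  "[d, Inl i, Inr r] \<in> mixed_orders 2 2" "[d, Inr r, Inl i] \<in> mixed_orders 2 2"
  "[Inl j, Inr s, Inl i, Inr r] \<in> mixed_orders 2 2"
  "[Inr s, Inl j, Inl i, Inr r] \<in> mixed_orders 2 2"
proof -
  show single: "[d] \<in> mixed_orders 2 2" by (rule mixed_orders_single) auto
  show p: "[Inl i, Inr r] \<in> mixed_orders 2 2" "[Inr r, Inl i] \<in> mixed_orders 2 2"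
    by (rule mixed_orders_pair; simp)+
  have t: "[d, Inl i, Inr r] \<in> mixed_orders 2 2" for d
    by (rule mixed_orders_Cons[OF p(1)]; cases d) simp_all
  show "[d, Inl i, Inr r] \<in> mixed_orders 2 2" by (rule t)
  show "[d, Inr r, Inl i] \<in> mixed_orders 2 2"
    by (rule mixed_orders_Cons[OF p(2)]; cases d) simp_all
  show "[Inl j, Inr s, Inl i, Inr r] \<in> mixed_orders 2 2"
    by (rule mixed_orders_Cons[OF t]) simp_all
  show "[Inr s, Inl j, Inl i, Inr r] \<in> mixed_orders 2 2"
    by (rule mixed_orders_Cons[OF t]) simp_all
qed

lemma finite_mixed_orders: "finite (mixed_orders k l :: ('n::finite + 'n) list set)"
proof (rule finite_subset)
  show "mixed_orders k l \<subseteq> {w :: ('n + 'n) list. set w \<subseteq> UNIV \<and> length w \<le> k + l}"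
  proof
    fix w :: "('n + 'n) list" assume "w \<in> mixed_orders k l"
    then show "w \<in> {w. set w \<subseteq> UNIV \<and> length w \<le> k + l}"
      using sum_length_filter_compl[of isl w] by (simp add: mixed_orders_def)
  qed
qed (rule finite_lists_length_le, simp)

text \<open>The partial derivative \<open>cost_partial\<close>, as a function of the coordinates of the two points.\<close>

definition pd ::
  "('a \<Rightarrow> 'b \<Rightarrow> real) \<Rightarrow> ('a, 'n::finite) chart \<Rightarrow> ('b, 'n) chart \<Rightarrow> ('n + 'n) list \<Rightarrow>
   real ^ 'n \<Rightarrow> real ^ 'n \<Rightarrow> real" where
  "pd c \<kappa> \<psi> w u v = iter_partial (map coord_dir w) (local_cost c \<kappa> \<psi>) (u, v)"

fun flip :: "'n + 'n \<Rightarrow> 'n + 'n" where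
  "flip (Inl i) = Inr i"
| "flip (Inr i) = Inl i"

lemma flip_flip [simp]: "flip (flip d) = d"
  by (cases d) auto

lemma map_flip_flip [simp]: "map flip (map flip w) = w"
  by (induction w) auto

lemma isl_flip [simp]: "isl (flip d) \<longleftrightarrow> \<not> isl d"
  by (cases d) auto

lemma coord_dir_flip: "coord_dir (flip d) = prod.swap (coord_dir d)"
  by (cases d) (auto simp: coord_dir_def)

lemma local_cost_swap: "local_cost (swap_cost c) \<psi> \<kappa> = local_cost c \<kappa> \<psi> \<circ> prod.swap"
  by (auto simp: local_cost_def swap_cost_def fun_eq_iff)

lemma swap_line: "prod.swap (p + t *\<^sub>R prod.swap v) = prod.swap p + t *\<^sub>R v"
  by (cases p; cases v) auto

lemma iter_partial_swap:
  "iter_partial (map prod.swap vs) (f \<circ> prod.swap) = iter_partial vs f \<circ> prod.swap"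
proof (induction vs)
  case (Cons v vs)
  then show ?case
    unfolding list.map iter_partial.simps Cons.IH by (simp only: o_def swap_line)
qed simp

lemma iter_partial_exists_swap:
  assumes "iter_partial_exists vs f (T \<times> S)"
  shows "iter_partial_exists (map prod.swap vs) (f \<circ> prod.swap) (S \<times> T)"
  using assms
proof (induction vs)
  case (Cons v vs)
  from Cons.prems have "iter_partial_exists vs f (T \<times> S)" by simp
  then have ih: "iter_partial_exists (map prod.swap vs) (f \<circ> prod.swap) (S \<times> T)"
    by (rule Cons.IH)
  have "(\<lambda>t. iter_partial (map prod.swap vs) (f \<circ> prod.swap) (p + t *\<^sub>R prod.swap v)) differentiable at 0"
    if "p \<in> S \<times> T" for p
  proof -
    have "prod.swap p \<in> T \<times> S" using that by auto
    then have "(\<lambda>t. iter_partial vs f (prod.swap p + t *\<^sub>R v)) differentiable at 0"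
      by (rule bspec[OF conjunct2[OF Cons.prems[unfolded iter_partial_exists.simps]]])
    then show ?thesis
      unfolding iter_partial_swap by (simp only: o_def swap_line)
  qed
  with ih show ?case
    unfolding list.map iter_partial_exists.simps by blast
qed simp

lemma map_coord_dir_flip: "map coord_dir (map flip w) = map prod.swap (map coord_dir w)"
  by (simp add: coord_dir_flip)

lemma iter_partial_local_cost_swap:
  "iter_partial (map coord_dir (map flip w)) (local_cost (swap_cost c) \<psi> \<kappa>)
    = iter_partial (map coord_dir w) (local_cost c \<kappa> \<psi>) \<circ> prod.swap"
  unfolding map_coord_dir_flip local_cost_swap by (rule iter_partial_swap)

lemma pd_swap: "pd (swap_cost c) \<psi> \<kappa> (map flip w) v u = pd c \<kappa> \<psi> w u v"
  unfolding pd_def iter_partial_local_cost_swap by simp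

lemma length_filter_flip:
  "length (filter isl (map flip w)) = length (filter (\<lambda>d. \<not> isl d) w)"
  "length (filter (\<lambda>d. \<not> isl d) (map flip w)) = length (filter isl w)"
  by (induction w) auto

lemma mixed_orders_flip:
  assumes "w \<in> mixed_orders k l"
  shows "map flip w \<in> mixed_orders l k"
proof -
  have "(\<exists>d\<in>set v. isl d) \<and> (\<exists>d\<in>set v. \<not> isl d)"
    if "suffix v (map flip w)" "2 \<le> length v" for v
  proof -
    have "suffix (map flip v) w"
      using map_mono_suffix[OF that(1), of flip] by (simp only: map_flip_flip)
    moreover have "2 \<le> length (map flip v)" using that(2) by simp
    ultimately have "(\<exists>d\<in>set (map flip v). isl d) \<and> (\<exists>d\<in>set (map flip v). \<not> isl d)"
      using assms unfolding mixed_orders_def mem_Collect_eq by blast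
    then show ?thesis unfolding set_map bex_simps isl_flip by blast
  qed
  moreover have "length (filter isl w) \<le> k" "length (filter (\<lambda>d. \<not> isl d) w) \<le> l"
    using assms unfolding mixed_orders_def by blast+
  ultimately show ?thesis
    unfolding mixed_orders_def mem_Collect_eq length_filter_flip by blast
qed

text \<open>Regularity is invariant under the exchange of the variables. Every statement about the first variable
therefore has a mirror image, obtained from the cost \<open>swap_cost c\<close>.\<close>

lemma mixed_regular_swap:
  fixes \<A> :: "('a::topological_space, 'b::finite) chart set"
  assumes "mixed_regular \<A> \<B> \<Omega> \<Omega>' c k l"
  shows "mixed_regular \<B> \<A> \<Omega>' \<Omega> (swap_cost c) l k"
  unfolding mixed_regular_def Let_def
proof (intro conjI ballI)
  have "continuous_on (closure \<Omega>' \<times> closure \<Omega>) ((\<lambda>(x, y). c x y) \<circ> prod.swap)"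
    using assms unfolding mixed_regular_def
    by (intro continuous_on_compose continuous_on_swap) (simp add: product_swap)
  then show "continuous_on (closure \<Omega>' \<times> closure \<Omega>) (\<lambda>(x, y). swap_cost c x y)"
    by (simp add: swap_cost_def o_def case_prod_beta)
next
  fix \<psi> \<kappa> and w :: "('b + 'b) list" assume *: "\<psi> \<in> \<B>" "\<kappa> \<in> \<A>" "w \<in> mixed_orders l k"
  define w' where "w' = map flip w"
  have w: "w = map flip w'" "w' \<in> mixed_orders k l"
    using mixed_orders_flip[OF *(3)] by (simp_all add: w'_def del: map_map)
  define D where "D = iter_partial (map coord_dir w') (local_cost c \<kappa> \<psi>)"
  have ex: "iter_partial_exists (map coord_dir w') (local_cost c \<kappa> \<psi>) (chart_img \<kappa> \<Omega> \<times> chart_img \<psi> \<Omega>')"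
    and "\<exists>G. continuous_on (chart_img \<kappa> (closure \<Omega>) \<times> chart_img \<psi> (closure \<Omega>')) G \<and>
        (\<forall>p\<in>chart_img \<kappa> \<Omega> \<times> chart_img \<psi> \<Omega>'. G p = D p)"
    using assms * w(2) unfolding mixed_regular_def Let_def D_def by blast+
  then obtain G where G: "continuous_on (chart_img \<kappa> (closure \<Omega>) \<times> chart_img \<psi> (closure \<Omega>')) G"
      "\<And>p. p \<in> chart_img \<kappa> \<Omega> \<times> chart_img \<psi> \<Omega>' \<Longrightarrow> G p = D p"
    by blast
  show "iter_partial_exists (map coord_dir w) (local_cost (swap_cost c) \<psi> \<kappa>)
      (chart_img \<psi> \<Omega>' \<times> chart_img \<kappa> \<Omega>)"
    unfolding w(1) map_coord_dir_flip local_cost_swap by (rule iter_partial_exists_swap[OF ex])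
  have "continuous_on (chart_img \<psi> (closure \<Omega>') \<times> chart_img \<kappa> (closure \<Omega>)) (G \<circ> prod.swap)"
    using G(1) by (intro continuous_on_compose continuous_on_swap) (simp add: product_swap)
  moreover have "(G \<circ> prod.swap) p = iter_partial (map coord_dir w) (local_cost (swap_cost c) \<psi> \<kappa>) p"
    if "p \<in> chart_img \<psi> \<Omega>' \<times> chart_img \<kappa> \<Omega>" for p
    unfolding w(1) iter_partial_local_cost_swap using G(2)[of "prod.swap p"] that
    by (auto simp: D_def)
  ultimately show "\<exists>G. continuous_on (chart_img \<psi> (closure \<Omega>') \<times> chart_img \<kappa> (closure \<Omega>)) G \<and>
      (\<forall>p\<in>chart_img \<psi> \<Omega>' \<times> chart_img \<kappa> \<Omega>.
        G p = iter_partial (map coord_dir w) (local_cost (swap_cost c) \<psi> \<kappa>) p)"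
    by blast
qed

lemma swap_swap_cost [simp]: "swap_cost (swap_cost c) = c"
  by (simp add: swap_cost_def)

lemma twist_swap: "twist \<A> \<B> \<Omega> \<Omega>' c \<Longrightarrow> twist \<B> \<A> \<Omega>' \<Omega> (swap_cost c)"
  by (auto simp: twist_def)

section \<open>Costs with mixed derivatives of order two in each variable\<close>

text \<open>What follows from regularity alone is kept apart, because the invariance of nondegeneracy under the exchange of
the variables already needs it.\<close>

locale cost_regular =
  fixes \<A> :: "('a::{t2_space, second_countable_topology}, 'n::finite) chart set"
    and \<B> :: "('b::{t2_space, second_countable_topology}, 'n) chart set"
    and \<Omega> :: "'a set" and \<Omega>' :: "'b set" and c :: "'a \<Rightarrow> 'b \<Rightarrow> real"
  assumes mfA: "smooth_manifold \<A>" and mfB: "smooth_manifold \<B>"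
    and open1: "open \<Omega>" and open2: "open \<Omega>'"
    and reg: "mixed_regular \<A> \<B> \<Omega> \<Omega>' c 2 2"

begin


lemma swapped_regular: "cost_regular \<B> \<A> \<Omega>' \<Omega> (swap_cost c)"
  using mfA mfB open1 open2 mixed_regular_swap[OF reg] by unfold_locales

lemma partial_exists:
  assumes "\<kappa> \<in> \<A>" "\<psi> \<in> \<B>" "w \<in> mixed_orders 2 2"
  shows "iter_partial_exists (map coord_dir w) (local_cost c \<kappa> \<psi>) (chart_img \<kappa> \<Omega> \<times> chart_img \<psi> \<Omega>')"
  using bspec[OF bspec[OF bspec[OF conjunct2[OF reg[unfolded mixed_regular_def Let_def]]
      assms(1)] assms(2)] assms(3)] by (rule conjunct1)

lemma continuous_extension:
  assumes "\<kappa> \<in> \<A>" "\<psi> \<in> \<B>" "w \<in> mixed_orders 2 2"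
  obtains G where "continuous_on (chart_img \<kappa> (closure \<Omega>) \<times> chart_img \<psi> (closure \<Omega>')) G"
    "\<And>u v. u \<in> chart_img \<kappa> \<Omega> \<Longrightarrow> v \<in> chart_img \<psi> \<Omega>' \<Longrightarrow> G (u, v) = pd c \<kappa> \<psi> w u v"
proof -
  have "\<exists>G. continuous_on (chart_img \<kappa> (closure \<Omega>) \<times> chart_img \<psi> (closure \<Omega>')) G \<and>
      (\<forall>p\<in>chart_img \<kappa> \<Omega> \<times> chart_img \<psi> \<Omega>'.
        G p = iter_partial (map coord_dir w) (local_cost c \<kappa> \<psi>) p)"
    using bspec[OF bspec[OF bspec[OF conjunct2[OF reg[unfolded mixed_regular_def Let_def]]
      assms(1)] assms(2)] assms(3)] by (rule conjunct2)
  then obtain G where "continuous_on (chart_img \<kappa> (closure \<Omega>) \<times> chart_img \<psi> (closure \<Omega>')) G"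
    "\<forall>p\<in>chart_img \<kappa> \<Omega> \<times> chart_img \<psi> \<Omega>'.
        G p = iter_partial (map coord_dir w) (local_cost c \<kappa> \<psi>) p" by blast
  then show ?thesis by (intro that[of G]) (auto simp: pd_def)
qed

lemma open_img1: "\<kappa> \<in> \<A> \<Longrightarrow> open (chart_img \<kappa> \<Omega>)"
  using open_chart_img[OF mfA] open1 by blast

lemma open_img2: "\<psi> \<in> \<B> \<Longrightarrow> open (chart_img \<psi> \<Omega>')"
  using open_chart_img[OF mfB] open2 by blast

lemma pd_continuous:
  assumes "\<kappa> \<in> \<A>" "\<psi> \<in> \<B>" "w \<in> mixed_orders 2 2"
  shows "continuous_on (chart_img \<kappa> \<Omega> \<times> chart_img \<psi> \<Omega>') (\<lambda>(u, v). pd c \<kappa> \<psi> w u v)"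
proof -
  obtain G where G: "continuous_on (chart_img \<kappa> (closure \<Omega>) \<times> chart_img \<psi> (closure \<Omega>')) G"
    "\<And>u v. u \<in> chart_img \<kappa> \<Omega> \<Longrightarrow> v \<in> chart_img \<psi> \<Omega>' \<Longrightarrow> G (u, v) = pd c \<kappa> \<psi> w u v"
    using continuous_extension[OF assms] by blast
  have "continuous_on (chart_img \<kappa> \<Omega> \<times> chart_img \<psi> \<Omega>') G"
    by (intro continuous_on_subset[OF G(1)] Sigma_mono image_mono Int_mono closure_subset order_refl)
  then show ?thesis
    by (rule continuous_on_eq) (auto simp: G(2))
qed

lemma pd_has_partial1:
  assumes "\<kappa> \<in> \<A>" "\<psi> \<in> \<B>" "Inl i # w \<in> mixed_orders 2 2"
    and "u \<in> chart_img \<kappa> \<Omega>" "v \<in> chart_img \<psi> \<Omega>'"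
  shows "((\<lambda>t. pd c \<kappa> \<psi> w (u + t *\<^sub>R axis i 1) v) has_real_derivative pd c \<kappa> \<psi> (Inl i # w) u v) (at 0)"
proof -
  have "((\<lambda>t. iter_partial (map coord_dir w) (local_cost c \<kappa> \<psi>) ((u, v) + t *\<^sub>R coord_dir (Inl i)))
      has_vector_derivative iter_partial (map coord_dir (Inl i # w)) (local_cost c \<kappa> \<psi>) (u, v)) (at 0)"
    using iter_partial_has_vector_derivative[OF partial_exists[OF assms(1-3), unfolded list.map]
        SigmaI[OF assms(4,5)]] by (simp only: list.map)
  then show ?thesis
    unfolding pd_def has_real_derivative_iff_has_vector_derivative
    by (simp only: coord_dir_def sum.case scaleR_Pair add_Pair scaleR_zero_right add_0_right)
qed

lemma pd_has_partial2:
  assumes "\<kappa> \<in> \<A>" "\<psi> \<in> \<B>" "Inr r # w \<in> mixed_orders 2 2"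
    and "u \<in> chart_img \<kappa> \<Omega>" "v \<in> chart_img \<psi> \<Omega>'"
  shows "((\<lambda>t. pd c \<kappa> \<psi> w u (v + t *\<^sub>R axis r 1)) has_real_derivative pd c \<kappa> \<psi> (Inr r # w) u v) (at 0)"
proof -
  have "((\<lambda>t. iter_partial (map coord_dir w) (local_cost c \<kappa> \<psi>) ((u, v) + t *\<^sub>R coord_dir (Inr r)))
      has_vector_derivative iter_partial (map coord_dir (Inr r # w)) (local_cost c \<kappa> \<psi>) (u, v)) (at 0)"
    using iter_partial_has_vector_derivative[OF partial_exists[OF assms(1-3), unfolded list.map]
        SigmaI[OF assms(4,5)]] by (simp only: list.map)
  then show ?thesis
    unfolding pd_def has_real_derivative_iff_has_vector_derivative
    by (simp only: coord_dir_def sum.case scaleR_Pair add_Pair scaleR_zero_right add_0_right)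
qed

lemma pd_continuous1:
  assumes "\<kappa> \<in> \<A>" "\<psi> \<in> \<B>" "w \<in> mixed_orders 2 2" "v \<in> chart_img \<psi> \<Omega>'"
  shows "continuous_on (chart_img \<kappa> \<Omega>) (\<lambda>u. pd c \<kappa> \<psi> w u v)"
proof -
  have "continuous_on (chart_img \<kappa> \<Omega>) (\<lambda>u. (u, v))" by (intro continuous_intros)
  moreover have "(\<lambda>u. (u, v)) ` chart_img \<kappa> \<Omega> \<subseteq> chart_img \<kappa> \<Omega> \<times> chart_img \<psi> \<Omega>'"
    using assms(4) by blast
  ultimately show ?thesis
    by (auto dest: continuous_on_compose2[OF pd_continuous[OF assms(1-3)]])
qed

lemma pd_continuous2:
  assumes "\<kappa> \<in> \<A>" "\<psi> \<in> \<B>" "w \<in> mixed_orders 2 2" "u \<in> chart_img \<kappa> \<Omega>"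
  shows "continuous_on (chart_img \<psi> \<Omega>') (\<lambda>v. pd c \<kappa> \<psi> w u v)"
proof -
  have "continuous_on (chart_img \<psi> \<Omega>') (\<lambda>v. (u, v))" by (intro continuous_intros)
  moreover have "(\<lambda>v. (u, v)) ` chart_img \<psi> \<Omega>' \<subseteq> chart_img \<kappa> \<Omega> \<times> chart_img \<psi> \<Omega>'"
    using assms(4) by blast
  ultimately show ?thesis
    by (auto dest: continuous_on_compose2[OF pd_continuous[OF assms(1-3)]])
qed

lemma pd_has_derivative1:
  assumes "\<kappa> \<in> \<A>" "\<psi> \<in> \<B>" "\<And>i. Inl i # w \<in> mixed_orders 2 2"
    and "u \<in> chart_img \<kappa> \<Omega>" "v \<in> chart_img \<psi> \<Omega>'"
  shows "((\<lambda>u. pd c \<kappa> \<psi> w u v) has_derivative (\<lambda>h. \<Sum>i\<in>UNIV. h $ i * pd c \<kappa> \<psi> (Inl i # w) u v)) (at u)"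
proof -
  have "((\<lambda>u. pd c \<kappa> \<psi> w u v) has_derivative
      (\<lambda>h. \<Sum>i\<in>UNIV. h $ i *\<^sub>R pd c \<kappa> \<psi> (Inl i # w) u v)) (at u)"
  proof (rule has_derivative_of_coordinate_partials[OF open_img1[OF assms(1)] _ _ assms(4)])
    show "((\<lambda>t. pd c \<kappa> \<psi> w (p + t *\<^sub>R axis i 1) v) has_vector_derivative
        pd c \<kappa> \<psi> (Inl i # w) p v) (at 0)" if "p \<in> chart_img \<kappa> \<Omega>" for p i
      using pd_has_partial1[OF assms(1-3) that assms(5)]
      by (simp only: has_real_derivative_iff_has_vector_derivative)
    show "continuous_on (chart_img \<kappa> \<Omega>) (\<lambda>u. pd c \<kappa> \<psi> (Inl i # w) u v)" for i
      by (rule pd_continuous1[OF assms(1-3,5)])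
  qed
  then show ?thesis by (simp only: real_scaleR_def)
qed

lemma pd_has_derivative2:
  assumes "\<kappa> \<in> \<A>" "\<psi> \<in> \<B>" "\<And>r. Inr r # w \<in> mixed_orders 2 2"
    and "u \<in> chart_img \<kappa> \<Omega>" "v \<in> chart_img \<psi> \<Omega>'"
  shows "((\<lambda>v. pd c \<kappa> \<psi> w u v) has_derivative (\<lambda>h. \<Sum>r\<in>UNIV. h $ r * pd c \<kappa> \<psi> (Inr r # w) u v)) (at v)"
proof -
  have "((\<lambda>v. pd c \<kappa> \<psi> w u v) has_derivative
      (\<lambda>h. \<Sum>r\<in>UNIV. h $ r *\<^sub>R pd c \<kappa> \<psi> (Inr r # w) u v)) (at v)"
  proof (rule has_derivative_of_coordinate_partials[OF open_img2[OF assms(2)] _ _ assms(5)])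
    show "((\<lambda>t. pd c \<kappa> \<psi> w u (p + t *\<^sub>R axis r 1)) has_vector_derivative
        pd c \<kappa> \<psi> (Inr r # w) u p) (at 0)" if "p \<in> chart_img \<psi> \<Omega>'" for p r
      using pd_has_partial2[OF assms(1-3) assms(4) that]
      by (simp only: has_real_derivative_iff_has_vector_derivative)
    show "continuous_on (chart_img \<psi> \<Omega>') (\<lambda>v. pd c \<kappa> \<psi> (Inr r # w) u v)" for r
      by (rule pd_continuous2[OF assms(1-3,4)])
  qed
  then show ?thesis by (simp only: real_scaleR_def)
qed

lemma pd_chain1:
  assumes "\<kappa> \<in> \<A>" "\<psi> \<in> \<B>" "\<And>i. Inl i # w \<in> mixed_orders 2 2"
    and "\<gamma> s \<in> chart_img \<kappa> \<Omega>" "v \<in> chart_img \<psi> \<Omega>'" "(\<gamma> has_vector_derivative \<gamma>') (at s)"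
  shows "((\<lambda>s. pd c \<kappa> \<psi> w (\<gamma> s) v) has_real_derivative
    (\<Sum>i\<in>UNIV. \<gamma>' $ i * pd c \<kappa> \<psi> (Inl i # w) (\<gamma> s) v)) (at s)"
  using vector_derivative_diff_chain_within[OF assms(6) has_derivative_at_withinI[OF
      pd_has_derivative1[OF assms(1-5)]]]
  by (simp only: has_real_derivative_iff_has_vector_derivative o_def)

lemma pd_chain2:
  assumes "\<kappa> \<in> \<A>" "\<psi> \<in> \<B>" "\<And>r. Inr r # w \<in> mixed_orders 2 2"
    and "u \<in> chart_img \<kappa> \<Omega>" "\<delta> t \<in> chart_img \<psi> \<Omega>'" "(\<delta> has_vector_derivative \<delta>') (at t)"
  shows "((\<lambda>t. pd c \<kappa> \<psi> w u (\<delta> t)) has_real_derivative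
    (\<Sum>r\<in>UNIV. \<delta>' $ r * pd c \<kappa> \<psi> (Inr r # w) u (\<delta> t))) (at t)"
  using vector_derivative_diff_chain_within[OF assms(6) has_derivative_at_withinI[OF
      pd_has_derivative2[OF assms(1-5)]]]
  by (simp only: has_real_derivative_iff_has_vector_derivative o_def)

text \<open>Directions are applied from right to left, so a transposition at the head of a word is an instance of the
symmetry of second derivatives.\<close>

lemma pd_commute:
  assumes "\<kappa> \<in> \<A>" "\<psi> \<in> \<B>" "u \<in> chart_img \<kappa> \<Omega>" "v \<in> chart_img \<psi> \<Omega>'"
    and w: "Inl i # w \<in> mixed_orders 2 2" "Inr r # w \<in> mixed_orders 2 2"
      "Inl i # Inr r # w \<in> mixed_orders 2 2" "Inr r # Inl i # w \<in> mixed_orders 2 2"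
  shows "pd c \<kappa> \<psi> (Inl i # Inr r # w) u v = pd c \<kappa> \<psi> (Inr r # Inl i # w) u v"
proof -
  define P where "P w = (\<lambda>p. pd c \<kappa> \<psi> w (fst p) (snd p))" for w
  define S where "S = chart_img \<kappa> \<Omega> \<times> chart_img \<psi> \<Omega>'"
  have S: "open S" "(u, v) \<in> S"
    using assms open_img1 open_img2 by (auto simp: S_def open_Times)
  have d1: "((\<lambda>t. P w (q + t *\<^sub>R (axis i 1, 0))) has_real_derivative P (Inl i # w) q) (at 0)"
    if "q \<in> S" "Inl i # w \<in> mixed_orders 2 2" for q w
    using pd_has_partial1[OF assms(1,2) that(2), of "fst q" "snd q"] that(1) by (auto simp: P_def S_def)
  have d2: "((\<lambda>t. P w (q + t *\<^sub>R (0, axis r 1))) has_real_derivative P (Inr r # w) q) (at 0)"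
    if "q \<in> S" "Inr r # w \<in> mixed_orders 2 2" for q w
    using pd_has_partial2[OF assms(1,2) that(2), of "fst q" "snd q"] that(1) by (auto simp: P_def S_def)
  have co: "continuous_on S (P w)" if "w \<in> mixed_orders 2 2" for w
    using pd_continuous[OF assms(1,2) that] by (simp add: S_def P_def case_prod_beta)
  have "P (Inl i # Inr r # w) (u, v) = P (Inr r # Inl i # w) (u, v)"
    using S w d1 d2 co
    by (intro mixed_partials_commute[where f="P w" and S=S and Da="P (Inr r # w)" and Db="P (Inl i # w)"
          and a="(0, axis r 1)" and b="(axis i 1, 0)"]) auto
  then show ?thesis by (simp add: P_def)
qed

lemma pd_pair_commute:
  assumes "\<kappa> \<in> \<A>" "\<psi> \<in> \<B>" "u \<in> chart_img \<kappa> \<Omega>" "v \<in> chart_img \<psi> \<Omega>'"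
  shows "pd c \<kappa> \<psi> [Inl i, Inr r] u v = pd c \<kappa> \<psi> [Inr r, Inl i] u v"
  by (rule pd_commute[OF assms]) (rule mixed_words)+

text \<open>Carries a transposition inside a word to the words with further derivatives in front.\<close>

lemma pd_Cons_cong:
  assumes "\<kappa> \<in> \<A>" "\<psi> \<in> \<B>" "u \<in> chart_img \<kappa> \<Omega>" "v \<in> chart_img \<psi> \<Omega>'"
    and eq: "\<And>u v. u \<in> chart_img \<kappa> \<Omega> \<Longrightarrow> v \<in> chart_img \<psi> \<Omega>' \<Longrightarrow> pd c \<kappa> \<psi> w u v = pd c \<kappa> \<psi> w' u v"
  shows "pd c \<kappa> \<psi> (d # w) u v = pd c \<kappa> \<psi> (d # w') u v"
proof -
  define S where "S = chart_img \<kappa> \<Omega> \<times> chart_img \<psi> \<Omega>'"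
  have S: "open S" "(u, v) \<in> S"
    using assms open_img1 open_img2 by (auto simp: S_def open_Times)
  define D where "D w = iter_partial (map coord_dir w) (local_cost c \<kappa> \<psi>)" for w
  have eq: "D w p = D w' p" if "p \<in> S" for p
    using eq[of "fst p" "snd p"] that by (auto simp: S_def D_def pd_def)
  have ev: "\<forall>\<^sub>F t in nhds 0. D w ((u, v) + t *\<^sub>R coord_dir d) = D w' ((u, v) + t *\<^sub>R coord_dir d)"
  proof -
    have "((\<lambda>t. (u, v) + t *\<^sub>R coord_dir d) \<longlongrightarrow> (u, v) + 0 *\<^sub>R coord_dir d) (nhds 0)"
      by (intro tendsto_intros filterlim_ident)
    then have "\<forall>\<^sub>F t in nhds 0. (u, v) + t *\<^sub>R coord_dir d \<in> S"
      using S by (intro topological_tendstoD) auto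
    then show ?thesis by eventually_elim (rule eq)
  qed
  have "vector_derivative (\<lambda>t. D w ((u, v) + t *\<^sub>R coord_dir d)) (at 0)
      = vector_derivative (\<lambda>t. D w' ((u, v) + t *\<^sub>R coord_dir d)) (at 0)"
    using ev by (intro vector_derivative_cong_eq) auto
  then show ?thesis by (simp add: D_def pd_def)
qed

lemma pd_triple_commute:
  assumes "\<kappa> \<in> \<A>" "\<psi> \<in> \<B>" "u \<in> chart_img \<kappa> \<Omega>" "v \<in> chart_img \<psi> \<Omega>'"
  shows "pd c \<kappa> \<psi> [d, Inl i, Inr r] u v = pd c \<kappa> \<psi> [d, Inr r, Inl i] u v"
  by (rule pd_Cons_cong[OF assms pd_pair_commute[OF assms(1,2)]])

lemma pd_quadruple_commute:
  assumes "\<kappa> \<in> \<A>" "\<psi> \<in> \<B>" "u \<in> chart_img \<kappa> \<Omega>" "v \<in> chart_img \<psi> \<Omega>'"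
  shows "pd c \<kappa> \<psi> [Inl i, Inr r, Inl j, Inr s] u v = pd c \<kappa> \<psi> [Inr r, Inl i, Inl j, Inr s] u v"
  by (rule pd_commute[OF assms]) (rule mixed_words)+

text \<open>The fourth derivatives in the order \<open>t, s, t, s\<close> and in the order with both variables exchanged agree.\<close>

lemma pd_quadruple_commute_tail:
  assumes "\<kappa> \<in> \<A>" "\<psi> \<in> \<B>" "u \<in> chart_img \<kappa> \<Omega>" "v \<in> chart_img \<psi> \<Omega>'"
  shows "pd c \<kappa> \<psi> [Inl i, Inr r, Inl j, Inr s] u v = pd c \<kappa> \<psi> [Inr r, Inl i, Inr s, Inl j] u v"
  unfolding pd_quadruple_commute[OF assms]
  by (rule pd_Cons_cong[OF assms pd_triple_commute[OF assms(1,2)]])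

text \<open>Every point of the closures is a limit point of the open domains, so the limit in the definition is taken
along a nontrivial filter and is the value of the continuous extension.\<close>

lemma mixed_hessian_cl_eq:
  assumes "\<kappa> \<in> \<A>" "\<psi> \<in> \<B>" "x \<in> cdom \<kappa>" "x \<in> closure \<Omega>" "y \<in> cdom \<psi>" "y \<in> closure \<Omega>'"
    and G: "continuous_on (chart_img \<kappa> (closure \<Omega>) \<times> chart_img \<psi> (closure \<Omega>')) G"
    "\<And>u v. u \<in> chart_img \<kappa> \<Omega> \<Longrightarrow> v \<in> chart_img \<psi> \<Omega>' \<Longrightarrow> G (u, v) = pd c \<kappa> \<psi> [Inl i, Inr j] u v"
  shows "mixed_hessian_cl \<Omega> \<Omega>' c \<kappa> \<psi> x y $ i $ j = G (cmap \<kappa> x, cmap \<psi> y)"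
proof -
  define S where "S = chart_img \<kappa> \<Omega> \<times> chart_img \<psi> \<Omega>'"
  define p where "p = (cmap \<kappa> x, cmap \<psi> y)"
  define D where "D = iter_partial (map coord_dir [Inl i, Inr j]) (local_cost c \<kappa> \<psi>)"
  have "open S" using assms open_img1 open_img2 by (auto simp: S_def open_Times)
  have "p \<in> closure S"
    using closure_chart_img[OF mfA assms(1,3,4)] closure_chart_img[OF mfB assms(2,5,6)]
    by (simp add: S_def p_def closure_Times)
  then have "p islimpt S"
    using interior_limit_point[of p S] interior_open[OF \<open>open S\<close>] by (auto simp: closure_def)
  then have nt: "at p within S \<noteq> bot"
    by (simp add: trivial_limit_within)
  have "p \<in> chart_img \<kappa> (closure \<Omega>) \<times> chart_img \<psi> (closure \<Omega>')"
    using assms by (auto simp: p_def)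
  then have "(G \<longlongrightarrow> G p) (at p within chart_img \<kappa> (closure \<Omega>) \<times> chart_img \<psi> (closure \<Omega>'))"
    using G(1) unfolding continuous_on_def by blast
  moreover have "S \<subseteq> chart_img \<kappa> (closure \<Omega>) \<times> chart_img \<psi> (closure \<Omega>')"
    unfolding S_def by (intro Sigma_mono image_mono Int_mono closure_subset order_refl)
  ultimately have "(G \<longlongrightarrow> G p) (at p within S)"
    by (rule tendsto_within_subset)
  moreover have "\<forall>\<^sub>F q in at p within S. G q = D q"
    unfolding eventually_at_filter by (rule always_eventually) (auto simp: S_def D_def G(2) pd_def simp del: iter_partial.simps)
  ultimately have "(D \<longlongrightarrow> G p) (at p within S)"
    by (rule Lim_transform_eventually)
  then have "Lim (at p within S) D = G p"
    using nt by (rule tendsto_Lim[rotated])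
  then show ?thesis
    unfolding mixed_hessian_cl_def S_def p_def D_def by simp
qed

definition hess :: "('a, 'n) chart \<Rightarrow> ('b, 'n) chart \<Rightarrow> real ^ 'n \<Rightarrow> real ^ 'n \<Rightarrow> real ^ 'n ^ 'n" where
  "hess \<kappa> \<psi> u v = (\<chi> i j. pd c \<kappa> \<psi> [Inl i, Inr j] u v)"

lemma mixed_hessian_eq_hess:
  assumes "\<kappa> \<in> charts_at \<A> x" "\<psi> \<in> charts_at \<B> y" "x \<in> \<Omega>" "y \<in> \<Omega>'"
  shows "mixed_hessian_cl \<Omega> \<Omega>' c \<kappa> \<psi> x y = hess \<kappa> \<psi> (cmap \<kappa> x) (cmap \<psi> y)"
proof -
  have *: "\<kappa> \<in> \<A>" "\<psi> \<in> \<B>" "x \<in> cdom \<kappa>" "y \<in> cdom \<psi>" "x \<in> closure \<Omega>" "y \<in> closure \<Omega>'"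
    using assms closure_subset by (auto simp: charts_at_def)
  have "mixed_hessian_cl \<Omega> \<Omega>' c \<kappa> \<psi> x y $ i $ j = pd c \<kappa> \<psi> [Inl i, Inr j] (cmap \<kappa> x) (cmap \<psi> y)" for i j
  proof -
    obtain G where G: "continuous_on (chart_img \<kappa> (closure \<Omega>) \<times> chart_img \<psi> (closure \<Omega>')) G"
      "\<And>u v. u \<in> chart_img \<kappa> \<Omega> \<Longrightarrow> v \<in> chart_img \<psi> \<Omega>' \<Longrightarrow> G (u, v) = pd c \<kappa> \<psi> [Inl i, Inr j] u v"
      using continuous_extension[OF *(1,2) mixed_words(2)[where i=i and r=j]] by blast
    show ?thesis
      using mixed_hessian_cl_eq[OF *(1-3,5,4,6) G] G(2)[of "cmap \<kappa> x" "cmap \<psi> y"] * assms by auto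
  qed
  then show ?thesis by (simp add: hess_def vec_eq_iff)
qed

lemma mixed_hessian_cl_swap:
  assumes "\<kappa> \<in> charts_at \<A> x" "\<psi> \<in> charts_at \<B> y" "x \<in> closure \<Omega>" "y \<in> closure \<Omega>'"
  shows "mixed_hessian_cl \<Omega>' \<Omega> (swap_cost c) \<psi> \<kappa> y x = transpose (mixed_hessian_cl \<Omega> \<Omega>' c \<kappa> \<psi> x y)"
proof -
  interpret sw: cost_regular \<B> \<A> \<Omega>' \<Omega> "swap_cost c" by (rule swapped_regular)
  have *: "\<kappa> \<in> \<A>" "\<psi> \<in> \<B>" "x \<in> cdom \<kappa>" "y \<in> cdom \<psi>"
    using assms by (auto simp: charts_at_def)
  have "mixed_hessian_cl \<Omega>' \<Omega> (swap_cost c) \<psi> \<kappa> y x $ j $ i = mixed_hessian_cl \<Omega> \<Omega>' c \<kappa> \<psi> x y $ i $ j" for i j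
  proof -
    obtain G where G: "continuous_on (chart_img \<kappa> (closure \<Omega>) \<times> chart_img \<psi> (closure \<Omega>')) G"
      "\<And>u v. u \<in> chart_img \<kappa> \<Omega> \<Longrightarrow> v \<in> chart_img \<psi> \<Omega>' \<Longrightarrow> G (u, v) = pd c \<kappa> \<psi> [Inl i, Inr j] u v"
      using continuous_extension[OF *(1,2) mixed_words(2)[where i=i and r=j]] by blast
    have "continuous_on (chart_img \<psi> (closure \<Omega>') \<times> chart_img \<kappa> (closure \<Omega>)) (G \<circ> prod.swap)"
      using G(1) by (intro continuous_on_compose continuous_on_swap) (simp add: product_swap)
    moreover have "(G \<circ> prod.swap) (v, u) = pd (swap_cost c) \<psi> \<kappa> [Inl j, Inr i] v u"
      if "v \<in> chart_img \<psi> \<Omega>'" "u \<in> chart_img \<kappa> \<Omega>" for u v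
      using G(2)[OF that(2,1)] pd_pair_commute[OF *(1,2) that(2,1)]
        pd_swap[of c \<psi> \<kappa> "[Inr j, Inl i]" v u] by simp
    ultimately have "mixed_hessian_cl \<Omega>' \<Omega> (swap_cost c) \<psi> \<kappa> y x $ j $ i = (G \<circ> prod.swap) (cmap \<psi> y, cmap \<kappa> x)"
      using * assms by (intro sw.mixed_hessian_cl_eq) auto
    also have "\<dots> = mixed_hessian_cl \<Omega> \<Omega>' c \<kappa> \<psi> x y $ i $ j"
      using mixed_hessian_cl_eq[OF *(1,2,3) assms(3) *(4) assms(4) G] by simp
    finally show ?thesis .
  qed
  then show ?thesis by (simp add: vec_eq_iff transpose_def)
qed

lemma pvec_component:
  assumes "\<kappa> \<in> charts_at \<A> x" "\<psi> \<in> charts_at \<B> y"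
  shows "pvec \<B> c x y \<psi> $ r = - pd c \<kappa> \<psi> [Inr r] (cmap \<kappa> x) (cmap \<psi> y)"
proof -
  have "cinv \<kappa> (cmap \<kappa> x) = x" using assms cinv_cmap[OF mfA] by (auto simp: charts_at_def)
  then show ?thesis
    using assms(2)
    by (simp add: pvec_def differential_def pd_def coord_dir_def local_cost_def)
qed

text \<open>The components of a differential in another chart are obtained by multiplication with the Jacobian of the
transition map, which does not depend on \<open>x\<close>. Hence equations between covectors at \<open>y\<close> that are linear may be
checked in one chart.\<close>

lemma pvec_change_chart:
  assumes "y \<in> \<Omega>'" "\<psi> \<in> charts_at \<B> y" "\<psi>' \<in> charts_at \<B> y"
  shows "\<exists>J. \<forall>x\<in>\<Omega>. pvec \<B> c x y \<psi>' = J *v pvec \<B> c x y \<psi>"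
proof -
  define \<tau> where "\<tau> = cmap \<psi> \<circ> cinv \<psi>'"
  obtain T where T: "(\<tau> has_derivative T) (at (cmap \<psi>' y))"
    using transition_has_derivative[OF mfB assms(3,2)] unfolding \<tau>_def by blast
  have *: "\<psi> \<in> \<B>" "\<psi>' \<in> \<B>" "y \<in> cdom \<psi>" "y \<in> cdom \<psi>'" using assms by (auto simp: charts_at_def)
  have "pvec \<B> c x y \<psi>' = (\<chi> a r. T (axis a 1) $ r) *v pvec \<B> c x y \<psi>" if x: "x \<in> \<Omega>" for x
  proof -
    obtain \<kappa> where \<kappa>: "\<kappa> \<in> charts_at \<A> x" using charts_at_nonempty[OF mfA] by blast
    have \<kappa>': "\<kappa> \<in> \<A>" "x \<in> cdom \<kappa>" "cinv \<kappa> (cmap \<kappa> x) = x"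
      using \<kappa> cinv_cmap[OF mfA] by (auto simp: charts_at_def)
    have u: "cmap \<kappa> x \<in> chart_img \<kappa> \<Omega>" using \<kappa>' x by blast
    have "pvec \<B> c x y \<psi>' $ a = (\<Sum>r\<in>UNIV. T (axis a 1) $ r * pvec \<B> c x y \<psi> $ r)" for a
    proof -
      define \<delta> where "\<delta> t = \<tau> (cmap \<psi>' y + t *\<^sub>R axis a 1)" for t :: real
      have \<delta>0: "\<delta> 0 = cmap \<psi> y"
        using cinv_cmap[OF mfB *(2,4)] by (simp add: \<delta>_def \<tau>_def)
      have "((\<lambda>t. cmap \<psi>' y + t *\<^sub>R axis a 1) has_vector_derivative axis a 1) (at 0)"
        by (auto intro!: derivative_eq_intros)
      moreover have "(\<tau> has_derivative T) (at (cmap \<psi>' y + 0 *\<^sub>R axis a 1) within range (\<lambda>t. cmap \<psi>' y + t *\<^sub>R axis a 1))"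
        using T by (simp add: has_derivative_at_withinI)
      ultimately have "(\<tau> \<circ> (\<lambda>t. cmap \<psi>' y + t *\<^sub>R axis a 1) has_vector_derivative T (axis a 1)) (at 0)"
        by (rule vector_derivative_diff_chain_within)
      then have d\<delta>: "(\<delta> has_vector_derivative T (axis a 1)) (at 0)"
        by (simp add: o_def flip: \<delta>_def)
      have "\<delta> 0 \<in> chart_img \<psi> \<Omega>'" using \<delta>0 * assms(1) by auto
      from pd_chain2[OF \<kappa>'(1) *(1) mixed_words(1) u this d\<delta>]
      have d1: "((\<lambda>t. pd c \<kappa> \<psi> [] (cmap \<kappa> x) (\<delta> t)) has_real_derivative
          (\<Sum>r\<in>UNIV. T (axis a 1) $ r * pd c \<kappa> \<psi> [Inr r] (cmap \<kappa> x) (cmap \<psi> y))) (at 0)"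
        by (simp only: \<delta>0)
      define N where "N = chart_img \<psi>' (cdom \<psi>)"
      have N: "open N" "cmap \<psi>' y \<in> N"
        using open_chart_img[OF mfB *(2) open_cdom[OF mfB *(1)]] * by (auto simp: N_def)
      have "((\<lambda>t. cmap \<psi>' y + t *\<^sub>R axis a 1) \<longlongrightarrow> cmap \<psi>' y + 0 *\<^sub>R axis a 1) (nhds (0::real))"
        by (intro tendsto_intros filterlim_ident)
      then have "\<forall>\<^sub>F t in nhds 0. cmap \<psi>' y + t *\<^sub>R axis a 1 \<in> N"
        using N by (intro topological_tendstoD) auto
      then have ev: "\<forall>\<^sub>F t in nhds 0. pd c \<kappa> \<psi> [] (cmap \<kappa> x) (\<delta> t) = (c x \<circ> cinv \<psi>') (cmap \<psi>' y + t *\<^sub>R axis a 1)"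
      proof eventually_elim
        case (elim t)
        then obtain z where z: "z \<in> cdom \<psi>'" "z \<in> cdom \<psi>" "cmap \<psi>' y + t *\<^sub>R axis a 1 = cmap \<psi>' z"
          by (auto simp: N_def)
        show ?case
          using z cinv_cmap[OF mfB *(1)] cinv_cmap[OF mfB *(2)] \<kappa>'(3)
          by (simp add: pd_def local_cost_def \<delta>_def \<tau>_def)
      qed
      have "((\<lambda>t. (c x \<circ> cinv \<psi>') (cmap \<psi>' y + t *\<^sub>R axis a 1)) has_real_derivative
          (\<Sum>r\<in>UNIV. T (axis a 1) $ r * pd c \<kappa> \<psi> [Inr r] (cmap \<kappa> x) (cmap \<psi> y))) (at 0)"
        using d1 DERIV_cong_ev[OF refl ev refl] by blast
      then have "vector_derivative (\<lambda>t. (c x \<circ> cinv \<psi>') (cmap \<psi>' y + t *\<^sub>R axis a 1)) (at 0)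
          = (\<Sum>r\<in>UNIV. T (axis a 1) $ r * pd c \<kappa> \<psi> [Inr r] (cmap \<kappa> x) (cmap \<psi> y))"
        by (simp add: has_real_derivative_iff_has_vector_derivative vector_derivative_at)
      then have "pvec \<B> c x y \<psi>' $ a = - (\<Sum>r\<in>UNIV. T (axis a 1) $ r * pd c \<kappa> \<psi> [Inr r] (cmap \<kappa> x) (cmap \<psi> y))"
        using assms(3) by (simp add: pvec_def differential_def)
      then show ?thesis
        by (simp add: pvec_component[OF \<kappa> assms(2)] sum_negf)
    qed
    then show ?thesis
      by (simp add: vec_eq_iff matrix_vector_mult_def)
  qed
  then show ?thesis by blast
qed

end


section \<open>The covector map and curves along which it is affine\<close>

locale cost_domain = cost_regular \<A> \<B> \<Omega> \<Omega>' c
  for \<A> :: "('a::{t2_space, second_countable_topology}, 'n::finite) chart set"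
    and \<B> :: "('b::{t2_space, second_countable_topology}, 'n) chart set"
    and \<Omega> :: "'a set" and \<Omega>' :: "'b set" and c :: "'a \<Rightarrow> 'b \<Rightarrow> real" +
  assumes compact1: "compact (closure \<Omega>)" and compact2: "compact (closure \<Omega>')"
    and tw: "twist \<A> \<B> \<Omega> \<Omega>' c"
    and nd: "nondeg \<A> \<B> \<Omega> \<Omega>' c"
    and convex1: "c_convex_wrt \<B> c \<Omega> \<Omega> \<Omega>'"
    and convex2: "c_convex_wrt \<A> (swap_cost c) \<Omega>' \<Omega>' \<Omega>"

begin


lemma swapped_domain: "cost_domain \<B> \<A> \<Omega>' \<Omega> (swap_cost c)"
proof -
  interpret sw: cost_regular \<B> \<A> \<Omega>' \<Omega> "swap_cost c" by (rule swapped_regular)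
  have "nondeg \<B> \<A> \<Omega>' \<Omega> (swap_cost c)"
    unfolding nondeg_def
  proof (intro ballI)
    fix y x \<psi> \<kappa>
    assume *: "y \<in> closure \<Omega>'" "x \<in> closure \<Omega>" "\<psi> \<in> charts_at \<B> y" "\<kappa> \<in> charts_at \<A> x"
    define M where "M = mixed_hessian_cl \<Omega> \<Omega>' c \<kappa> \<psi> x y"
    have M: "mixed_hessian_cl \<Omega>' \<Omega> (swap_cost c) \<psi> \<kappa> y x = transpose M"
      using mixed_hessian_cl_swap * by (simp add: M_def)
    have "invertible (- M) \<and> invertible (transpose (- M))"
      using nd * by (simp add: nondeg_def M_def)
    moreover have "transpose (- M) = - transpose M" by (simp add: transpose_def vec_eq_iff)
    moreover have "transpose (- transpose M) = - M" by (simp add: transpose_def vec_eq_iff)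
    ultimately show "invertible (- mixed_hessian_cl \<Omega>' \<Omega> (swap_cost c) \<psi> \<kappa> y x) \<and>
        invertible (transpose (- mixed_hessian_cl \<Omega>' \<Omega> (swap_cost c) \<psi> \<kappa> y x))"
      unfolding M by simp
  qed
  then show ?thesis
    using compact1 compact2 twist_swap[OF tw] convex1 convex2 by unfold_locales simp_all
qed

lemma det_mixed_hessian_cl:
  assumes "\<kappa> \<in> charts_at \<A> x" "\<psi> \<in> charts_at \<B> y" "x \<in> closure \<Omega>" "y \<in> closure \<Omega>'"
  shows "det (mixed_hessian_cl \<Omega> \<Omega>' c \<kappa> \<psi> x y) \<noteq> 0"
proof -
  have "invertible (- mixed_hessian_cl \<Omega> \<Omega>' c \<kappa> \<psi> x y)"
    using nd assms by (auto simp: nondeg_def)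
  then obtain B where "- mixed_hessian_cl \<Omega> \<Omega>' c \<kappa> \<psi> x y ** B = mat 1"
      "B ** - mixed_hessian_cl \<Omega> \<Omega>' c \<kappa> \<psi> x y = mat 1"
    unfolding invertible_def by blast
  then have "mixed_hessian_cl \<Omega> \<Omega>' c \<kappa> \<psi> x y ** (- B) = mat 1"
    by (simp add: matrix_matrix_mult_def vec_eq_iff)
  then show ?thesis
    by (metis det_I det_mul mult_zero_left zero_neq_one)
qed

lemma det_hess:
  assumes "\<kappa> \<in> \<A>" "\<psi> \<in> \<B>" "u \<in> chart_img \<kappa> \<Omega>" "v \<in> chart_img \<psi> \<Omega>'"
  shows "det (hess \<kappa> \<psi> u v) \<noteq> 0"
proof -
  obtain x y where "x \<in> cdom \<kappa> \<inter> \<Omega>" "y \<in> cdom \<psi> \<inter> \<Omega>'" "u = cmap \<kappa> x" "v = cmap \<psi> y"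
    using assms by blast
  moreover from this have "\<kappa> \<in> charts_at \<A> x" "\<psi> \<in> charts_at \<B> y" "x \<in> closure \<Omega>" "y \<in> closure \<Omega>'"
    using assms closure_subset[of \<Omega>] closure_subset[of \<Omega>'] by (auto simp: charts_at_def)
  ultimately show ?thesis
    using det_mixed_hessian_cl[of \<kappa> x \<psi> y] mixed_hessian_eq_hess[of \<kappa> x \<psi> y] by simp
qed

lemma hess_inverse:
  assumes "\<kappa> \<in> \<A>" "\<psi> \<in> \<B>" "u \<in> chart_img \<kappa> \<Omega>" "v \<in> chart_img \<psi> \<Omega>'"
  shows "hess \<kappa> \<psi> u v *v (matrix_inv (hess \<kappa> \<psi> u v) *v z) = z"
    "matrix_inv (hess \<kappa> \<psi> u v) *v (hess \<kappa> \<psi> u v *v z) = z"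
  using matrix_inv_inverse[of "hess \<kappa> \<psi> u v"] det_hess[OF assms]
  by (simp_all add: matrix_vector_mul_assoc invertible_det_nz)

lemma hess_swap:
  assumes "\<kappa> \<in> \<A>" "\<psi> \<in> \<B>" "u \<in> chart_img \<kappa> \<Omega>" "v \<in> chart_img \<psi> \<Omega>'"
  shows "cost_regular.hess (swap_cost c) \<psi> \<kappa> v u = transpose (hess \<kappa> \<psi> u v)"
proof -
  interpret sw: cost_regular \<B> \<A> \<Omega>' \<Omega> "swap_cost c" by (rule swapped_regular)
  have "pd (swap_cost c) \<psi> \<kappa> [Inl j, Inr i] v u = pd c \<kappa> \<psi> [Inl i, Inr j] u v" for i j
    using pd_pair_commute[OF assms, of i j] pd_swap[of c \<psi> \<kappa> "[Inr j, Inl i]" v u] by simp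
  then show ?thesis by (simp add: sw.hess_def hess_def transpose_def)
qed

text \<open>The twist condition, read off in a single chart.\<close>

lemma pvec_inject:
  assumes "y \<in> \<Omega>'" "\<psi> \<in> charts_at \<B> y" "x \<in> \<Omega>" "x' \<in> \<Omega>"
    and "pvec \<B> c x y \<psi> = pvec \<B> c x' y \<psi>"
  shows "x = x'"
proof -
  have "pvec \<B> c x y \<psi>' = pvec \<B> c x' y \<psi>'" for \<psi>'
  proof (cases "\<psi>' \<in> charts_at \<B> y")
    case True
    then show ?thesis using pvec_change_chart[OF assms(1,2) True] assms(3-5) by metis
  qed (simp add: pvec_def differential_def)
  then have "pvec \<B> c x y = pvec \<B> c x' y" by blast
  then show ?thesis using tw assms by (auto simp: twist_def dest: inj_onD)
qed

lemma covector_interp_eq_iff: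
  assumes "y \<in> \<Omega>'" "\<psi> \<in> charts_at \<B> y" "x \<in> \<Omega>" "x0 \<in> \<Omega>" "x1 \<in> \<Omega>"
  shows "pvec \<B> c x y = covector_interp (pvec \<B> c x0 y) (pvec \<B> c x1 y) s \<longleftrightarrow>
    pvec \<B> c x y \<psi> = (1 - s) *\<^sub>R pvec \<B> c x0 y \<psi> + s *\<^sub>R pvec \<B> c x1 y \<psi>"
proof
  assume *: "pvec \<B> c x y \<psi> = (1 - s) *\<^sub>R pvec \<B> c x0 y \<psi> + s *\<^sub>R pvec \<B> c x1 y \<psi>"
  show "pvec \<B> c x y = covector_interp (pvec \<B> c x0 y) (pvec \<B> c x1 y) s"
  proof
    fix \<psi>'
    show "pvec \<B> c x y \<psi>' = covector_interp (pvec \<B> c x0 y) (pvec \<B> c x1 y) s \<psi>'"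
    proof (cases "\<psi>' \<in> charts_at \<B> y")
      case True
      obtain J where "\<And>x. x \<in> \<Omega> \<Longrightarrow> pvec \<B> c x y \<psi>' = J *v pvec \<B> c x y \<psi>"
        using pvec_change_chart[OF assms(1,2) True] by blast
      then show ?thesis
        using * assms(3-5)
        by (simp add: covector_interp_def matrix_vector_right_distrib matrix_vector_mult_scaleR)
    qed (simp add: pvec_def differential_def covector_interp_def)
  qed
qed (simp add: covector_interp_def)

lemma c_segment_eqI:
  assumes "y \<in> \<Omega>'" "\<psi> \<in> charts_at \<B> y" "x \<in> \<Omega>" "x0 \<in> \<Omega>" "x1 \<in> \<Omega>"
    and "pvec \<B> c x y \<psi> = (1 - s) *\<^sub>R pvec \<B> c x0 y \<psi> + s *\<^sub>R pvec \<B> c x1 y \<psi>"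
  shows "c_segment \<B> c \<Omega> y x0 x1 s = x"
  unfolding c_segment_def c_exp_def
proof (rule the_equality)
  show "x \<in> \<Omega> \<and> pvec \<B> c x y = covector_interp (pvec \<B> c x0 y) (pvec \<B> c x1 y) s"
    using covector_interp_eq_iff[OF assms(1-5)] assms by blast
next
  fix x' assume x': "x' \<in> \<Omega> \<and> pvec \<B> c x' y = covector_interp (pvec \<B> c x0 y) (pvec \<B> c x1 y) s"
  then have "pvec \<B> c x' y \<psi> = pvec \<B> c x y \<psi>"
    using assms(6) by (simp add: covector_interp_def)
  then show "x' = x" using pvec_inject assms x' by blast
qed

lemma convex_pvec_image:
  assumes "y \<in> \<Omega>'" "\<psi> \<in> charts_at \<B> y"
  shows "convex ((\<lambda>x. pvec \<B> c x y \<psi>) ` \<Omega>)"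
  unfolding convex_alt
proof (intro ballI allI impI; clarify)
  fix x0 x1 and s :: real
  assume *: "x0 \<in> \<Omega>" "x1 \<in> \<Omega>" "0 \<le> s" "s \<le> 1"
  then have "covector_interp (pvec \<B> c x0 y) (pvec \<B> c x1 y) s \<in> (\<lambda>x. pvec \<B> c x y) ` \<Omega>"
    using convex1 assms unfolding c_convex_wrt_def by auto
  then obtain x where x: "x \<in> \<Omega>" "pvec \<B> c x y = covector_interp (pvec \<B> c x0 y) (pvec \<B> c x1 y) s"
    by auto
  then show "(1 - s) *\<^sub>R pvec \<B> c x0 y \<psi> + s *\<^sub>R pvec \<B> c x1 y \<psi> \<in> (\<lambda>x. pvec \<B> c x y \<psi>) ` \<Omega>"
    using covector_interp_eq_iff[OF assms x(1) *(1,2)] by (metis imageI)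
qed

text \<open>The map \<open>x \<mapsto> - \<partial>\<^sub>y c(x, y)\<close> in coordinates; its inverse is the \<open>c\<close>-exponential.\<close>

definition coord_map :: "('a, 'n) chart \<Rightarrow> ('b, 'n) chart \<Rightarrow> real ^ 'n \<Rightarrow> real ^ 'n \<Rightarrow> real ^ 'n" where
  "coord_map \<kappa> \<psi> v u = (\<chi> r. - pd c \<kappa> \<psi> [Inr r] u v)"

lemma coord_map_cmap:
  assumes "\<kappa> \<in> charts_at \<A> x" "\<psi> \<in> charts_at \<B> y"
  shows "coord_map \<kappa> \<psi> (cmap \<psi> y) (cmap \<kappa> x) = pvec \<B> c x y \<psi>"
  by (simp add: coord_map_def vec_eq_iff pvec_component[OF assms])

lemma coord_map_continuous:
  assumes "\<kappa> \<in> \<A>" "\<psi> \<in> \<B>" "v \<in> chart_img \<psi> \<Omega>'"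
  shows "continuous_on (chart_img \<kappa> \<Omega>) (coord_map \<kappa> \<psi> v)"
  unfolding coord_map_def
  by (intro continuous_on_vec_lambda continuous_on_minus
      pd_continuous1[OF assms(1,2) mixed_words(1) assms(3)])

lemma coord_map_inj:
  assumes "\<kappa> \<in> \<A>" "y \<in> \<Omega>'" "\<psi> \<in> charts_at \<B> y"
  shows "inj_on (coord_map \<kappa> \<psi> (cmap \<psi> y)) (chart_img \<kappa> \<Omega>)"
proof (rule inj_onI; clarify)
  fix x x' assume "x \<in> cdom \<kappa>" "x \<in> \<Omega>" "x' \<in> cdom \<kappa>" "x' \<in> \<Omega>"
    and eq: "coord_map \<kappa> \<psi> (cmap \<psi> y) (cmap \<kappa> x) = coord_map \<kappa> \<psi> (cmap \<psi> y) (cmap \<kappa> x')"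
  moreover from this have "\<kappa> \<in> charts_at \<A> x" "\<kappa> \<in> charts_at \<A> x'"
    using assms by (auto simp: charts_at_def)
  ultimately have "x = x'"
    using eq pvec_inject[OF assms(2,3)] assms(3)
    by (metis coord_map_cmap)
  then show "cmap \<kappa> x = cmap \<kappa> x'" by simp
qed

lemma coord_map_image:
  assumes "\<kappa> \<in> \<A>" "y \<in> \<Omega>'" "\<psi> \<in> charts_at \<B> y"
  shows "coord_map \<kappa> \<psi> (cmap \<psi> y) ` chart_img \<kappa> \<Omega> = (\<lambda>x. pvec \<B> c x y \<psi>) ` (cdom \<kappa> \<inter> \<Omega>)"
  unfolding image_image
proof (rule image_cong[OF refl])
  fix x assume "x \<in> cdom \<kappa> \<inter> \<Omega>"
  then have "\<kappa> \<in> charts_at \<A> x" using assms(1) by (simp add: charts_at_def)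
  then show "coord_map \<kappa> \<psi> (cmap \<psi> y) (cmap \<kappa> x) = pvec \<B> c x y \<psi>"
    using assms(3) by (rule coord_map_cmap)
qed

text \<open>Invariance of domain. It makes the covectors at \<open>y\<close> of points of \<open>\<Omega>\<close> an open set, so that \<open>c\<close>-segments
extend beyond their end points and two-sided derivatives are available on all of them.\<close>

lemma open_coord_map_image:
  assumes "\<kappa> \<in> \<A>" "y \<in> \<Omega>'" "\<psi> \<in> charts_at \<B> y"
  shows "open ((\<lambda>x. pvec \<B> c x y \<psi>) ` (cdom \<kappa> \<inter> \<Omega>))"
proof -
  have "\<psi> \<in> \<B>" "cmap \<psi> y \<in> chart_img \<psi> \<Omega>'" using assms by (auto simp: charts_at_def)
  then have "open (coord_map \<kappa> \<psi> (cmap \<psi> y) ` chart_img \<kappa> \<Omega>)"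
    using assms by (intro invariance_of_domain coord_map_continuous coord_map_inj open_img1)
  then show ?thesis by (simp only: coord_map_image[OF assms])
qed

lemma open_pvec_image:
  assumes "y \<in> \<Omega>'" "\<psi> \<in> charts_at \<B> y"
  shows "open ((\<lambda>x. pvec \<B> c x y \<psi>) ` \<Omega>)"
proof -
  have "(\<Union>\<kappa>\<in>\<A>. cdom \<kappa>) = UNIV" using mfA by (simp add: smooth_manifold_def)
  then have "\<Omega> = (\<Union>\<kappa>\<in>\<A>. cdom \<kappa> \<inter> \<Omega>)" by blast
  then have "(\<lambda>x. pvec \<B> c x y \<psi>) ` \<Omega> = (\<Union>\<kappa>\<in>\<A>. (\<lambda>x. pvec \<B> c x y \<psi>) ` (cdom \<kappa> \<inter> \<Omega>))"
    by (metis image_UN)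
  then show ?thesis using open_coord_map_image[OF _ assms] by auto
qed

lemma coord_map_has_derivative:
  assumes "\<kappa> \<in> \<A>" "\<psi> \<in> \<B>" "u \<in> chart_img \<kappa> \<Omega>" "v \<in> chart_img \<psi> \<Omega>'"
  shows "(coord_map \<kappa> \<psi> v has_derivative (\<lambda>h. - (transpose (hess \<kappa> \<psi> u v) *v h))) (at u)"
proof -
  have "((\<lambda>u. coord_map \<kappa> \<psi> v u \<bullet> axis r 1) has_derivative (\<lambda>h. - (transpose (hess \<kappa> \<psi> u v) *v h) \<bullet> axis r 1)) (at u)"
    for r
  proof -
    have "((\<lambda>u. - pd c \<kappa> \<psi> [Inr r] u v) has_derivative
        (\<lambda>h. - (\<Sum>i\<in>UNIV. h $ i * pd c \<kappa> \<psi> [Inl i, Inr r] u v))) (at u)"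
      by (intro has_derivative_minus pd_has_derivative1[OF assms(1,2) mixed_words(2) assms(3,4)])
    then show ?thesis
      by (simp add: coord_map_def inner_axis matrix_vector_mult_def transpose_def hess_def mult.commute)
  qed
  then show ?thesis
    by (subst has_derivative_componentwise_within) (auto simp: Basis_vec_real)
qed

text \<open>A \<open>c\<close>-segment with respect to \<open>y\<close>, parametrized over an arbitrary set of parameters: the covector at \<open>y\<close>
is affine.\<close>

definition c_line :: "'b \<Rightarrow> ('b, 'n) chart \<Rightarrow> real ^ 'n \<Rightarrow> real ^ 'n \<Rightarrow> real set \<Rightarrow> (real \<Rightarrow> 'a) \<Rightarrow> bool" where
  "c_line y \<psi> a b J \<gamma> \<longleftrightarrow> (\<forall>s\<in>J. \<gamma> s \<in> \<Omega> \<and> pvec \<B> c (\<gamma> s) y \<psi> = a + s *\<^sub>R b)"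

text \<open>The set of admissible parameters is open because the image of the covector map is, and an interval
because this image is convex. Taking all of them makes the line contain every segment through \<open>x0\<close> in
the direction \<open>b\<close>.\<close>

lemma c_line_exists:
  assumes y: "y \<in> \<Omega>'" "\<psi> \<in> charts_at \<B> y" and x0: "x0 \<in> \<Omega>"
  obtains J \<gamma> where "open J" "convex J" "0 \<in> J" "c_line y \<psi> (pvec \<B> c x0 y \<psi>) b J \<gamma>" "\<gamma> 0 = x0"
    "\<And>s x. x \<in> \<Omega> \<Longrightarrow> pvec \<B> c x y \<psi> = pvec \<B> c x0 y \<psi> + s *\<^sub>R b \<Longrightarrow> s \<in> J \<and> \<gamma> s = x"
proof -
  define a where "a = pvec \<B> c x0 y \<psi>"
  define P where "P = (\<lambda>x. pvec \<B> c x y \<psi>) ` \<Omega>"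
  define J where "J = (\<lambda>s. a + s *\<^sub>R b) -` P"
  define \<gamma> where "\<gamma> s = inv_into \<Omega> (\<lambda>x. pvec \<B> c x y \<psi>) (a + s *\<^sub>R b)" for s
  have "open J"
    unfolding J_def P_def
    by (intro open_vimage open_pvec_image y) (auto intro!: continuous_intros)
  have "convex J"
  proof (rule convexI)
    fix s t p q :: real assume *: "s \<in> J" "t \<in> J" "0 \<le> p" "0 \<le> q" "p + q = 1"
    then have "p *\<^sub>R (a + s *\<^sub>R b) + q *\<^sub>R (a + t *\<^sub>R b) \<in> P"
      using convex_pvec_image[OF y] unfolding J_def P_def by (auto intro: convexD)
    also have "p *\<^sub>R (a + s *\<^sub>R b) + q *\<^sub>R (a + t *\<^sub>R b) = (p + q) *\<^sub>R a + (p * s + q * t) *\<^sub>R b"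
      by (simp add: algebra_simps)
    finally show "p *\<^sub>R s + q *\<^sub>R t \<in> J" using *(5) by (simp add: J_def)
  qed
  have line: "\<gamma> s \<in> \<Omega>" "pvec \<B> c (\<gamma> s) y \<psi> = a + s *\<^sub>R b" if "s \<in> J" for s
  proof -
    have "a + s *\<^sub>R b \<in> P" using that by (simp add: J_def)
    then show "\<gamma> s \<in> \<Omega>" "pvec \<B> c (\<gamma> s) y \<psi> = a + s *\<^sub>R b"
      unfolding P_def \<gamma>_def by (rule inv_into_into, rule f_inv_into_f)
  qed
  have uniq: "s \<in> J \<and> \<gamma> s = x" if "x \<in> \<Omega>" "pvec \<B> c x y \<psi> = a + s *\<^sub>R b" for s x
  proof -
    have "a + s *\<^sub>R b \<in> P" unfolding P_def using that by (metis imageI)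
    then have "s \<in> J" by (simp add: J_def)
    then show ?thesis using line[of s] that pvec_inject[OF y] by metis
  qed
  have "0 \<in> J" "\<gamma> 0 = x0" using uniq[OF x0, of 0] by (auto simp: a_def)
  show ?thesis
  proof (rule that[where J=J and \<gamma>=\<gamma>, OF \<open>open J\<close> \<open>convex J\<close> \<open>0 \<in> J\<close> _ \<open>\<gamma> 0 = x0\<close>])
    show "c_line y \<psi> (pvec \<B> c x0 y \<psi>) b J \<gamma>"
      unfolding c_line_def using line by (simp add: a_def)
    show "s \<in> J \<and> \<gamma> s = x" if "x \<in> \<Omega>" "pvec \<B> c x y \<psi> = pvec \<B> c x0 y \<psi> + s *\<^sub>R b" for s x
      using uniq[of x s] that by (simp add: a_def)
  qed
qed

text \<open>The contraction \<open>c\<^sub>i\<^sub>j\<^sub>,\<^sub>r V\<^sup>i V\<^sup>j\<close>, with \<open>r\<close> barred.\<close>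

definition third1 ::
  "('a, 'n) chart \<Rightarrow> ('b, 'n) chart \<Rightarrow> real ^ 'n \<Rightarrow> real ^ 'n \<Rightarrow> real ^ 'n \<Rightarrow> real ^ 'n" where
  "third1 \<kappa> \<psi> u v V =
     (\<chi> r. \<Sum>i\<in>UNIV. (\<Sum>k\<in>UNIV. V $ k * pd c \<kappa> \<psi> [Inl k, Inl i, Inr r] u v) * V $ i)"

text \<open>The curve is the inverse of the covector map composed with a line, hence differentiable, and its velocity \<open>u1\<close>
solves a linear system with coefficients \<open>c\<^sub>i\<^sub>,\<^sub>r\<close>. These are differentiable along the curve, so the velocity
is of class \<open>C\<^sup>1\<close>; differentiating the system gives the geodesic-like equation for the acceleration \<open>u2\<close>.\<close>

lemma c_line_C2:
  assumes y: "y \<in> \<Omega>'" "\<psi> \<in> charts_at \<B> y" and J: "open J" "s0 \<in> J"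
    and \<gamma>: "c_line y \<psi> a b J \<gamma>" and \<kappa>: "\<kappa> \<in> charts_at \<A> (\<gamma> s0)"
  obtains N u1 u2 where "open N" "s0 \<in> N" "N \<subseteq> J"
    "\<And>s. s \<in> N \<Longrightarrow> \<gamma> s \<in> cdom \<kappa>"
    "\<And>s. s \<in> N \<Longrightarrow> (cmap \<kappa> \<circ> \<gamma> has_vector_derivative u1 s) (at s)"
    "\<And>s. s \<in> N \<Longrightarrow> (u1 has_vector_derivative u2 s) (at s)"
    "continuous_on N u1" "continuous_on N u2"
    "\<And>s. s \<in> N \<Longrightarrow> u1 s v* hess \<kappa> \<psi> (cmap \<kappa> (\<gamma> s)) (cmap \<psi> y) = - b"
    "\<And>s. s \<in> N \<Longrightarrow> u2 s v* hess \<kappa> \<psi> (cmap \<kappa> (\<gamma> s)) (cmap \<psi> y)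
      = - third1 \<kappa> \<psi> (cmap \<kappa> (\<gamma> s)) (cmap \<psi> y) (u1 s)"
proof -
  define v where "v = cmap \<psi> y"
  define U where "U = chart_img \<kappa> \<Omega>"
  define \<Phi> where "\<Phi> = coord_map \<kappa> \<psi> v"
  define u where "u = cmap \<kappa> \<circ> \<gamma>"
  have [simp]: "\<kappa> \<in> \<A>" "\<psi> \<in> \<B>" "y \<in> cdom \<psi>" "v \<in> chart_img \<psi> \<Omega>'"
    using \<kappa> y by (auto simp: charts_at_def v_def)
  have U: "open U" unfolding U_def by (simp add: open_img1)
  define V where "V = (\<lambda>x. pvec \<B> c x y \<psi>) ` (cdom \<kappa> \<inter> \<Omega>)"
  have V: "open V" unfolding V_def using y by (simp add: open_coord_map_image)
  define N where "N = J \<inter> (\<lambda>s. a + s *\<^sub>R b) -` V"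
  have N: "open N"
    unfolding N_def using J V by (intro open_Int open_vimage) (auto intro!: continuous_intros)
  have "s0 \<in> N"
    using \<gamma> \<kappa> J unfolding N_def V_def c_line_def charts_at_def by force
  \<comment> \<open>The curve stays in the chart because its covector stays in the open set \<open>V\<close>.\<close>
  have inN: "\<gamma> s \<in> cdom \<kappa>" "\<gamma> s \<in> \<Omega>" "u s \<in> U" "\<Phi> (u s) = a + s *\<^sub>R b" if "s \<in> N" for s
  proof -
    have s: "\<gamma> s \<in> \<Omega>" "pvec \<B> c (\<gamma> s) y \<psi> = a + s *\<^sub>R b"
      using \<gamma> that by (auto simp: N_def c_line_def)
    have "a + s *\<^sub>R b \<in> V" using that by (simp add: N_def)
    then obtain x where "x \<in> cdom \<kappa> \<inter> \<Omega>" "a + s *\<^sub>R b = pvec \<B> c x y \<psi>"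
      unfolding V_def by (rule imageE)
    then show *: "\<gamma> s \<in> cdom \<kappa>" "\<gamma> s \<in> \<Omega>"
      using pvec_inject[OF y s(1), of x] s by auto
    then show "u s \<in> U" by (auto simp: u_def U_def)
    show "\<Phi> (u s) = a + s *\<^sub>R b"
      using * s y coord_map_cmap[of \<kappa> "\<gamma> s" \<psi> y] by (simp add: u_def \<Phi>_def v_def charts_at_def)
  qed
  define A where "A s = transpose (hess \<kappa> \<psi> (u s) v)" for s
  have detA: "det (A s) \<noteq> 0" if "s \<in> N" for s
    using det_hess[of \<kappa> \<psi> "u s" v] inN(3)[OF that] by (simp add: A_def det_transpose U_def)
  define u1 where "u1 s = matrix_inv (A s) *v (- b)" for s
  have invA: "A s *v (matrix_inv (A s) *v k) = k" "matrix_inv (A s) *v (A s *v k) = k" if "s \<in> N" for s k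
    using matrix_inv_inverse[of "A s"] detA[OF that]
    by (simp_all add: invertible_det_nz matrix_vector_mul_assoc)
  have u1_eq: "A s *v u1 s = - b" if "s \<in> N" for s
    using invA[OF that] by (simp add: u1_def)
  have injU: "inj_on \<Phi> U"
    unfolding \<Phi>_def U_def v_def using y by (simp add: coord_map_inj)
  have du: "(u has_vector_derivative u1 s) (at s)" if s: "s \<in> N" for s
  proof -
    define g where "g = inv_into U \<Phi>"
    have g: "g (\<Phi> w) = w" if "w \<in> U" for w unfolding g_def by (rule inv_into_f_f[OF injU that])
    have "(g has_derivative (\<lambda>k. - (matrix_inv (A s) *v k))) (at (\<Phi> (u s)))"
    proof (rule has_derivative_inverse_strong[OF U inN(3)[OF s]])
      show "continuous_on U \<Phi>" unfolding \<Phi>_def U_def by (simp add: coord_map_continuous)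
      show "(\<Phi> has_derivative (\<lambda>h. - (A s *v h))) (at (u s))"
        unfolding \<Phi>_def A_def using inN(3)[OF s] by (intro coord_map_has_derivative) (simp_all add: U_def)
      show "(\<lambda>h. - (A s *v h)) \<circ> (\<lambda>k. - (matrix_inv (A s) *v k)) = id"
      proof
        fix k
        have "A s *v (- (matrix_inv (A s) *v k)) = - (A s *v (matrix_inv (A s) *v k))"
          by (simp add: vec_eq_iff matrix_vector_mult_def sum_negf)
        then show "((\<lambda>h. - (A s *v h)) \<circ> (\<lambda>k. - (matrix_inv (A s) *v k))) k = id k"
          using invA[OF s] by simp
      qed
    qed (rule g)
    then have dg: "(g has_derivative (\<lambda>k. - (matrix_inv (A s) *v k))) (at (a + s *\<^sub>R b))"
      using inN(4)[OF s] by simp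
    have "((\<lambda>t. a + t *\<^sub>R b) has_vector_derivative b) (at s)"
      by (auto intro!: derivative_eq_intros)
    from vector_derivative_diff_chain_within[OF this has_derivative_at_withinI[OF dg]]
    have "((\<lambda>t. g (a + t *\<^sub>R b)) has_vector_derivative - (matrix_inv (A s) *v b)) (at s)"
      by (simp add: o_def)
    moreover have "- (matrix_inv (A s) *v b) = u1 s"
      by (simp add: u1_def vec_eq_iff matrix_vector_mult_def sum_negf)
    ultimately have "((\<lambda>t. g (a + t *\<^sub>R b)) has_vector_derivative u1 s) (at s)" by simp
    moreover have "g (a + t *\<^sub>R b) = u t" if "t \<in> N" for t
      using g[OF inN(3)[OF that]] inN(4)[OF that] by simp
    ultimately show ?thesis
      using has_vector_derivative_transform_within_open[OF _ N s] by blast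
  qed
  define A' where "A' s = (\<chi> r i. \<Sum>k\<in>UNIV. u1 s $ k * pd c \<kappa> \<psi> [Inl k, Inl i, Inr r] (u s) v)" for s
  have dA: "((\<lambda>s. A s $ r $ i) has_real_derivative A' s $ r $ i) (at s)" if "s \<in> N" for s r i
  proof -
    have "((\<lambda>s. pd c \<kappa> \<psi> [Inl i, Inr r] (u s) v) has_real_derivative
        (\<Sum>k\<in>UNIV. u1 s $ k * pd c \<kappa> \<psi> [Inl k, Inl i, Inr r] (u s) v)) (at s)"
      using inN(3)[OF that] by (intro pd_chain1 mixed_words(4) du that) (auto simp: U_def)
    then show ?thesis by (simp add: A_def A'_def transpose_def hess_def)
  qed
  have contu: "continuous_on N u"
    using du by (meson continuous_at_imp_continuous_on has_vector_derivative_continuous)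
  have contA: "continuous_on N (\<lambda>s. A s $ r $ i)" for r i
    using dA by (meson DERIV_isCont continuous_at_imp_continuous_on)
  have contu1: "continuous_on N u1"
    using contA detA u1_eq by (intro continuous_on_linear_solution[where A=A and b="\<lambda>_. - b"]) auto
  have "continuous_on N (\<lambda>s. A' s $ r $ i)" for r i
  proof -
    have "continuous_on N (\<lambda>s. pd c \<kappa> \<psi> [Inl k, Inl i, Inr r] (u s) v)" for k
      by (rule continuous_on_compose2[OF pd_continuous1[of \<kappa> \<psi> _ v] contu])
         (use inN(3) in \<open>auto simp: U_def intro: mixed_words\<close>)
    then show ?thesis
      using contu1 by (simp add: A'_def) (intro continuous_intros)
  qed
  then obtain u2 where u2: "\<And>s. s \<in> N \<Longrightarrow> (u1 has_vector_derivative u2 s) (at s)" "continuous_on N u2"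
      "\<And>s. s \<in> N \<Longrightarrow> A s *v u2 s = - (A' s *v u1 s)"
    using linear_solution_C1[OF N dA _ detA u1_eq] by blast
  show ?thesis
  proof (rule that[OF N \<open>s0 \<in> N\<close>])
    show "N \<subseteq> J" by (auto simp: N_def)
    show "u1 s v* hess \<kappa> \<psi> (cmap \<kappa> (\<gamma> s)) (cmap \<psi> y) = - b" if "s \<in> N" for s
      using u1_eq[OF that] by (simp add: A_def u_def v_def)
    show "(cmap \<kappa> \<circ> \<gamma> has_vector_derivative u1 s) (at s)" if "s \<in> N" for s
      using du[OF that] by (simp add: u_def)
    show "u2 s v* hess \<kappa> \<psi> (cmap \<kappa> (\<gamma> s)) (cmap \<psi> y)
      = - third1 \<kappa> \<psi> (cmap \<kappa> (\<gamma> s)) (cmap \<psi> y) (u1 s)" if "s \<in> N" for s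
    proof -
      have "A' s *v u1 s = third1 \<kappa> \<psi> (cmap \<kappa> (\<gamma> s)) (cmap \<psi> y) (u1 s)"
        by (simp add: A'_def third1_def u_def v_def matrix_vector_mult_def vec_eq_iff)
      then show ?thesis using u2(3)[OF that] by (simp add: A_def u_def v_def)
    qed
  qed (use inN u2 contu1 in auto)
qed

section \<open>The second variation of a cost difference\<close>

text \<open>The contraction \<open>c\<^sub>j\<^sub>,\<^sub>q\<^sub>r w\<^sup>q w\<^sup>r\<close>, with \<open>q\<close> and \<open>r\<close> barred.\<close>

definition third2 ::
  "('a, 'n) chart \<Rightarrow> ('b, 'n) chart \<Rightarrow> real ^ 'n \<Rightarrow> real ^ 'n \<Rightarrow> real ^ 'n \<Rightarrow> real ^ 'n" where
  "third2 \<kappa> \<psi> u v w =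
     (\<chi> j. \<Sum>r\<in>UNIV. (\<Sum>q\<in>UNIV. w $ q * pd c \<kappa> \<psi> [Inr q, Inl j, Inr r] u v) * w $ r)"

text \<open>The contraction \<open>c\<^sub>i\<^sub>j\<^sub>,\<^sub>q\<^sub>r V\<^sup>i V\<^sup>j w\<^sup>q w\<^sup>r\<close>, with \<open>q\<close> and \<open>r\<close> barred.\<close>

definition fourth ::
  "('a, 'n) chart \<Rightarrow> ('b, 'n) chart \<Rightarrow> real ^ 'n \<Rightarrow> real ^ 'n \<Rightarrow> real ^ 'n \<Rightarrow> real ^ 'n \<Rightarrow> real" where
  "fourth \<kappa> \<psi> u v V w =
     (\<Sum>j\<in>UNIV. V $ j * (\<Sum>r\<in>UNIV. (\<Sum>q\<in>UNIV. w $ q *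
        (\<Sum>i\<in>UNIV. V $ i * pd c \<kappa> \<psi> [Inl i, Inr q, Inl j, Inr r] u v)) * w $ r))"

text \<open>The Ma--Trudinger--Wang tensor with a tangent vector \<open>w\<close> at \<open>y\<close> in place of the covector \<open>\<eta>\<close> at \<open>x\<close>; the
mixed Hessian identifies the two. This form is symmetric in the roles of \<open>x\<close> and \<open>y\<close>.\<close>

definition curv ::
  "('a, 'n) chart \<Rightarrow> ('b, 'n) chart \<Rightarrow> real ^ 'n \<Rightarrow> real ^ 'n \<Rightarrow> real ^ 'n \<Rightarrow> real ^ 'n \<Rightarrow> real" where
  "curv \<kappa> \<psi> u v V w = third1 \<kappa> \<psi> u v V \<bullet> (matrix_inv (hess \<kappa> \<psi> u v) *v third2 \<kappa> \<psi> u v w)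
     - fourth \<kappa> \<psi> u v V w"

text \<open>The derivative in \<open>t\<close> of the mixed derivative of \<open>- c(\<gamma> s, \<delta> t)\<close>. Here \<open>V\<close> is the velocity of \<open>\<gamma>\<close>, and \<open>z\<close>
is the acceleration of \<open>\<delta>\<close>.\<close>

lemma mixed_form_has_derivative:
  assumes "\<kappa> \<in> \<A>" "\<psi> \<in> \<B>" "u \<in> chart_img \<kappa> \<Omega>" "\<delta> t \<in> chart_img \<psi> \<Omega>'"
    and "(\<delta> has_vector_derivative w) (at t)" "(v1 has_vector_derivative z) (at t)" "w = v1 t"
  shows "((\<lambda>t. - (V \<bullet> (hess \<kappa> \<psi> u (\<delta> t) *v v1 t))) has_real_derivative
    - (V \<bullet> third2 \<kappa> \<psi> u (\<delta> t) w) - V \<bullet> (hess \<kappa> \<psi> u (\<delta> t) *v z)) (at t)"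
proof -
  have d: "((\<lambda>t. pd c \<kappa> \<psi> [Inl j, Inr r] u (\<delta> t)) has_real_derivative
     (\<Sum>q\<in>UNIV. w $ q * pd c \<kappa> \<psi> [Inr q, Inl j, Inr r] u (\<delta> t))) (at t)" for j r
    by (rule pd_chain2[OF assms(1,2) mixed_words(4) assms(3-5)])
  have v: "((\<lambda>t. v1 t $ r) has_real_derivative z $ r) (at t)" for r
    using bounded_linear.has_vector_derivative[OF bounded_linear_vec_nth assms(6)]
    by (simp add: has_real_derivative_iff_has_vector_derivative)
  have "((\<lambda>t. - (\<Sum>j\<in>UNIV. V $ j * (\<Sum>r\<in>UNIV. pd c \<kappa> \<psi> [Inl j, Inr r] u (\<delta> t) * v1 t $ r)))
     has_real_derivative - (\<Sum>j\<in>UNIV. V $ j * (\<Sum>r\<in>UNIV.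
       (\<Sum>q\<in>UNIV. w $ q * pd c \<kappa> \<psi> [Inr q, Inl j, Inr r] u (\<delta> t)) * w $ r
       + z $ r * pd c \<kappa> \<psi> [Inl j, Inr r] u (\<delta> t)))) (at t)"
    unfolding \<open>w = v1 t\<close>
    by (intro DERIV_minus DERIV_sum DERIV_cmult DERIV_mult d[unfolded \<open>w = v1 t\<close>] v)
  then show ?thesis
    by (simp add: inner_vec_def matrix_vector_mult_def hess_def third2_def sum.distrib distrib_left mult.commute)
qed

text \<open>The acceleration \<open>z\<close> of the second curve drops out by the equation for the acceleration \<open>Z\<close> of the first one.
What \<open>Z\<close> contributes through the third derivatives becomes the quadratic term of the tensor.\<close>

lemma curv_is_derivative:
  assumes "\<kappa> \<in> \<A>" "\<psi> \<in> \<B>" "\<gamma> s \<in> chart_img \<kappa> \<Omega>" "v \<in> chart_img \<psi> \<Omega>'"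
    and "(\<gamma> has_vector_derivative V) (at s)" "(u1 has_vector_derivative Z) (at s)" "V = u1 s"
    and Z: "Z v* hess \<kappa> \<psi> (\<gamma> s) v = - third1 \<kappa> \<psi> (\<gamma> s) v V"
  shows "((\<lambda>s. - (u1 s \<bullet> third2 \<kappa> \<psi> (\<gamma> s) v w) - u1 s \<bullet> (hess \<kappa> \<psi> (\<gamma> s) v *v z)) has_real_derivative
    curv \<kappa> \<psi> (\<gamma> s) v V w) (at s)"
proof -
  have d2: "((\<lambda>s. pd c \<kappa> \<psi> [Inl j, Inr r] (\<gamma> s) v) has_real_derivative
     (\<Sum>i\<in>UNIV. V $ i * pd c \<kappa> \<psi> [Inl i, Inl j, Inr r] (\<gamma> s) v)) (at s)" for j r
    by (rule pd_chain1[OF assms(1,2) mixed_words(4) assms(3-5)])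
  have d3: "((\<lambda>s. pd c \<kappa> \<psi> [Inr q, Inl j, Inr r] (\<gamma> s) v) has_real_derivative
     (\<Sum>i\<in>UNIV. V $ i * pd c \<kappa> \<psi> [Inl i, Inr q, Inl j, Inr r] (\<gamma> s) v)) (at s)" for j r q
    by (rule pd_chain1[OF assms(1,2) mixed_words(6) assms(3-5)])
  have u: "((\<lambda>s. u1 s $ r) has_real_derivative Z $ r) (at s)" for r
    using bounded_linear.has_vector_derivative[OF bounded_linear_vec_nth assms(6)]
    by (simp add: has_real_derivative_iff_has_vector_derivative)
  define H where "H = hess \<kappa> \<psi> (\<gamma> s) v"
  define T2 where "T2 = third2 \<kappa> \<psi> (\<gamma> s) v w"
  have D1: "((\<lambda>s. u1 s \<bullet> third2 \<kappa> \<psi> (\<gamma> s) v w) has_real_derivative Z \<bullet> T2 + fourth \<kappa> \<psi> (\<gamma> s) v V w) (at s)"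
  proof -
    have "((\<lambda>s. \<Sum>j\<in>UNIV. u1 s $ j * (\<Sum>r\<in>UNIV. (\<Sum>q\<in>UNIV. w $ q * pd c \<kappa> \<psi> [Inr q, Inl j, Inr r] (\<gamma> s) v) * w $ r))
      has_real_derivative (\<Sum>j\<in>UNIV. Z $ j * (\<Sum>r\<in>UNIV. (\<Sum>q\<in>UNIV. w $ q * pd c \<kappa> \<psi> [Inr q, Inl j, Inr r] (\<gamma> s) v) * w $ r)
        + (\<Sum>r\<in>UNIV. (\<Sum>q\<in>UNIV. w $ q * (\<Sum>i\<in>UNIV. V $ i * pd c \<kappa> \<psi> [Inl i, Inr q, Inl j, Inr r] (\<gamma> s) v)) * w $ r) * u1 s $ j)) (at s)"
      by (intro DERIV_sum DERIV_mult DERIV_cmult DERIV_cmult_right d3 u)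
    then show ?thesis
      by (simp add: inner_vec_def third2_def fourth_def sum.distrib T2_def mult.commute \<open>V = u1 s\<close>)
  qed
  have D2: "((\<lambda>s. u1 s \<bullet> (hess \<kappa> \<psi> (\<gamma> s) v *v z)) has_real_derivative
      Z \<bullet> (H *v z) + third1 \<kappa> \<psi> (\<gamma> s) v V \<bullet> z) (at s)"
  proof -
    have "((\<lambda>s. \<Sum>j\<in>UNIV. u1 s $ j * (\<Sum>r\<in>UNIV. pd c \<kappa> \<psi> [Inl j, Inr r] (\<gamma> s) v * z $ r))
      has_real_derivative (\<Sum>j\<in>UNIV. Z $ j * (\<Sum>r\<in>UNIV. pd c \<kappa> \<psi> [Inl j, Inr r] (\<gamma> s) v * z $ r)
       + (\<Sum>r\<in>UNIV. (\<Sum>i\<in>UNIV. V $ i * pd c \<kappa> \<psi> [Inl i, Inl j, Inr r] (\<gamma> s) v) * z $ r) * u1 s $ j)) (at s)"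
      by (intro DERIV_sum DERIV_mult DERIV_cmult DERIV_cmult_right d2 u)
    moreover have "(\<Sum>j\<in>UNIV. (\<Sum>r\<in>UNIV. (\<Sum>i\<in>UNIV. V $ i * pd c \<kappa> \<psi> [Inl i, Inl j, Inr r] (\<gamma> s) v) * z $ r) * u1 s $ j)
        = third1 \<kappa> \<psi> (\<gamma> s) v V \<bullet> z"
      unfolding third1_def inner_vec_def \<open>V = u1 s\<close> sum_distrib_right vec_lambda_beta inner_real_def
      by (subst sum.swap) (simp add: ac_simps)
    ultimately show ?thesis
      by (simp add: inner_vec_def matrix_vector_mult_def hess_def H_def sum.distrib)
  qed
  \<comment> \<open>With \<open>x = z\<close> this cancels the terms in \<open>D2\<close>, with \<open>x = matrix_inv H *v T2\<close> it evaluates \<open>Z \<bullet> T2\<close>.\<close>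
  have "Z \<bullet> (H *v x) = - (third1 \<kappa> \<psi> (\<gamma> s) v V \<bullet> x)" for x
    using Z by (simp add: H_def flip: dot_lmul_matrix)
  moreover have "H *v (matrix_inv H *v x) = x" for x
    using matrix_inv_inverse(1)[of H] det_hess[OF assms(1-4)]
    by (simp add: matrix_vector_mul_assoc invertible_det_nz H_def)
  ultimately have "Z \<bullet> (H *v z) = - (third1 \<kappa> \<psi> (\<gamma> s) v V \<bullet> z)"
    "Z \<bullet> T2 = - (third1 \<kappa> \<psi> (\<gamma> s) v V \<bullet> (matrix_inv H *v T2))"
    by metis+
  then have "curv \<kappa> \<psi> (\<gamma> s) v V w = - (Z \<bullet> T2 + fourth \<kappa> \<psi> (\<gamma> s) v V w) - (Z \<bullet> (H *v z) + third1 \<kappa> \<psi> (\<gamma> s) v V \<bullet> z)"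
    by (simp add: curv_def H_def T2_def)
  then show ?thesis using DERIV_diff[OF DERIV_minus[OF D1] D2] by simp
qed

text \<open>Joint continuity is what differentiation under the integral over \<open>s\<close> requires.\<close>

lemma mixed_form_derivative_continuous:
  fixes u u1 v v1 v2 :: "real \<Rightarrow> real ^ 'n"
  assumes "\<kappa> \<in> \<A>" "\<psi> \<in> \<B>"
    and u: "continuous_on N u" "u ` N \<subseteq> chart_img \<kappa> \<Omega>" "continuous_on N u1"
    and v: "continuous_on I v" "v ` I \<subseteq> chart_img \<psi> \<Omega>'" "continuous_on I v1" "continuous_on I v2"
  shows "continuous_on (N \<times> I) (\<lambda>(s, t). - (u1 s \<bullet> third2 \<kappa> \<psi> (u s) (v t) (v1 t))
     - u1 s \<bullet> (hess \<kappa> \<psi> (u s) (v t) *v v2 t))"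
proof -
  have fs: "continuous_on (N \<times> I) (\<lambda>p. f (fst p))" if "continuous_on N f" for f :: "real \<Rightarrow> real ^ 'n"
    by (rule continuous_on_compose2[OF that]) (auto intro!: continuous_intros)
  have sn: "continuous_on (N \<times> I) (\<lambda>p. f (snd p))" if "continuous_on I f" for f :: "real \<Rightarrow> real ^ 'n"
    by (rule continuous_on_compose2[OF that]) (auto intro!: continuous_intros)
  have pd: "continuous_on (N \<times> I) (\<lambda>p. pd c \<kappa> \<psi> w (u (fst p)) (v (snd p)))" if "w \<in> mixed_orders 2 2" for w
  proof -
    have "continuous_on (N \<times> I) (\<lambda>p. (u (fst p), v (snd p)))"
      by (intro continuous_on_Pair fs sn u v)
    from continuous_on_compose2[OF pd_continuous[OF assms(1,2) that] this]
    show ?thesis using u(2) v(2) by (auto simp: image_subset_iff)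
  qed
  have "continuous_on (N \<times> I) (\<lambda>p. - (\<Sum>j\<in>UNIV. u1 (fst p) $ j * (\<Sum>r\<in>UNIV. (\<Sum>q\<in>UNIV. v1 (snd p) $ q *
      pd c \<kappa> \<psi> [Inr q, Inl j, Inr r] (u (fst p)) (v (snd p))) * v1 (snd p) $ r))
      - (\<Sum>j\<in>UNIV. u1 (fst p) $ j * (\<Sum>r\<in>UNIV. pd c \<kappa> \<psi> [Inl j, Inr r] (u (fst p)) (v (snd p)) * v2 (snd p) $ r)))"
    by (intro continuous_on_diff continuous_on_minus continuous_on_sum continuous_on_mult
        continuous_on_component fs sn u v pd mixed_words(2,4))
  then show ?thesis
    by (simp add: case_prod_beta inner_vec_def third2_def matrix_vector_mult_def hess_def)
qed

text \<open>The computation described at the beginning. The function \<open>f1 s1\<close> is the derivative of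
\<open>t \<mapsto> c (\<gamma> 0) (\<delta> t) - c (\<gamma> s1) (\<delta> t)\<close>, \<open>w\<close> is the velocity of \<open>\<delta>\<close> at \<open>t0\<close>, and \<open>k\<close> does not depend on \<open>s1\<close>, so
that short and long curves can be compared. The chart \<open>\<psi>\<close> around \<open>y0\<close> is fixed, whereas \<open>\<gamma>\<close> may run
through many charts; therefore the derivatives of \<open>F\<close> are introduced as functions of the real
parameters and only computed in charts.\<close>

lemma second_variation:
  assumes y0: "y0 \<in> \<Omega>'" "\<psi> \<in> charts_at \<B> y0"
    and J: "open J" "0 \<in> J" and \<gamma>: "c_line y0 \<psi> a b J \<gamma>"
    and \<kappa>0: "\<kappa>0 \<in> charts_at \<A> (\<gamma> 0)"
    and I0: "open I0" "t0 \<in> I0" "\<delta> t0 = y0"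
    and \<delta>: "\<And>t. t \<in> I0 \<Longrightarrow> \<delta> t \<in> \<Omega>' \<and> pvec \<A> (swap_cost c) (\<delta> t) (\<gamma> 0) \<kappa>0 = a' + t *\<^sub>R b'"
  shows "\<exists>I f1 k w. open I \<and> t0 \<in> I \<and> I \<subseteq> I0 \<and>
    (\<forall>s1\<in>J. \<forall>t\<in>I.
      ((\<lambda>t. - c (\<gamma> s1) (\<delta> t) + c (\<gamma> 0) (\<delta> t)) has_real_derivative f1 s1 t) (at t)) \<and>
    (\<forall>s1. 0 < s1 \<longrightarrow> {0..s1} \<subseteq> J \<longrightarrow> (f1 s1 has_real_derivative integral {0..s1} k) (at t0)) \<and>
    (\<forall>s1\<in>J. f1 s1 t0 = s1 * (b \<bullet> w)) \<and>
    hess \<kappa>0 \<psi> (cmap \<kappa>0 (\<gamma> 0)) (cmap \<psi> y0) *v w = - b' \<and>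
    k 0 = 0 \<and>
    (\<forall>s\<in>J. \<forall>\<kappa>\<in>charts_at \<A> (\<gamma> s).
      \<exists>V. V v* hess \<kappa> \<psi> (cmap \<kappa> (\<gamma> s)) (cmap \<psi> y0) = - b \<and>
        (k has_real_derivative curv \<kappa> \<psi> (cmap \<kappa> (\<gamma> s)) (cmap \<psi> y0) V w) (at s))"
proof -
  interpret sw: cost_domain \<B> \<A> \<Omega>' \<Omega> "swap_cost c" by (rule swapped_domain)
  define x0 where "x0 = \<gamma> 0"
  have \<gamma>_in: "\<gamma> s \<in> \<Omega>" "pvec \<B> c (\<gamma> s) y0 \<psi> = a + s *\<^sub>R b" if "s \<in> J" for s
    using \<gamma> that by (auto simp: c_line_def)
  have x0: "x0 \<in> \<Omega>" "\<kappa>0 \<in> charts_at \<A> x0" "\<kappa>0 \<in> \<A>"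
    using \<gamma>_in(1)[OF J(2)] \<kappa>0 by (auto simp: x0_def charts_at_def)
  have \<psi>: "\<psi> \<in> \<B>" "y0 \<in> cdom \<psi>" using y0 by (auto simp: charts_at_def)
  have "sw.c_line x0 \<kappa>0 a' b' I0 \<delta>" using \<delta> by (simp add: sw.c_line_def x0_def)
  moreover have "\<psi> \<in> charts_at \<B> (\<delta> t0)" using y0 I0 by simp
  ultimately obtain N0 v1 v2 where N0: "open N0" "t0 \<in> N0" "N0 \<subseteq> I0"
    "\<And>t. t \<in> N0 \<Longrightarrow> \<delta> t \<in> cdom \<psi>"
    "\<And>t. t \<in> N0 \<Longrightarrow> (cmap \<psi> \<circ> \<delta> has_vector_derivative v1 t) (at t)"
    "\<And>t. t \<in> N0 \<Longrightarrow> (v1 has_vector_derivative v2 t) (at t)"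
    "continuous_on N0 v1" "continuous_on N0 v2"
    "\<And>t. t \<in> N0 \<Longrightarrow> v1 t v* sw.hess \<psi> \<kappa>0 (cmap \<psi> (\<delta> t)) (cmap \<kappa>0 x0) = - b'"
    using sw.c_line_C2[OF x0(1,2) I0(1,2)] by metis
  obtain r where r: "r > 0" "ball t0 r \<subseteq> N0" using N0 openE by blast
  define I where "I = ball t0 r"
  have I: "open I" "t0 \<in> I" "convex I" "I \<subseteq> N0" "I \<subseteq> I0" using r N0 by (auto simp: I_def)
  define v where "v = cmap \<psi> \<circ> \<delta>"
  have vI: "\<psi> \<in> charts_at \<B> (\<delta> t)" "\<delta> t \<in> cdom \<psi>" "\<delta> t \<in> \<Omega>'" "v t \<in> chart_img \<psi> \<Omega>'" "cmap \<psi> (\<delta> t) = v t"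
    "(v has_vector_derivative v1 t) (at t)" "(v1 has_vector_derivative v2 t) (at t)" if "t \<in> I" for t
  proof -
    have t: "t \<in> N0" "t \<in> I0" using that I by auto
    show *: "\<delta> t \<in> cdom \<psi>" "\<delta> t \<in> \<Omega>'" "cmap \<psi> (\<delta> t) = v t"
      "(v has_vector_derivative v1 t) (at t)" "(v1 has_vector_derivative v2 t) (at t)"
      using N0(4,5,6)[OF t(1)] \<delta>[OF t(2)] by (simp_all add: v_def)
    show "\<psi> \<in> charts_at \<B> (\<delta> t)" "v t \<in> chart_img \<psi> \<Omega>'"
      using * \<psi> by (auto simp: charts_at_def v_def)
  qed
  have v_cont: "continuous_on I v" "continuous_on I v1" "continuous_on I v2"
  proof -
    show "continuous_on I v" "continuous_on I v1"
      using vI(6,7) has_vector_derivative_continuous by (blast intro: continuous_at_imp_continuous_on)+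
    show "continuous_on I v2" by (rule continuous_on_subset[OF N0(8) I(4)])
  qed
  have v0: "v t0 = cmap \<psi> y0" using I0 by (simp add: v_def)
  have u0: "cmap \<kappa>0 x0 \<in> chart_img \<kappa>0 \<Omega>" using x0 by (auto simp: charts_at_def)
  have Hv1: "hess \<kappa>0 \<psi> (cmap \<kappa>0 x0) (v t) *v v1 t = - b'" if "t \<in> I" for t
    using N0(9)[of t] that I(4) hess_swap[OF x0(3) \<psi>(1) u0 vI(4)[OF that]] vI(5)[OF that] by auto

  \<comment> \<open>The names list the parameters in which \<open>F s t = - c (\<gamma> s) (\<delta> t)\<close> has been differentiated, in this order.\<close>
  define Ft where "Ft s t = pvec \<B> c (\<gamma> s) (\<delta> t) \<psi> \<bullet> v1 t" for s t
  define Fts where "Fts s t = deriv (\<lambda>s. Ft s t) s" for s t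
  define Ftst where "Ftst s t = deriv (\<lambda>t. Fts s t) t" for s t

  have dF: "((\<lambda>t. - c (\<gamma> s) (\<delta> t)) has_real_derivative Ft s t) (at t)" if "s \<in> J" "t \<in> I" for s t
  proof -
    obtain \<kappa> where \<kappa>: "\<kappa> \<in> charts_at \<A> (\<gamma> s)" using charts_at_nonempty[OF mfA] by blast
    have \<kappa>': "\<kappa> \<in> \<A>" "cinv \<kappa> (cmap \<kappa> (\<gamma> s)) = \<gamma> s" "cmap \<kappa> (\<gamma> s) \<in> chart_img \<kappa> \<Omega>"
      using \<kappa> \<gamma>_in(1)[OF that(1)] cinv_cmap[OF mfA] by (auto simp: charts_at_def)
    have "((\<lambda>t. - pd c \<kappa> \<psi> [] (cmap \<kappa> (\<gamma> s)) (v t)) has_real_derivative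
      - (\<Sum>r\<in>UNIV. v1 t $ r * pd c \<kappa> \<psi> [Inr r] (cmap \<kappa> (\<gamma> s)) (v t))) (at t)"
      by (intro DERIV_minus pd_chain2 \<kappa>' \<psi> mixed_words(1) vI that)
    moreover have "- (\<Sum>r\<in>UNIV. v1 t $ r * pd c \<kappa> \<psi> [Inr r] (cmap \<kappa> (\<gamma> s)) (v t)) = Ft s t"
      using pvec_component[OF \<kappa> vI(1)[OF that(2)]] vI(5)[OF that(2)]
      by (simp add: Ft_def inner_vec_def sum_negf mult.commute)
    moreover have "- pd c \<kappa> \<psi> [] (cmap \<kappa> (\<gamma> s)) (v t) = - c (\<gamma> s) (\<delta> t)" if "t \<in> I" for t
      using cinv_cmap[OF mfB \<psi>(1) vI(2)[OF that]] vI(5)[OF that] \<kappa>'(2)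
      by (simp add: pd_def local_cost_def)
    ultimately show ?thesis
      using has_field_derivative_transform_within_open[OF _ I(1) that(2)] by force
  qed

  have local: "\<exists>N u1. open N \<and> s0 \<in> N \<and> N \<subseteq> J \<and>
      (\<forall>s\<in>N. \<forall>t\<in>I. ((\<lambda>s. Ft s t) has_real_derivative Fts s t) (at s) \<and>
        ((\<lambda>t. Fts s t) has_real_derivative Ftst s t) (at t) \<and>
        Fts s t = - (u1 s \<bullet> (hess \<kappa> \<psi> (cmap \<kappa> (\<gamma> s)) (v t) *v v1 t))) \<and>
      continuous_on (N \<times> I) (\<lambda>(s, t). Ftst s t) \<and>
      (\<forall>s\<in>N. u1 s v* hess \<kappa> \<psi> (cmap \<kappa> (\<gamma> s)) (cmap \<psi> y0) = - b \<and>
        ((\<lambda>s. Ftst s t0) has_real_derivative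
          curv \<kappa> \<psi> (cmap \<kappa> (\<gamma> s)) (cmap \<psi> y0) (u1 s) (v1 t0)) (at s))"
    if s0: "s0 \<in> J" and \<kappa>: "\<kappa> \<in> charts_at \<A> (\<gamma> s0)" for s0 \<kappa>
  proof -
    have \<kappa>': "\<kappa> \<in> \<A>" using \<kappa> by (simp add: charts_at_def)
    obtain N u1 u2 where N: "open N" "s0 \<in> N" "N \<subseteq> J"
      "\<And>s. s \<in> N \<Longrightarrow> \<gamma> s \<in> cdom \<kappa>"
      "\<And>s. s \<in> N \<Longrightarrow> (cmap \<kappa> \<circ> \<gamma> has_vector_derivative u1 s) (at s)"
      "\<And>s. s \<in> N \<Longrightarrow> (u1 has_vector_derivative u2 s) (at s)"
      "continuous_on N u1" "continuous_on N u2"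
      "\<And>s. s \<in> N \<Longrightarrow> u1 s v* hess \<kappa> \<psi> (cmap \<kappa> (\<gamma> s)) (cmap \<psi> y0) = - b"
      "\<And>s. s \<in> N \<Longrightarrow> u2 s v* hess \<kappa> \<psi> (cmap \<kappa> (\<gamma> s)) (cmap \<psi> y0)
        = - third1 \<kappa> \<psi> (cmap \<kappa> (\<gamma> s)) (cmap \<psi> y0) (u1 s)"
      using c_line_C2[OF y0 J(1) s0 \<gamma> \<kappa>] by metis
    define u where "u = cmap \<kappa> \<circ> \<gamma>"
    have uN: "u s \<in> chart_img \<kappa> \<Omega>" "cmap \<kappa> (\<gamma> s) = u s" "\<kappa> \<in> charts_at \<A> (\<gamma> s)"
      "(u has_vector_derivative u1 s) (at s)" if "s \<in> N" for s
      using N(4,5)[OF that] \<gamma>_in(1)[of s] N(3) that \<kappa>' by (auto simp: u_def charts_at_def)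
    have contu: "continuous_on N u"
      using uN(4) has_vector_derivative_continuous by (blast intro: continuous_at_imp_continuous_on)
    define E where "E s t = - (u1 s \<bullet> (hess \<kappa> \<psi> (u s) (v t) *v v1 t))" for s t
    define G where "G s t = - (u1 s \<bullet> third2 \<kappa> \<psi> (u s) (v t) (v1 t)) - u1 s \<bullet> (hess \<kappa> \<psi> (u s) (v t) *v v2 t)" for s t
    have dFt: "((\<lambda>s. Ft s t) has_real_derivative E s t) (at s)" if "s \<in> N" "t \<in> I" for s t
    proof -
      have "((\<lambda>s. \<Sum>r\<in>UNIV. - pd c \<kappa> \<psi> [Inr r] (u s) (v t) * v1 t $ r) has_real_derivative
        (\<Sum>r\<in>UNIV. - (\<Sum>i\<in>UNIV. u1 s $ i * pd c \<kappa> \<psi> [Inl i, Inr r] (u s) (v t)) * v1 t $ r)) (at s)"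
        by (intro DERIV_sum DERIV_cmult_right DERIV_minus pd_chain1 \<kappa>' \<psi> mixed_words(2) uN vI that)
      moreover have "(\<Sum>r\<in>UNIV. - (\<Sum>i\<in>UNIV. u1 s $ i * pd c \<kappa> \<psi> [Inl i, Inr r] (u s) (v t)) * v1 t $ r) = E s t"
        unfolding E_def inner_vec_def matrix_vector_mult_def hess_def
        by (simp add: sum_negf sum_distrib_left sum_distrib_right) (subst sum.swap, simp add: ac_simps)
      moreover have "(\<Sum>r\<in>UNIV. - pd c \<kappa> \<psi> [Inr r] (u s) (v t) * v1 t $ r) = Ft s t" if "s \<in> N" for s
        using pvec_component[OF uN(3)[OF that] vI(1)[OF \<open>t \<in> I\<close>]] vI(5)[OF \<open>t \<in> I\<close>] uN(2)[OF that]
        by (simp add: Ft_def inner_vec_def)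
      ultimately show ?thesis
        using has_field_derivative_transform_within_open[OF _ N(1) that(1)] by force
    qed
    have Fts: "Fts s t = E s t" if "s \<in> N" "t \<in> I" for s t
      unfolding Fts_def by (rule DERIV_imp_deriv[OF dFt[OF that]])
    have dFts: "((\<lambda>t. Fts s t) has_real_derivative G s t) (at t)" if "s \<in> N" "t \<in> I" for s t
    proof -
      have "((\<lambda>t. E s t) has_real_derivative G s t) (at t)"
        unfolding E_def G_def
        by (rule mixed_form_has_derivative[OF \<kappa>' \<psi>(1) uN(1)[OF that(1)] vI(4)[OF that(2)] vI(6)[OF that(2)] vI(7)[OF that(2)] refl])
      then show ?thesis
        using has_field_derivative_transform_within_open[OF _ I(1) that(2)] Fts[OF that(1)] by force
    qed
    have Ftst: "Ftst s t = G s t" if "s \<in> N" "t \<in> I" for s t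
      unfolding Ftst_def by (rule DERIV_imp_deriv[OF dFts[OF that]])
    have cont: "continuous_on (N \<times> I) (\<lambda>(s, t). Ftst s t)"
    proof -
      have "continuous_on (N \<times> I) (\<lambda>(s, t). G s t)"
        unfolding G_def using uN(1) vI(4)
        by (intro mixed_form_derivative_continuous \<kappa>' \<psi> contu v_cont N) auto
      then show ?thesis by (rule continuous_on_eq) (auto simp: Ftst)
    qed
    have curv: "((\<lambda>s. Ftst s t0) has_real_derivative
          curv \<kappa> \<psi> (cmap \<kappa> (\<gamma> s)) (cmap \<psi> y0) (u1 s) (v1 t0)) (at s)" if "s \<in> N" for s
    proof -
      have "u2 s v* hess \<kappa> \<psi> (u s) (v t0) = - third1 \<kappa> \<psi> (u s) (v t0) (u1 s)"
        using N(10)[OF that] by (simp add: u_def v0)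
      from curv_is_derivative[OF \<kappa>' \<psi>(1) uN(1)[OF that] vI(4)[OF I(2)] uN(4)[OF that] N(6)[OF that] refl this]
      have "((\<lambda>s. G s t0) has_real_derivative
          curv \<kappa> \<psi> (cmap \<kappa> (\<gamma> s)) (cmap \<psi> y0) (u1 s) (v1 t0)) (at s)"
        unfolding G_def uN(2)[OF that] v0[symmetric] .
      then show ?thesis
        using has_field_derivative_transform_within_open[OF _ N(1) that] Ftst I(2) by force
    qed
    show ?thesis
      using N(1-3,9) dFt dFts cont curv Fts Ftst uN(2) by (intro exI[of _ N] exI[of _ u1]) (simp add: E_def)
  qed

  have dFt: "((\<lambda>s. Ft s t) has_real_derivative Fts s t) (at s)"
    and dFts: "((\<lambda>t. Fts s t) has_real_derivative Ftst s t) (at t)" if "s \<in> J" "t \<in> I" for s t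
  proof -
    obtain \<kappa> where "\<kappa> \<in> charts_at \<A> (\<gamma> s)" using charts_at_nonempty[OF mfA] by blast
    from local[OF that(1) this] that(2)
    show "((\<lambda>s. Ft s t) has_real_derivative Fts s t) (at s)"
      "((\<lambda>t. Fts s t) has_real_derivative Ftst s t) (at t)" by blast+
  qed
  have cont: "continuous_on (J \<times> I) (\<lambda>(s, t). Ftst s t)"
  proof (rule continuous_at_imp_continuous_on, clarify)
    fix s t assume st: "s \<in> J" "t \<in> I"
    obtain \<kappa> where "\<kappa> \<in> charts_at \<A> (\<gamma> s)" using charts_at_nonempty[OF mfA] by blast
    from local[OF st(1) this] obtain N where "open N" "s \<in> N" "continuous_on (N \<times> I) (\<lambda>(s, t). Ftst s t)"
      by blast
    then show "isCont (\<lambda>(s, t). Ftst s t) (s, t)"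
      using continuous_on_eq_continuous_at[OF open_Times[OF \<open>open N\<close> I(1)]] st(2) by blast
  qed

  define f1 where "f1 s1 t = Ft s1 t - Ft 0 t" for s1 t
  define k where "k = (\<lambda>s. Ftst s t0)"
  have int: "((\<lambda>s. Fts s t) has_integral f1 s1 t) {0..s1}" if s1: "0 < s1" "{0..s1} \<subseteq> J" and "t \<in> I" for s1 t
    unfolding f1_def
  proof (rule fundamental_theorem_of_calculus)
    fix s assume "s \<in> {0..s1}"
    then have "s \<in> J" using s1 by blast
    from dFt[OF this \<open>t \<in> I\<close>]
    show "((\<lambda>s. Ft s t) has_vector_derivative Fts s t) (at s within {0..s1})"
      unfolding has_real_derivative_iff_has_vector_derivative by (rule has_vector_derivative_at_within)
  qed (use s1 in auto)
  have df1: "(f1 s1 has_real_derivative integral {0..s1} k) (at t0)" if s1: "0 < s1" "{0..s1} \<subseteq> J" for s1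
  proof -
    have "((\<lambda>t. integral (cbox 0 s1) (\<lambda>s. Fts s t)) has_field_derivative integral (cbox 0 s1) (\<lambda>s. Ftst s t0)) (at t0 within I)"
    proof (rule leibniz_rule_field_derivative[where fx="\<lambda>t s. Ftst s t"])
      show "((\<lambda>t. Fts s t) has_field_derivative Ftst s t) (at t within I)" if "t \<in> I" "s \<in> cbox 0 s1" for t s
      proof -
        have "s \<in> J" using s1 that(2) by auto
        from dFts[OF this that(1)] show ?thesis by (rule has_field_derivative_at_within)
      qed
      show "(\<lambda>s. Fts s t) integrable_on cbox 0 s1" if "t \<in> I" for t
        using int[OF s1 that] by (auto simp: has_integral_integrable)
      have "continuous_on (I \<times> cbox 0 s1) ((\<lambda>(s, t). Ftst s t) \<circ> prod.swap)"
      proof (rule continuous_on_compose[OF continuous_on_swap])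
        have "prod.swap ` (I \<times> cbox 0 s1) \<subseteq> J \<times> I" using s1 by (auto simp: product_swap)
        then show "continuous_on (prod.swap ` (I \<times> cbox 0 s1)) (\<lambda>(s, t). Ftst s t)"
          by (rule continuous_on_subset[OF cont])
      qed
      then show "continuous_on (I \<times> cbox 0 s1) (\<lambda>(t, s). Ftst s t)"
        by (simp add: o_def case_prod_beta)
    qed (use I in auto)
    then have "((\<lambda>t. integral {0..s1} (\<lambda>s. Fts s t)) has_field_derivative integral {0..s1} k) (at t0)"
      using at_within_open[OF I(2,1)] by (simp add: k_def)
    then show ?thesis
      by (rule has_field_derivative_transform_within_open[OF _ I(1,2)]) (rule integral_unique[OF int[OF s1]])
  qed

  \<comment> \<open>At \<open>s = 0\<close> the mixed derivative pairs a fixed velocity with the derivative of the covector of \<open>\<delta> t\<close> at \<open>\<gamma> 0\<close>, the constant \<open>b'\<close>.\<close>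
  have k0: "k 0 = 0"
  proof -
    obtain u1 where "\<And>t. t \<in> I \<Longrightarrow> Fts 0 t = - (u1 \<bullet> (hess \<kappa>0 \<psi> (cmap \<kappa>0 x0) (v t) *v v1 t))"
      using local[OF J(2) \<kappa>0] unfolding x0_def by blast
    then have "Fts 0 t = u1 \<bullet> b'" if "t \<in> I" for t
      using Hv1[OF that] that by (simp add: inner_minus_right)
    then have "((\<lambda>t. Fts 0 t) has_real_derivative 0) (at t0)"
      using has_field_derivative_transform_within_open[OF DERIV_const[of "u1 \<bullet> b'"] I(1,2)] by metis
    then show ?thesis
      using DERIV_unique[OF dFts[OF J(2) I(2)]] by (simp add: k_def)
  qed
  show ?thesis
  proof (rule exI[of _ I], rule exI[of _ f1], rule exI[of _ k], rule exI[of _ "v1 t0"],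
      intro conjI ballI allI impI I(1,2,5) df1 k0)
    show "((\<lambda>t. - c (\<gamma> s1) (\<delta> t) + c (\<gamma> 0) (\<delta> t)) has_real_derivative f1 s1 t) (at t)" if "s1 \<in> J" "t \<in> I" for s1 t
      using DERIV_diff[OF dF[OF that] dF[OF J(2) that(2)]] by (simp add: f1_def)
    show "f1 s1 t0 = s1 * (b \<bullet> v1 t0)" if "s1 \<in> J" for s1
      using \<gamma>_in(2)[OF J(2)] \<gamma>_in(2)[OF that] I0(3)
      by (simp add: f1_def Ft_def inner_add_left)
    show "hess \<kappa>0 \<psi> (cmap \<kappa>0 (\<gamma> 0)) (cmap \<psi> y0) *v v1 t0 = - b'"
      using Hv1[OF I(2)] by (simp add: x0_def v0)
    show "\<exists>V. V v* hess \<kappa> \<psi> (cmap \<kappa> (\<gamma> s)) (cmap \<psi> y0) = - b \<and>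
        (k has_real_derivative curv \<kappa> \<psi> (cmap \<kappa> (\<gamma> s)) (cmap \<psi> y0) V (v1 t0)) (at s)"
      if "s \<in> J" "\<kappa> \<in> charts_at \<A> (\<gamma> s)" for s \<kappa>
      using local[of s \<kappa>] that unfolding k_def by blast
  qed
qed

section \<open>The Ma--Trudinger--Wang tensor as a curvature form\<close>

lemma MTW_eq_curv:
  assumes "\<kappa> \<in> charts_at \<A> x" "\<psi> \<in> charts_at \<B> y" "x \<in> \<Omega>" "y \<in> \<Omega>'"
  shows "MTW c \<kappa> \<psi> x y V V \<eta> \<eta> =
    curv \<kappa> \<psi> (cmap \<kappa> x) (cmap \<psi> y) V (matrix_inv (hess \<kappa> \<psi> (cmap \<kappa> x) (cmap \<psi> y)) *v \<eta>)"
proof -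
  define u where "u = cmap \<kappa> x"
  define v where "v = cmap \<psi> y"
  have in_dom: "\<kappa> \<in> \<A>" "\<psi> \<in> \<B>" "u \<in> chart_img \<kappa> \<Omega>" "v \<in> chart_img \<psi> \<Omega>'"
    using assms by (auto simp: charts_at_def u_def v_def)
  define d where "d w = pd c \<kappa> \<psi> w u v" for w
  have d: "cost_partial c \<kappa> \<psi> w x y = d w" for w
    by (simp add: cost_partial_def d_def pd_def u_def v_def)
  define C where "C = matrix_inv (hess \<kappa> \<psi> u v)"
  have C: "matrix_inv (\<chi> i j. d [Inl i, Inr j]) = C" by (simp add: C_def hess_def d_def)
  define w where "w = C *v \<eta>"
  define X where "X i j r s = (\<Sum>t\<in>UNIV. \<Sum>m\<in>UNIV. d [Inl i, Inl j, Inr t] * C $ t $ m * d [Inr r, Inr s, Inl m])" for i j r s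
  have inner: "(\<Sum>k\<in>UNIV. \<Sum>l\<in>UNIV. - (d [Inl i, Inr r, Inl j, Inr s] - X i j r s) * C $ r $ k * C $ s $ l * V $ i * V $ j * \<eta> $ k * \<eta> $ l)
    = X i j r s * V $ i * V $ j * w $ r * w $ s - d [Inl i, Inr r, Inl j, Inr s] * V $ i * V $ j * w $ r * w $ s" for i j r s
  proof -
    have "w $ r * w $ s = (\<Sum>k\<in>UNIV. \<Sum>l\<in>UNIV. (C $ r $ k * \<eta> $ k) * (C $ s $ l * \<eta> $ l))"
      by (simp add: w_def matrix_vector_mult_def sum_product)
    then have "- (d [Inl i, Inr r, Inl j, Inr s] - X i j r s) * V $ i * V $ j * (w $ r * w $ s)
      = (\<Sum>k\<in>UNIV. \<Sum>l\<in>UNIV. - (d [Inl i, Inr r, Inl j, Inr s] - X i j r s) * V $ i * V $ j * ((C $ r $ k * \<eta> $ k) * (C $ s $ l * \<eta> $ l)))"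
      by (simp only: sum_distrib_left)
    also have "\<dots> = (\<Sum>k\<in>UNIV. \<Sum>l\<in>UNIV. - (d [Inl i, Inr r, Inl j, Inr s] - X i j r s) * C $ r $ k * C $ s $ l * V $ i * V $ j * \<eta> $ k * \<eta> $ l)"
      by (simp only: ac_simps)
    finally show ?thesis by (simp add: algebra_simps)
  qed
  have "MTW c \<kappa> \<psi> x y V V \<eta> \<eta> = (\<Sum>i\<in>UNIV. \<Sum>j\<in>UNIV. \<Sum>r\<in>UNIV. \<Sum>s\<in>UNIV.
      X i j r s * V $ i * V $ j * w $ r * w $ s - d [Inl i, Inr r, Inl j, Inr s] * V $ i * V $ j * w $ r * w $ s)"
    unfolding MTW_def Let_def d C X_def[symmetric] inner ..
  also have "\<dots> = (\<Sum>i\<in>UNIV. \<Sum>j\<in>UNIV. \<Sum>r\<in>UNIV. \<Sum>s\<in>UNIV. X i j r s * V $ i * V $ j * w $ r * w $ s)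
      - (\<Sum>i\<in>UNIV. \<Sum>j\<in>UNIV. \<Sum>r\<in>UNIV. \<Sum>s\<in>UNIV. d [Inl i, Inr r, Inl j, Inr s] * V $ i * V $ j * w $ r * w $ s)"
    by (simp only: sum_subtractf)
  also have "(\<Sum>i\<in>UNIV. \<Sum>j\<in>UNIV. \<Sum>r\<in>UNIV. \<Sum>s\<in>UNIV. X i j r s * V $ i * V $ j * w $ r * w $ s)
      = third1 \<kappa> \<psi> u v V \<bullet> (C *v third2 \<kappa> \<psi> u v w)"
  proof -
    have t2: "third2 \<kappa> \<psi> u v w $ m = (\<Sum>s\<in>UNIV. (\<Sum>r\<in>UNIV. w $ r * d [Inr r, Inr s, Inl m]) * w $ s)" for m
      unfolding third2_def d_def by (simp add: pd_triple_commute[OF in_dom])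
    show ?thesis
      unfolding X_def sum_contraction
      by (simp add: inner_vec_def matrix_vector_mult_def t2) (simp add: third1_def d_def)
  qed
  also have "(\<Sum>i\<in>UNIV. \<Sum>j\<in>UNIV. \<Sum>r\<in>UNIV. \<Sum>s\<in>UNIV. d [Inl i, Inr r, Inl j, Inr s] * V $ i * V $ j * w $ r * w $ s)
      = fourth \<kappa> \<psi> u v V w"
  proof -
    have "fourth \<kappa> \<psi> u v V w = (\<Sum>j\<in>UNIV. \<Sum>s\<in>UNIV. \<Sum>r\<in>UNIV. \<Sum>i\<in>UNIV. d [Inl i, Inr r, Inl j, Inr s] * V $ i * V $ j * w $ r * w $ s)"
      unfolding fourth_def d_def
      by (simp only: sum_distrib_left sum_distrib_right) (simp only: ac_simps)
    also have "\<dots> = (\<Sum>j\<in>UNIV. \<Sum>r\<in>UNIV. \<Sum>s\<in>UNIV. \<Sum>i\<in>UNIV. d [Inl i, Inr r, Inl j, Inr s] * V $ i * V $ j * w $ r * w $ s)"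
      by (rule sum.cong[OF refl], rule sum.swap)
    also have "\<dots> = (\<Sum>j\<in>UNIV. \<Sum>r\<in>UNIV. \<Sum>i\<in>UNIV. \<Sum>s\<in>UNIV. d [Inl i, Inr r, Inl j, Inr s] * V $ i * V $ j * w $ r * w $ s)"
      by (rule sum.cong[OF refl], rule sum.cong[OF refl], rule sum.swap)
    also have "\<dots> = (\<Sum>j\<in>UNIV. \<Sum>i\<in>UNIV. \<Sum>r\<in>UNIV. \<Sum>s\<in>UNIV. d [Inl i, Inr r, Inl j, Inr s] * V $ i * V $ j * w $ r * w $ s)"
      by (rule sum.cong[OF refl], rule sum.swap)
    also have "\<dots> = (\<Sum>i\<in>UNIV. \<Sum>j\<in>UNIV. \<Sum>r\<in>UNIV. \<Sum>s\<in>UNIV. d [Inl i, Inr r, Inl j, Inr s] * V $ i * V $ j * w $ r * w $ s)"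
      by (rule sum.swap)
    finally show ?thesis by simp
  qed
  finally show ?thesis
    by (simp add: curv_def C_def w_def u_def v_def)
qed

definition curv_nonneg :: bool where
  "curv_nonneg \<longleftrightarrow> (\<forall>\<kappa>\<in>\<A>. \<forall>\<psi>\<in>\<B>. \<forall>u\<in>chart_img \<kappa> \<Omega>. \<forall>v\<in>chart_img \<psi> \<Omega>'. \<forall>V w.
     V \<bullet> (hess \<kappa> \<psi> u v *v w) = 0 \<longrightarrow> curv \<kappa> \<psi> u v V w \<ge> 0)"

text \<open>The substitution \<open>\<eta> = hess \<kappa> \<psi> u v *v w\<close> is a bijection by nondegeneracy.\<close>

lemma A3w_iff_curv_nonneg: "A3w \<A> \<B> \<Omega> \<Omega>' c \<longleftrightarrow> curv_nonneg"
proof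
  assume A: "A3w \<A> \<B> \<Omega> \<Omega>' c"
  show curv_nonneg
    unfolding curv_nonneg_def
  proof (intro ballI allI impI)
    fix \<kappa> \<psi> u v V w
    assume *: "\<kappa> \<in> \<A>" "\<psi> \<in> \<B>" "u \<in> chart_img \<kappa> \<Omega>" "v \<in> chart_img \<psi> \<Omega>'" "V \<bullet> (hess \<kappa> \<psi> u v *v w) = 0"
    obtain x y where xy: "x \<in> cdom \<kappa> \<inter> \<Omega>" "u = cmap \<kappa> x" "y \<in> cdom \<psi> \<inter> \<Omega>'" "v = cmap \<psi> y"
      using *(3,4) by blast
    have ch: "\<kappa> \<in> charts_at \<A> x" "\<psi> \<in> charts_at \<B> y" "x \<in> \<Omega>" "y \<in> \<Omega>'"
      using xy * by (auto simp: charts_at_def)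
    define \<eta> where "\<eta> = hess \<kappa> \<psi> u v *v w"
    have "MTW c \<kappa> \<psi> x y V V \<eta> \<eta> \<ge> 0"
      using A ch *(5) unfolding A3w_def \<eta>_def by (metis inner_commute)
    then show "curv \<kappa> \<psi> u v V w \<ge> 0"
      using MTW_eq_curv[OF ch, of V \<eta>] hess_inverse(2)[OF *(1-4), of w] by (simp add: \<eta>_def xy)
  qed
next
  assume C: curv_nonneg
  show "A3w \<A> \<B> \<Omega> \<Omega>' c"
    unfolding A3w_def
  proof (intro ballI allI impI)
    fix x y \<kappa> \<psi> and V \<eta> :: "real ^ 'n"
    assume *: "x \<in> \<Omega>" "y \<in> \<Omega>'" "\<kappa> \<in> charts_at \<A> x" "\<psi> \<in> charts_at \<B> y" "\<eta> \<bullet> V = 0"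
    have in_dom: "\<kappa> \<in> \<A>" "\<psi> \<in> \<B>" "cmap \<kappa> x \<in> chart_img \<kappa> \<Omega>" "cmap \<psi> y \<in> chart_img \<psi> \<Omega>'"
      using * by (auto simp: charts_at_def)
    show "0 \<le> MTW c \<kappa> \<psi> x y V V \<eta> \<eta>"
      unfolding MTW_eq_curv[OF *(3,4,1,2)]
      using C in_dom hess_inverse(1)[OF in_dom, of \<eta>] *(5)
      unfolding curv_nonneg_def by (metis inner_commute)
  qed
qed

text \<open>The exchange of the variables exchanges \<open>third1\<close> and \<open>third2\<close> and transposes the mixed Hessian.\<close>

lemma curv_swap:
  assumes in_dom: "\<kappa> \<in> \<A>" "\<psi> \<in> \<B>" "u \<in> chart_img \<kappa> \<Omega>" "v \<in> chart_img \<psi> \<Omega>'"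
  shows "cost_domain.curv (swap_cost c) \<psi> \<kappa> v u w V = curv \<kappa> \<psi> u v V w"
proof -
  interpret sw: cost_domain \<B> \<A> \<Omega>' \<Omega> "swap_cost c" by (rule swapped_domain)
  have pds: "pd (swap_cost c) \<psi> \<kappa> w v u = pd c \<kappa> \<psi> (map flip w) u v" for w
    using pd_swap[of c \<psi> \<kappa> "map flip w" v u] by (simp del: map_map)
  have t1: "sw.third1 \<psi> \<kappa> v u w = third2 \<kappa> \<psi> u v w"
    unfolding sw.third1_def third2_def pds by (simp add: pd_triple_commute[OF in_dom])
  have t2: "sw.third2 \<psi> \<kappa> v u V = third1 \<kappa> \<psi> u v V"
    unfolding sw.third2_def third1_def pds by (simp add: pd_triple_commute[OF in_dom])
  have f: "sw.fourth \<psi> \<kappa> v u w V = fourth \<kappa> \<psi> u v V w"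
  proof -
    have "sw.fourth \<psi> \<kappa> v u w V = (\<Sum>r\<in>UNIV. \<Sum>j\<in>UNIV. \<Sum>i\<in>UNIV. \<Sum>q\<in>UNIV.
        w $ r * (V $ i * (w $ q * pd c \<kappa> \<psi> [Inl i, Inr q, Inl j, Inr r] u v) * V $ j))"
      unfolding sw.fourth_def pds
      by (simp add: pd_quadruple_commute_tail[OF in_dom] sum_distrib_left sum_distrib_right)
    also have "\<dots> = (\<Sum>j\<in>UNIV. \<Sum>r\<in>UNIV. \<Sum>i\<in>UNIV. \<Sum>q\<in>UNIV.
        w $ r * (V $ i * (w $ q * pd c \<kappa> \<psi> [Inl i, Inr q, Inl j, Inr r] u v) * V $ j))"
      by (rule sum.swap)
    also have "\<dots> = (\<Sum>j\<in>UNIV. \<Sum>r\<in>UNIV. \<Sum>q\<in>UNIV. \<Sum>i\<in>UNIV.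
        w $ r * (V $ i * (w $ q * pd c \<kappa> \<psi> [Inl i, Inr q, Inl j, Inr r] u v) * V $ j))"
      by (rule sum.cong[OF refl], rule sum.cong[OF refl], rule sum.swap)
    also have "\<dots> = fourth \<kappa> \<psi> u v V w"
      unfolding fourth_def by (simp add: sum_distrib_left sum_distrib_right) (simp only: ac_simps)
    finally show ?thesis .
  qed
  define H where "H = hess \<kappa> \<psi> u v"
  have sH: "sw.hess \<psi> \<kappa> v u = transpose H" unfolding H_def by (rule hess_swap[OF in_dom])
  define a where "a = third2 \<kappa> \<psi> u v w"
  define z where "z = third1 \<kappa> \<psi> u v V"
  have "transpose H *v (matrix_inv (transpose H) *v z) = z"
    using sw.hess_inverse(1)[OF in_dom(2,1,4,3)] sH by simp
  then have X: "(matrix_inv (transpose H) *v z) v* H = z" by simp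
  have "a \<bullet> (matrix_inv (transpose H) *v z) = (H *v (matrix_inv H *v a)) \<bullet> (matrix_inv (transpose H) *v z)"
    using hess_inverse(1)[OF in_dom] by (simp add: H_def)
  also have "\<dots> = z \<bullet> (matrix_inv H *v a)"
    using X by (metis dot_lmul_matrix inner_commute)
  finally show ?thesis
    unfolding sw.curv_def curv_def t1 t2 f sH by (simp add: a_def z_def H_def)
qed

lemma curv_nonneg_swap:
  assumes curv_nonneg
  shows "cost_domain.curv_nonneg \<B> \<A> \<Omega>' \<Omega> (swap_cost c)"
proof -
  interpret sw: cost_domain \<B> \<A> \<Omega>' \<Omega> "swap_cost c" by (rule swapped_domain)
  show ?thesis
    unfolding sw.curv_nonneg_def
  proof (intro ballI allI impI)
    fix \<psi> \<kappa> v u w V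
    assume *: "\<psi> \<in> \<B>" "\<kappa> \<in> \<A>" "v \<in> chart_img \<psi> \<Omega>'" "u \<in> chart_img \<kappa> \<Omega>" "w \<bullet> (sw.hess \<psi> \<kappa> v u *v V) = 0"
    have "V \<bullet> (hess \<kappa> \<psi> u v *v w) = 0"
      using *(5) hess_swap[OF *(2,1,4,3)] by (simp add: inner_commute[of w] dot_lmul_matrix)
    then show "0 \<le> sw.curv \<psi> \<kappa> v u w V"
      using assms * unfolding curv_swap[OF *(2,1,4,3)] curv_nonneg_def by blast
  qed
qed

section \<open>Uniform bounds by compactness\<close>

end


lemma finite_uniform_constant:
  fixes P :: "'i \<Rightarrow> real \<Rightarrow> bool"
  assumes "finite F" and "\<And>i. i \<in> F \<Longrightarrow> \<exists>K. P i K"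
    and mono: "\<And>i K L. P i K \<Longrightarrow> K \<le> L \<Longrightarrow> P i L"
  shows "\<exists>K\<ge>1. \<forall>i\<in>F. P i K"
proof -
  obtain k where k: "\<And>i. i \<in> F \<Longrightarrow> P i (k i)" using assms(2) by metis
  have "P i (Max (insert 1 (k ` F)))" if "i \<in> F" for i
    using k[OF that] by (rule mono) (use assms(1) that in auto)
  then show ?thesis
    by (intro exI[of _ "Max (insert 1 (k ` F))"]) (use assms(1) in auto)
qed

context cost_domain
begin


text \<open>One constant for all quantities entering the estimates. The last two clauses bound the inverse of the mixed
Hessian and of its transpose, hence the velocity of a \<open>c\<close>-segment by the difference of its end covectors.\<close>

definition bounded_at :: "('a, 'n) chart \<Rightarrow> ('b, 'n) chart \<Rightarrow> real ^ 'n \<Rightarrow> real ^ 'n \<Rightarrow> real \<Rightarrow> bool" where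
  "bounded_at \<kappa> \<psi> u v K \<longleftrightarrow>
     (\<forall>w\<in>mixed_orders 2 2. \<bar>pd c \<kappa> \<psi> w u v\<bar> \<le> K) \<and>
     (\<forall>z. norm z \<le> K * norm (hess \<kappa> \<psi> u v *v z)) \<and>
     (\<forall>z. norm z \<le> K * norm (z v* hess \<kappa> \<psi> u v))"

lemma bounded_at_mono:
  assumes "bounded_at \<kappa> \<psi> u v K" "K \<le> L"
  shows "bounded_at \<kappa> \<psi> u v L"
proof -
  have "K * norm (hess \<kappa> \<psi> u v *v z) \<le> L * norm (hess \<kappa> \<psi> u v *v z)"
    "K * norm (z v* hess \<kappa> \<psi> u v) \<le> L * norm (z v* hess \<kappa> \<psi> u v)" for z
    using assms(2) by (auto intro: mult_right_mono)
  then show ?thesis using assms unfolding bounded_at_def by (meson order_trans)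
qed

text \<open>The derivatives extend continuously to the closures, and by nondegeneracy the extension of the mixed Hessian is
invertible there. So the bounds come from continuous functions on a compact set.\<close>

lemma bounded_on_compact:
  assumes \<kappa>: "\<kappa> \<in> \<A>" "C \<subseteq> cdom \<kappa>" "compact C" and \<psi>: "\<psi> \<in> \<B>" "C' \<subseteq> cdom \<psi>" "compact C'"
  shows "\<exists>K. \<forall>x\<in>C \<inter> \<Omega>. \<forall>y\<in>C' \<inter> \<Omega>'. bounded_at \<kappa> \<psi> (cmap \<kappa> x) (cmap \<psi> y) K"
proof -
  define S where "S = cmap \<kappa> ` (C \<inter> closure \<Omega>) \<times> cmap \<psi> ` (C' \<inter> closure \<Omega>')"
  have cpt: "compact S"
    unfolding S_def using \<kappa> \<psi>
    by (intro compact_Times compact_continuous_image compact_Int_closed closed_closure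
        continuous_on_subset[OF continuous_cmap[OF mfA]] continuous_on_subset[OF continuous_cmap[OF mfB]]) auto
  have S_sub: "S \<subseteq> chart_img \<kappa> (closure \<Omega>) \<times> chart_img \<psi> (closure \<Omega>')"
    using \<kappa> \<psi> by (auto simp: S_def)
  have inS: "(cmap \<kappa> x, cmap \<psi> y) \<in> S" "cmap \<kappa> x \<in> chart_img \<kappa> \<Omega>" "cmap \<psi> y \<in> chart_img \<psi> \<Omega>'"
    if "x \<in> C \<inter> \<Omega>" "y \<in> C' \<inter> \<Omega>'" for x y
    using that \<kappa> \<psi> subsetD[OF closure_subset, of x \<Omega>] subsetD[OF closure_subset, of y \<Omega>'] by (auto simp: S_def)
  have "\<exists>K. \<forall>x\<in>C \<inter> \<Omega>. \<forall>y\<in>C' \<inter> \<Omega>'. \<bar>pd c \<kappa> \<psi> w (cmap \<kappa> x) (cmap \<psi> y)\<bar> \<le> K"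
    if w: "w \<in> mixed_orders 2 2" for w
  proof -
    obtain G where G: "continuous_on (chart_img \<kappa> (closure \<Omega>) \<times> chart_img \<psi> (closure \<Omega>')) G"
      "\<And>u v. u \<in> chart_img \<kappa> \<Omega> \<Longrightarrow> v \<in> chart_img \<psi> \<Omega>' \<Longrightarrow> G (u, v) = pd c \<kappa> \<psi> w u v"
      using continuous_extension[OF \<kappa>(1) \<psi>(1) w] by blast
    have "compact (G ` S)"
      by (rule compact_continuous_image[OF continuous_on_subset[OF G(1) S_sub] cpt])
    then obtain K where K: "\<And>p. p \<in> S \<Longrightarrow> \<bar>G p\<bar> \<le> K"
      using compact_imp_bounded bounded_real by (metis imageI)
    have "\<bar>pd c \<kappa> \<psi> w (cmap \<kappa> x) (cmap \<psi> y)\<bar> \<le> K" if "x \<in> C \<inter> \<Omega>" "y \<in> C' \<inter> \<Omega>'" for x y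
      using K[OF inS(1)[OF that]] G(2)[OF inS(2,3)[OF that]] by simp
    then show ?thesis by blast
  qed
  then have "\<exists>K\<ge>1. \<forall>w\<in>mixed_orders 2 2. \<forall>x\<in>C \<inter> \<Omega>. \<forall>y\<in>C' \<inter> \<Omega>'. \<bar>pd c \<kappa> \<psi> w (cmap \<kappa> x) (cmap \<psi> y)\<bar> \<le> K"
  proof (rule finite_uniform_constant[OF finite_mixed_orders])
    show "\<forall>x\<in>C \<inter> \<Omega>. \<forall>y\<in>C' \<inter> \<Omega>'. \<bar>pd c \<kappa> \<psi> w (cmap \<kappa> x) (cmap \<psi> y)\<bar> \<le> L"
      if "\<forall>x\<in>C \<inter> \<Omega>. \<forall>y\<in>C' \<inter> \<Omega>'. \<bar>pd c \<kappa> \<psi> w (cmap \<kappa> x) (cmap \<psi> y)\<bar> \<le> K" "K \<le> L" for w K L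
      using that order_trans by blast
  qed
  then obtain K1 where K1: "\<And>w x y. w \<in> mixed_orders 2 2 \<Longrightarrow> x \<in> C \<inter> \<Omega> \<Longrightarrow> y \<in> C' \<inter> \<Omega>' \<Longrightarrow>
      \<bar>pd c \<kappa> \<psi> w (cmap \<kappa> x) (cmap \<psi> y)\<bar> \<le> K1"
    by blast
  define Q where "Q i j G \<longleftrightarrow> continuous_on (chart_img \<kappa> (closure \<Omega>) \<times> chart_img \<psi> (closure \<Omega>')) G \<and>
      (\<forall>u\<in>chart_img \<kappa> \<Omega>. \<forall>v\<in>chart_img \<psi> \<Omega>'. G (u, v) = pd c \<kappa> \<psi> [Inl i, Inr j] u v)" for i j G
  define G where "G i j = (SOME G. Q i j G)" for i j
  have QG: "Q i j (G i j)" for i j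
  proof -
    obtain G' where "continuous_on (chart_img \<kappa> (closure \<Omega>) \<times> chart_img \<psi> (closure \<Omega>')) G'"
      "\<And>u v. u \<in> chart_img \<kappa> \<Omega> \<Longrightarrow> v \<in> chart_img \<psi> \<Omega>' \<Longrightarrow> G' (u, v) = pd c \<kappa> \<psi> [Inl i, Inr j] u v"
      using continuous_extension[OF \<kappa>(1) \<psi>(1) mixed_words(2)[where i=i and r=j]] by blast
    then have "\<exists>G'. Q i j G'" unfolding Q_def by blast
    then show ?thesis unfolding G_def by (rule someI_ex)
  qed
  have G: "continuous_on (chart_img \<kappa> (closure \<Omega>) \<times> chart_img \<psi> (closure \<Omega>')) (G i j)"
    "u \<in> chart_img \<kappa> \<Omega> \<Longrightarrow> v \<in> chart_img \<psi> \<Omega>' \<Longrightarrow> G i j (u, v) = pd c \<kappa> \<psi> [Inl i, Inr j] u v" for i j u v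
    using QG[of i j] unfolding Q_def by blast+
  define M where "M p = (\<chi> i j. G i j p)" for p
  have contM: "continuous_on S (\<lambda>p. M p $ i $ j)" for i j
    using continuous_on_subset[OF G(1) S_sub] by (simp add: M_def)
  have detM: "det (M p) \<noteq> 0" if p: "p \<in> S" for p
  proof -
    obtain x y where xy: "x \<in> C" "x \<in> closure \<Omega>" "y \<in> C'" "y \<in> closure \<Omega>'" "p = (cmap \<kappa> x, cmap \<psi> y)"
      using p unfolding S_def by blast
    have dom: "x \<in> cdom \<kappa>" "y \<in> cdom \<psi>" using xy \<kappa> \<psi> by auto
    have "M p = mixed_hessian_cl \<Omega> \<Omega>' c \<kappa> \<psi> x y"
      using mixed_hessian_cl_eq[OF \<kappa>(1) \<psi>(1) dom(1) xy(2) dom(2) xy(4) G(1) G(2)]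
      by (simp add: M_def vec_eq_iff xy(5))
    then show ?thesis
      using det_mixed_hessian_cl[of \<kappa> x \<psi> y] xy dom \<kappa> \<psi> by (simp add: charts_at_def)
  qed
  have M_hess: "M (cmap \<kappa> x, cmap \<psi> y) = hess \<kappa> \<psi> (cmap \<kappa> x) (cmap \<psi> y)"
    if "x \<in> C \<inter> \<Omega>" "y \<in> C' \<inter> \<Omega>'" for x y
    using G(2)[OF inS(2,3)[OF that]] by (simp add: M_def hess_def)
  obtain K2 where K2: "K2 > 0" "\<And>p z. p \<in> S \<Longrightarrow> norm z \<le> K2 * norm (M p *v z)"
    using uniform_injectivity[OF cpt contM detM] by blast
  have "continuous_on S (\<lambda>p. transpose (M p) $ i $ j)" for i j
    using contM by (simp add: transpose_def)
  moreover have "det (transpose (M p)) \<noteq> 0" if "p \<in> S" for p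
    using detM[OF that] by (simp add: det_transpose)
  ultimately have "\<exists>K>0. \<forall>p\<in>S. \<forall>z. norm z \<le> K * norm (transpose (M p) *v z)"
    by (rule uniform_injectivity[OF cpt])
  then obtain K3 where K3: "K3 > 0" "\<And>p z. p \<in> S \<Longrightarrow> norm z \<le> K3 * norm (z v* M p)"
    by auto
  define K where "K = max K1 (max K2 K3)"
  have le: "K1 \<le> K" "K2 \<le> K" "K3 \<le> K" by (auto simp: K_def)
  have "bounded_at \<kappa> \<psi> (cmap \<kappa> x) (cmap \<psi> y) K" if xy: "x \<in> C \<inter> \<Omega>" "y \<in> C' \<inter> \<Omega>'" for x y
  proof -
    have "\<bar>pd c \<kappa> \<psi> w (cmap \<kappa> x) (cmap \<psi> y)\<bar> \<le> K" if "w \<in> mixed_orders 2 2" for w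
      using K1[OF that xy] le(1) by linarith
    moreover have "norm z \<le> K * norm (hess \<kappa> \<psi> (cmap \<kappa> x) (cmap \<psi> y) *v z)" for z
      using K2(2)[OF inS(1)[OF xy], of z] M_hess[OF xy]
        mult_right_mono[OF le(2) norm_ge_zero, of "hess \<kappa> \<psi> (cmap \<kappa> x) (cmap \<psi> y) *v z"] by simp
    moreover have "norm z \<le> K * norm (z v* hess \<kappa> \<psi> (cmap \<kappa> x) (cmap \<psi> y))" for z
      using K3(2)[OF inS(1)[OF xy], of z] M_hess[OF xy]
        mult_right_mono[OF le(3) norm_ge_zero, of "z v* hess \<kappa> \<psi> (cmap \<kappa> x) (cmap \<psi> y)"] by simp
    ultimately show ?thesis unfolding bounded_at_def by blast
  qed
  then show ?thesis by blast
qed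

text \<open>Tangent vectors along one curve are compared in different charts, so a bound for each pair of points is only
useful if the chart chosen at a point does not depend on the other point.\<close>

lemma uniform_charts:
  obtains K \<alpha> \<beta> where "K \<ge> 1" "\<And>x. x \<in> \<Omega> \<Longrightarrow> \<alpha> x \<in> charts_at \<A> x" "\<And>y. y \<in> \<Omega>' \<Longrightarrow> \<beta> y \<in> charts_at \<B> y"
    "\<And>x y. x \<in> \<Omega> \<Longrightarrow> y \<in> \<Omega>' \<Longrightarrow> bounded_at (\<alpha> x) (\<beta> y) (cmap (\<alpha> x) x) (cmap (\<beta> y) y) K"
proof -
  obtain F where F: "finite F"
    "\<And>\<kappa> C. (\<kappa>, C) \<in> F \<Longrightarrow> \<kappa> \<in> \<A> \<and> C \<subseteq> cdom \<kappa> \<and> compact C"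
    "\<And>x. x \<in> closure \<Omega> \<Longrightarrow> \<exists>(\<kappa>, C)\<in>F. x \<in> C"
    using compact_chart_cover[OF mfA compact1] by metis
  obtain F' where F': "finite F'"
    "\<And>\<kappa> C. (\<kappa>, C) \<in> F' \<Longrightarrow> \<kappa> \<in> \<B> \<and> C \<subseteq> cdom \<kappa> \<and> compact C"
    "\<And>x. x \<in> closure \<Omega>' \<Longrightarrow> \<exists>(\<kappa>, C)\<in>F'. x \<in> C"
    using compact_chart_cover[OF mfB compact2] by metis
  define P where "P = (\<lambda>((\<kappa>, C), (\<psi>, C')) K. \<forall>x\<in>C \<inter> \<Omega>. \<forall>y\<in>C' \<inter> \<Omega>'. bounded_at \<kappa> \<psi> (cmap \<kappa> x) (cmap \<psi> y) K)"
  have "\<exists>K\<ge>1. \<forall>i\<in>F \<times> F'. P i K"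
  proof (rule finite_uniform_constant)
    show "finite (F \<times> F')" using F(1) F'(1) by simp
    show "\<exists>K. P i K" if "i \<in> F \<times> F'" for i
      using that F(2) F'(2) bounded_on_compact by (auto simp: P_def split: prod.splits)
    show "P i L" if "P i K" "K \<le> L" for i K L
      using that bounded_at_mono by (force simp: P_def split: prod.splits)
  qed
  then obtain K where K: "K \<ge> 1" "\<And>i j. i \<in> F \<Longrightarrow> j \<in> F' \<Longrightarrow> P (i, j) K" by blast
  have "\<exists>i. i \<in> F \<and> x \<in> snd i" if "x \<in> \<Omega>" for x
    using F(3)[OF subsetD[OF closure_subset that]] by force
  then obtain a where a: "\<And>x. x \<in> \<Omega> \<Longrightarrow> a x \<in> F \<and> x \<in> snd (a x)" by metis
  have "\<exists>i. i \<in> F' \<and> y \<in> snd i" if "y \<in> \<Omega>'" for y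
    using F'(3)[OF subsetD[OF closure_subset that]] by force
  then obtain b where b: "\<And>y. y \<in> \<Omega>' \<Longrightarrow> b y \<in> F' \<and> y \<in> snd (b y)" by metis
  show ?thesis
  proof (rule that[of K "\<lambda>x. fst (a x)" "\<lambda>y. fst (b y)"])
    show "fst (a x) \<in> charts_at \<A> x" if "x \<in> \<Omega>" for x
      using F(2)[of "fst (a x)" "snd (a x)"] a[OF that] by (auto simp: charts_at_def)
    show "fst (b y) \<in> charts_at \<B> y" if "y \<in> \<Omega>'" for y
      using F'(2)[of "fst (b y)" "snd (b y)"] b[OF that] by (auto simp: charts_at_def)
    show "bounded_at (fst (a x)) (fst (b y)) (cmap (fst (a x)) x) (cmap (fst (b y)) y) K"
      if "x \<in> \<Omega>" "y \<in> \<Omega>'" for x y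
      using K(2)[of "a x" "b y"] a[OF that(1)] b[OF that(2)] that by (simp add: P_def case_prod_beta)
  qed (rule K)
qed

lemma curv_quadratic:
  fixes w :: "real ^ 'n"
  defines "z \<equiv> \<lambda>\<kappa> \<psi> u v. matrix_inv (hess \<kappa> \<psi> u v) *v third2 \<kappa> \<psi> u v w"
  shows "curv \<kappa> \<psi> u v V w = (\<Sum>i\<in>UNIV. \<Sum>k\<in>UNIV.
    ((\<Sum>r\<in>UNIV. pd c \<kappa> \<psi> [Inl k, Inl i, Inr r] u v * z \<kappa> \<psi> u v $ r)
      - (\<Sum>r\<in>UNIV. \<Sum>q\<in>UNIV. w $ q * pd c \<kappa> \<psi> [Inl k, Inr q, Inl i, Inr r] u v * w $ r)) * V $ i * V $ k)"
proof -
  define Z where "Z = z \<kappa> \<psi> u v"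
  define A where "A i k = (\<Sum>r\<in>UNIV. pd c \<kappa> \<psi> [Inl k, Inl i, Inr r] u v * Z $ r)" for i k
  define B where "B i k = (\<Sum>r\<in>UNIV. \<Sum>q\<in>UNIV. w $ q * pd c \<kappa> \<psi> [Inl k, Inr q, Inl i, Inr r] u v * w $ r)" for i k
  have A: "third1 \<kappa> \<psi> u v V \<bullet> Z = (\<Sum>i\<in>UNIV. \<Sum>k\<in>UNIV. A i k * V $ i * V $ k)"
  proof -
    have "third1 \<kappa> \<psi> u v V \<bullet> Z = (\<Sum>r\<in>UNIV. \<Sum>i\<in>UNIV. \<Sum>k\<in>UNIV. pd c \<kappa> \<psi> [Inl k, Inl i, Inr r] u v * Z $ r * V $ i * V $ k)"
      by (simp add: inner_vec_def third1_def sum_distrib_right) (simp only: ac_simps)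
    also have "\<dots> = (\<Sum>i\<in>UNIV. \<Sum>r\<in>UNIV. \<Sum>k\<in>UNIV. pd c \<kappa> \<psi> [Inl k, Inl i, Inr r] u v * Z $ r * V $ i * V $ k)"
      by (rule sum.swap)
    also have "\<dots> = (\<Sum>i\<in>UNIV. \<Sum>k\<in>UNIV. \<Sum>r\<in>UNIV. pd c \<kappa> \<psi> [Inl k, Inl i, Inr r] u v * Z $ r * V $ i * V $ k)"
      by (rule sum.cong[OF refl], rule sum.swap)
    finally show ?thesis by (simp only: A_def sum_distrib_right)
  qed
  have B: "fourth \<kappa> \<psi> u v V w = (\<Sum>i\<in>UNIV. \<Sum>k\<in>UNIV. B i k * V $ i * V $ k)"
  proof -
    have "fourth \<kappa> \<psi> u v V w = (\<Sum>i\<in>UNIV. \<Sum>r\<in>UNIV. \<Sum>q\<in>UNIV. \<Sum>k\<in>UNIV. w $ q * pd c \<kappa> \<psi> [Inl k, Inr q, Inl i, Inr r] u v * w $ r * V $ i * V $ k)"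
      by (simp only: fourth_def sum_distrib_left sum_distrib_right) (simp only: ac_simps)
    also have "\<dots> = (\<Sum>i\<in>UNIV. \<Sum>r\<in>UNIV. \<Sum>k\<in>UNIV. \<Sum>q\<in>UNIV. w $ q * pd c \<kappa> \<psi> [Inl k, Inr q, Inl i, Inr r] u v * w $ r * V $ i * V $ k)"
      by (rule sum.cong[OF refl], rule sum.cong[OF refl], rule sum.swap)
    also have "\<dots> = (\<Sum>i\<in>UNIV. \<Sum>k\<in>UNIV. \<Sum>r\<in>UNIV. \<Sum>q\<in>UNIV. w $ q * pd c \<kappa> \<psi> [Inl k, Inr q, Inl i, Inr r] u v * w $ r * V $ i * V $ k)"
      by (rule sum.cong[OF refl], rule sum.swap)
    finally show ?thesis by (simp only: B_def sum_distrib_right)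
  qed
  show ?thesis
    unfolding curv_def A_def[symmetric, unfolded Z_def] B_def[symmetric] left_diff_distrib sum_subtractf
    using A B by (simp add: Z_def z_def)
qed

text \<open>For fixed \<open>w\<close> the form is quadratic in \<open>V\<close> with coefficients of size \<open>(norm w)\<^sup>2\<close>, and it is nonnegative on the
hyperplane orthogonal to \<open>\<eta> = hess \<kappa> \<psi> u v *v w\<close>. One factor \<open>norm w\<close> is cancelled by \<open>norm \<eta>\<close>.\<close>

lemma curv_lower_bound:
  fixes V w :: "real ^ 'n"
  assumes in_dom: "\<kappa> \<in> \<A>" "\<psi> \<in> \<B>" "u \<in> chart_img \<kappa> \<Omega>" "v \<in> chart_img \<psi> \<Omega>'"
    and K: "bounded_at \<kappa> \<psi> u v K" "K \<ge> 1"
    and pos: "\<And>V. V \<bullet> (hess \<kappa> \<psi> u v *v w) = 0 \<Longrightarrow> curv \<kappa> \<psi> u v V w \<ge> 0"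
  defines "n \<equiv> real CARD('n)"
  shows "curv \<kappa> \<psi> u v V w \<ge>
    - (2 * n\<^sup>2 * (n ^ 4 * K ^ 3 + n\<^sup>2 * K) * K * norm V * norm w * \<bar>V \<bullet> (hess \<kappa> \<psi> u v *v w)\<bar>)"
proof -
  define H where "H = hess \<kappa> \<psi> u v"
  define Z where "Z = matrix_inv H *v third2 \<kappa> \<psi> u v w"
  define R where "R i k = (\<Sum>r\<in>UNIV. pd c \<kappa> \<psi> [Inl k, Inl i, Inr r] u v * Z $ r)
      - (\<Sum>r\<in>UNIV. \<Sum>q\<in>UNIV. w $ q * pd c \<kappa> \<psi> [Inl k, Inr q, Inl i, Inr r] u v * w $ r)" for i k
  have curv: "curv \<kappa> \<psi> u v V w = (\<Sum>i\<in>UNIV. \<Sum>k\<in>UNIV. R i k * V $ i * V $ k)" for V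
    unfolding R_def Z_def H_def by (rule curv_quadratic)
  have pdK: "\<bar>pd c \<kappa> \<psi> l u v\<bar> \<le> K" if "l \<in> mixed_orders 2 2" for l
    using K(1) that by (simp add: bounded_at_def)
  have K0: "K \<ge> 0" using K(2) by simp
  have prod3: "\<bar>w $ q * p * w $ r\<bar> \<le> K * (norm w)\<^sup>2" if "\<bar>p\<bar> \<le> K" for p q r
  proof -
    have "\<bar>w $ q * p * w $ r\<bar> = \<bar>p\<bar> * (\<bar>w $ q\<bar> * \<bar>w $ r\<bar>)" by (simp add: abs_mult)
    also have "\<dots> \<le> K * (norm w * norm w)"
      using that K0 by (intro mult_mono component_le_norm_cart) auto
    finally show ?thesis by (simp add: power2_eq_square)
  qed
  have sum2: "\<bar>\<Sum>r\<in>(UNIV::'n set). \<Sum>q\<in>(UNIV::'n set). w $ q * p q r * w $ r\<bar> \<le> n\<^sup>2 * K * (norm w)\<^sup>2"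
    if "\<And>q r. \<bar>p q r\<bar> \<le> K" for p
  proof -
    have "\<bar>\<Sum>r\<in>(UNIV::'n set). \<Sum>q\<in>(UNIV::'n set). w $ q * p q r * w $ r\<bar>
        \<le> (\<Sum>r\<in>(UNIV::'n set). \<Sum>q\<in>(UNIV::'n set). K * (norm w)\<^sup>2)"
      by (intro order_trans[OF sum_abs] sum_mono prod3 that)
    then show ?thesis by (simp add: n_def power2_eq_square)
  qed
  have "\<bar>third2 \<kappa> \<psi> u v w $ j\<bar> \<le> n\<^sup>2 * K * (norm w)\<^sup>2" for j
    using sum2[of "\<lambda>q r. pd c \<kappa> \<psi> [Inr q, Inl j, Inr r] u v", OF pdK[OF mixed_words(4)]]
    by (simp add: third2_def sum_distrib_right)
  then have "norm (third2 \<kappa> \<psi> u v w) \<le> (\<Sum>j\<in>(UNIV::'n set). n\<^sup>2 * K * (norm w)\<^sup>2)"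
    by (intro order_trans[OF norm_le_l1_cart] sum_mono)
  then have T: "norm (third2 \<kappa> \<psi> u v w) \<le> n ^ 3 * K * (norm w)\<^sup>2"
    by (simp add: n_def power3_eq_cube power2_eq_square mult.assoc)
  have "norm Z \<le> K * norm (H *v Z)"
    using K(1) by (simp add: bounded_at_def H_def)
  also have "H *v Z = third2 \<kappa> \<psi> u v w"
    unfolding H_def Z_def by (rule hess_inverse(1)[OF in_dom])
  also have "K * norm (third2 \<kappa> \<psi> u v w) \<le> K * (n ^ 3 * K * (norm w)\<^sup>2)"
    using T K0 by (rule mult_left_mono)
  finally have Z: "norm Z \<le> n ^ 3 * K\<^sup>2 * (norm w)\<^sup>2" by (simp add: power2_eq_square mult.assoc mult.left_commute)
  \<comment> \<open>The summands bound the two sums in \<open>R\<close>: \<open>n\<close> products of size \<open>K * norm Z\<close>, and \<open>n\<^sup>2\<close> of size \<open>K * (norm w)\<^sup>2\<close>.\<close>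
  define E where "E = (n ^ 4 * K ^ 3 + n\<^sup>2 * K) * (norm w)\<^sup>2"
  have R: "\<bar>R i k\<bar> \<le> E" for i k
  proof -
    have "\<bar>\<Sum>r\<in>UNIV. pd c \<kappa> \<psi> [Inl k, Inl i, Inr r] u v * Z $ r\<bar> \<le> (\<Sum>r\<in>(UNIV::'n set). K * norm Z)"
      unfolding abs_mult
      by (intro order_trans[OF sum_abs] sum_mono) (auto simp: abs_mult intro!: mult_mono pdK mixed_words(4) K0 component_le_norm_cart)
    also have "\<dots> = n * K * norm Z" by (simp add: n_def)
    also have "\<dots> \<le> n * K * (n ^ 3 * K\<^sup>2 * (norm w)\<^sup>2)"
      using Z K0 by (intro mult_left_mono) (auto simp: n_def)
    also have "\<dots> = n ^ 4 * K ^ 3 * (norm w)\<^sup>2"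
      by (simp add: power2_eq_square power3_eq_cube power4_eq_xxxx mult_ac)
    finally have 1: "\<bar>\<Sum>r\<in>UNIV. pd c \<kappa> \<psi> [Inl k, Inl i, Inr r] u v * Z $ r\<bar> \<le> n ^ 4 * K ^ 3 * (norm w)\<^sup>2" .
    have 2: "\<bar>\<Sum>r\<in>UNIV. \<Sum>q\<in>UNIV. w $ q * pd c \<kappa> \<psi> [Inl k, Inr q, Inl i, Inr r] u v * w $ r\<bar> \<le> n\<^sup>2 * K * (norm w)\<^sup>2"
      by (rule sum2) (rule pdK[OF mixed_words(6)])
    show ?thesis using 1 2 unfolding R_def E_def by (simp add: distrib_right)
  qed
  show ?thesis
  proof (cases "w = 0")
    case True
    then have "R i k = 0" for i k using R[of i k] by (simp add: E_def)
    then have "curv \<kappa> \<psi> u v V w = 0" unfolding curv by simp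
    then show ?thesis using True by simp
  next
    case False
    define \<eta> where "\<eta> = H *v w"
    have wK: "norm w \<le> K * norm \<eta>" using K(1) by (simp add: bounded_at_def H_def \<eta>_def)
    have "\<eta> \<noteq> 0" using wK False by auto
    have lower: "curv \<kappa> \<psi> u v V w \<ge> - (2 * real CARD('n) ^ 2 * E * norm V * \<bar>V \<bullet> \<eta>\<bar> / norm \<eta>)"
      unfolding curv
      by (rule quadratic_form_lower_bound[OF R _ \<open>\<eta> \<noteq> 0\<close>])
         (use pos curv in \<open>simp add: \<eta>_def H_def\<close>)
    have "E / norm \<eta> = (n ^ 4 * K ^ 3 + n\<^sup>2 * K) * norm w * (norm w / norm \<eta>)"
      by (simp add: E_def power2_eq_square)
    also have "\<dots> \<le> (n ^ 4 * K ^ 3 + n\<^sup>2 * K) * norm w * K"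
      using wK \<open>\<eta> \<noteq> 0\<close> K0 by (intro mult_left_mono) (auto simp: pos_divide_le_eq n_def)
    finally have "2 * n\<^sup>2 * norm V * \<bar>V \<bullet> \<eta>\<bar> * (E / norm \<eta>)
        \<le> 2 * n\<^sup>2 * norm V * \<bar>V \<bullet> \<eta>\<bar> * ((n ^ 4 * K ^ 3 + n\<^sup>2 * K) * norm w * K)"
      by (intro mult_left_mono) (auto simp: n_def)
    then show ?thesis using lower unfolding n_def \<eta>_def[symmetric] H_def[symmetric]
      by (simp add: mult_ac)
  qed
qed

section \<open>Quantitative quasi-convexity and the maximum principle\<close>

text \<open>At each \<open>\<tau>\<close> the curve \<open>\<gamma>\<close> is a different one, joining \<open>x0\<close> to \<open>x\<close> with respect to \<open>\<delta> \<tau>\<close>. The number \<open>N\<close> bounds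
the velocities of \<open>\<gamma>\<close> and \<open>\<delta>\<close>, since components of covectors are bounded by \<open>K\<close>.\<close>

lemma qq_one_sided:
  assumes curv_nonneg
  shows "\<exists>M\<ge>1. \<forall>x\<in>\<Omega>. \<forall>x0\<in>\<Omega>. \<forall>y0\<in>\<Omega>'. \<forall>y1\<in>\<Omega>'. \<forall>t\<in>{0..1}.
    (let yt = c_segment \<A> (swap_cost c) \<Omega>' x0 y0 y1 t in
       - c x yt + c x y0 - (- c x0 yt + c x0 y0) \<le> M * t * max 0 (- c x y1 + c x y0 - (- c x0 y1 + c x0 y0)))"
proof -
  interpret sw: cost_domain \<B> \<A> \<Omega>' \<Omega> "swap_cost c" by (rule swapped_domain)
  obtain K \<alpha> \<beta> where K: "K \<ge> 1" and ch: "\<And>x. x \<in> \<Omega> \<Longrightarrow> \<alpha> x \<in> charts_at \<A> x" "\<And>y. y \<in> \<Omega>' \<Longrightarrow> \<beta> y \<in> charts_at \<B> y"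
    and bd: "\<And>x y. x \<in> \<Omega> \<Longrightarrow> y \<in> \<Omega>' \<Longrightarrow> bounded_at (\<alpha> x) (\<beta> y) (cmap (\<alpha> x) x) (cmap (\<beta> y) y) K"
    using uniform_charts by metis
  have in_dom: "\<alpha> x \<in> \<A>" "\<beta> y \<in> \<B>" "cmap (\<alpha> x) x \<in> chart_img (\<alpha> x) \<Omega>" "cmap (\<beta> y) y \<in> chart_img (\<beta> y) \<Omega>'"
    if "x \<in> \<Omega>" "y \<in> \<Omega>'" for x y
    using ch(1)[OF that(1)] ch(2)[OF that(2)] that by (auto simp: charts_at_def)
  define n where "n = real CARD('n)"
  define C where "C = 2 * n\<^sup>2 * (n ^ 4 * K ^ 3 + n\<^sup>2 * K) * K"
  define N where "N = K * (n * (2 * K))"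
  define L where "L = C * N * N"
  have pos: "C \<ge> 0" "N \<ge> 0" "L \<ge> 0" "K \<ge> 0" using K by (auto simp: C_def N_def L_def n_def)
  have norm_bound: "norm z \<le> n * (2 * K)" if "\<And>i. \<bar>z $ i\<bar> \<le> 2 * K" for z :: "real ^ 'n"
  proof -
    have "norm z \<le> (\<Sum>i\<in>(UNIV :: 'n set). 2 * K)"
      by (intro order_trans[OF norm_le_l1_cart] sum_mono that)
    then show ?thesis by (simp add: n_def)
  qed
  have p_bound: "norm (pvec \<B> c x y (\<beta> y) - pvec \<B> c x' y (\<beta> y)) \<le> n * (2 * K)" if "x \<in> \<Omega>" "x' \<in> \<Omega>" "y \<in> \<Omega>'" for x x' y
  proof (rule norm_bound)
    fix r
    have "\<bar>pvec \<B> c x y (\<beta> y) $ r\<bar> \<le> K" if "x \<in> \<Omega>" for x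
      using bd[OF that \<open>y \<in> \<Omega>'\<close>] pvec_component[OF ch(1)[OF that] ch(2)[OF \<open>y \<in> \<Omega>'\<close>], of r]
      by (simp add: bounded_at_def mixed_words(1))
    from this[OF that(1)] this[OF that(2)]
    show "\<bar>(pvec \<B> c x y (\<beta> y) - pvec \<B> c x' y (\<beta> y)) $ r\<bar> \<le> 2 * K" by simp
  qed
  have q_bound: "norm (pvec \<A> (swap_cost c) y x (\<alpha> x) - pvec \<A> (swap_cost c) y' x (\<alpha> x)) \<le> n * (2 * K)"
    if "x \<in> \<Omega>" "y \<in> \<Omega>'" "y' \<in> \<Omega>'" for x y y'
  proof (rule norm_bound)
    fix r
    have "\<bar>pvec \<A> (swap_cost c) y x (\<alpha> x) $ r\<bar> \<le> K" if "y \<in> \<Omega>'" for y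
      using bd[OF \<open>x \<in> \<Omega>\<close> that] sw.pvec_component[OF ch(2)[OF that] ch(1)[OF \<open>x \<in> \<Omega>\<close>], of r]
        pd_swap[of c "\<beta> y" "\<alpha> x" "[Inl r]" "cmap (\<beta> y) y" "cmap (\<alpha> x) x"]
      by (simp add: bounded_at_def mixed_words(1))
    from this[OF that(2)] this[OF that(3)]
    show "\<bar>(pvec \<A> (swap_cost c) y x (\<alpha> x) - pvec \<A> (swap_cost c) y' x (\<alpha> x)) $ r\<bar> \<le> 2 * K" by simp
  qed

  have "- c x yt + c x y0 - (- c x0 yt + c x0 y0) \<le> exp L * t * max 0 (- c x y1 + c x y0 - (- c x0 y1 + c x0 y0))"
    if x: "x \<in> \<Omega>" "x0 \<in> \<Omega>" and y: "y0 \<in> \<Omega>'" "y1 \<in> \<Omega>'" and t: "t \<in> {0..1}"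
      and yt: "yt = c_segment \<A> (swap_cost c) \<Omega>' x0 y0 y1 t" for x x0 y0 y1 t yt
  proof -
    define \<kappa>0 where "\<kappa>0 = \<alpha> x0"
    have \<kappa>0: "\<kappa>0 \<in> charts_at \<A> x0" using ch x by (simp add: \<kappa>0_def)
    define a' where "a' = pvec \<A> (swap_cost c) y0 x0 \<kappa>0"
    define b' where "b' = pvec \<A> (swap_cost c) y1 x0 \<kappa>0 - a'"
    obtain I0 \<delta> where I0: "open I0" "convex I0" "0 \<in> I0" "sw.c_line x0 \<kappa>0 a' b' I0 \<delta>" "\<delta> 0 = y0"
      "\<And>s y. y \<in> \<Omega>' \<Longrightarrow> pvec \<A> (swap_cost c) y x0 \<kappa>0 = a' + s *\<^sub>R b' \<Longrightarrow> s \<in> I0 \<and> \<delta> s = y"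
      using sw.c_line_exists[OF x(2) \<kappa>0 y(1), of b'] unfolding a'_def by metis
    have one: "1 \<in> I0" "\<delta> 1 = y1" using I0(6)[OF y(2), of 1] by (auto simp: b'_def)
    have I01: "{0..1} \<subseteq> I0"
      using closed_segment_subset[OF I0(3) one(1) I0(2)] by (simp add: closed_segment_eq_real_ivl)
    have \<delta>: "\<delta> t \<in> \<Omega>'" "pvec \<A> (swap_cost c) (\<delta> t) x0 \<kappa>0 = a' + t *\<^sub>R b'" if "t \<in> I0" for t
      using I0(4) that by (auto simp: sw.c_line_def)
    have tI: "t \<in> I0" using t I01 by blast
    have "pvec \<A> (swap_cost c) (\<delta> t) x0 \<kappa>0 = (1 - t) *\<^sub>R pvec \<A> (swap_cost c) y0 x0 \<kappa>0 + t *\<^sub>R pvec \<A> (swap_cost c) y1 x0 \<kappa>0"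
      using \<delta>(2)[OF tI] by (simp add: a'_def b'_def algebra_simps)
    then have yt\<delta>: "yt = \<delta> t"
      unfolding yt by (rule sw.c_segment_eqI[OF x(2) \<kappa>0 \<delta>(1)[OF tI] y])
    define f where "f = (\<lambda>t. - c x (\<delta> t) + c x0 (\<delta> t))"
    have key: "\<exists>I f1 D. open I \<and> \<tau> \<in> I \<and> (\<forall>t\<in>I. (f has_real_derivative f1 t) (at t)) \<and>
        (f1 has_real_derivative D) (at \<tau>) \<and> D \<ge> - L * \<bar>f1 \<tau>\<bar>" if "\<tau> \<in> {0..1}" for \<tau>
    proof -
      have \<tau>: "\<tau> \<in> I0" using that I01 by blast
      define y where "y = \<delta> \<tau>"
      define \<psi> where "\<psi> = \<beta> y"
      have y': "y \<in> \<Omega>'" "\<psi> \<in> charts_at \<B> y" using \<delta>(1)[OF \<tau>] ch by (auto simp: y_def \<psi>_def)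
      define b where "b = pvec \<B> c x y \<psi> - pvec \<B> c x0 y \<psi>"
      obtain J \<gamma> where J: "open J" "convex J" "0 \<in> J" "c_line y \<psi> (pvec \<B> c x0 y \<psi>) b J \<gamma>" "\<gamma> 0 = x0"
        "\<And>s z. z \<in> \<Omega> \<Longrightarrow> pvec \<B> c z y \<psi> = pvec \<B> c x0 y \<psi> + s *\<^sub>R b \<Longrightarrow> s \<in> J \<and> \<gamma> s = z"
        using c_line_exists[OF y' x(2), of b] by metis
      have oneJ: "1 \<in> J" "\<gamma> 1 = x" using J(6)[OF x(1), of 1] by (auto simp: b_def)
      have J01: "{0..1} \<subseteq> J"
        using closed_segment_subset[OF J(3) oneJ(1) J(2)] by (simp add: closed_segment_eq_real_ivl)
      have \<gamma>\<Omega>: "\<gamma> s \<in> \<Omega>" if "s \<in> J" for s using J(4) that by (simp add: c_line_def)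
      have \<kappa>0': "\<kappa>0 \<in> charts_at \<A> (\<gamma> 0)" using \<kappa>0 J(5) by simp
      have \<delta>': "\<delta> t \<in> \<Omega>' \<and> pvec \<A> (swap_cost c) (\<delta> t) (\<gamma> 0) \<kappa>0 = a' + t *\<^sub>R b'" if "t \<in> I0" for t
        using \<delta>[OF that] J(5) by simp
      obtain I f1 k w where sv: "open I" "\<tau> \<in> I" "I \<subseteq> I0"
        "\<forall>s1\<in>J. \<forall>t\<in>I.
          ((\<lambda>t. - c (\<gamma> s1) (\<delta> t) + c (\<gamma> 0) (\<delta> t)) has_real_derivative f1 s1 t) (at t)"
        "\<forall>s1. 0 < s1 \<longrightarrow> {0..s1} \<subseteq> J \<longrightarrow> (f1 s1 has_real_derivative integral {0..s1} k) (at \<tau>)"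
        "\<forall>s1\<in>J. f1 s1 \<tau> = s1 * (b \<bullet> w)"
        "hess \<kappa>0 \<psi> (cmap \<kappa>0 (\<gamma> 0)) (cmap \<psi> y) *v w = - b'"
        "k 0 = 0"
        "\<forall>s\<in>J. \<forall>\<kappa>\<in>charts_at \<A> (\<gamma> s).
          \<exists>V. V v* hess \<kappa> \<psi> (cmap \<kappa> (\<gamma> s)) (cmap \<psi> y) = - b \<and>
            (k has_real_derivative curv \<kappa> \<psi> (cmap \<kappa> (\<gamma> s)) (cmap \<psi> y) V w) (at s)"
        using second_variation[OF y' J(1,3,4) \<kappa>0' I0(1) \<tau> y_def[symmetric] \<delta>'] by blast
      have w_bound: "norm w \<le> N"
      proof -
        have "norm w \<le> K * norm (hess \<kappa>0 \<psi> (cmap \<kappa>0 x0) (cmap \<psi> y) *v w)"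
          using bd[OF x(2) y'(1)] by (simp add: bounded_at_def \<kappa>0_def \<psi>_def)
        also have "\<dots> = K * norm b'" using sv(7) J(5) by simp
        also have "\<dots> \<le> N"
          unfolding N_def b'_def a'_def \<kappa>0_def using pos(4) by (intro mult_left_mono q_bound x \<open>y0 \<in> \<Omega>'\<close> \<open>y1 \<in> \<Omega>'\<close>)
        finally show ?thesis .
      qed
      have "\<exists>d. (k has_real_derivative d) (at s) \<and> d \<ge> - (L * \<bar>b \<bullet> w\<bar>)" if s: "s \<in> {0..1}" for s
      proof -
        have sJ: "s \<in> J" using s J01 by blast
        define \<kappa> where "\<kappa> = \<alpha> (\<gamma> s)"
        define u where "u = cmap \<kappa> (\<gamma> s)"
        define v where "v = cmap \<psi> y"
        have \<kappa>: "\<kappa> \<in> charts_at \<A> (\<gamma> s)" using ch \<gamma>\<Omega>[OF sJ] by (simp add: \<kappa>_def)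
        obtain V where V: "V v* hess \<kappa> \<psi> u v = - b" "(k has_real_derivative curv \<kappa> \<psi> u v V w) (at s)"
          using sv(9)[rule_format, OF sJ \<kappa>] unfolding u_def v_def by blast
        have dom: "\<kappa> \<in> \<A>" "\<psi> \<in> \<B>" "u \<in> chart_img \<kappa> \<Omega>" "v \<in> chart_img \<psi> \<Omega>'"
          using in_dom[OF \<gamma>\<Omega>[OF sJ] y'(1)] by (auto simp: \<kappa>_def \<psi>_def u_def v_def)
        have B: "bounded_at \<kappa> \<psi> u v K"
          using bd[OF \<gamma>\<Omega>[OF sJ] y'(1)] by (simp add: \<kappa>_def \<psi>_def u_def v_def)
        have "norm V \<le> K * norm (V v* hess \<kappa> \<psi> u v)" using B by (simp add: bounded_at_def)
        also have "\<dots> = K * norm b" using V(1) by simp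
        also have "\<dots> \<le> N"
          unfolding N_def b_def \<psi>_def using pos(4) by (intro mult_left_mono p_bound x y'(1))
        finally have V_bound: "norm V \<le> N" .
        have Hw: "\<bar>V \<bullet> (hess \<kappa> \<psi> u v *v w)\<bar> = \<bar>b \<bullet> w\<bar>"
          using V(1) by (simp flip: dot_lmul_matrix)
        have "curv \<kappa> \<psi> u v V w \<ge> - (C * norm V * norm w * \<bar>V \<bullet> (hess \<kappa> \<psi> u v *v w)\<bar>)"
          unfolding C_def n_def
          by (rule curv_lower_bound[OF dom B K]) (use assms dom in \<open>auto simp: curv_nonneg_def\<close>)
        moreover have "C * norm V * norm w * \<bar>b \<bullet> w\<bar> \<le> C * N * N * \<bar>b \<bullet> w\<bar>"
          using pos V_bound w_bound by (intro mult_right_mono mult_mono) auto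
        ultimately have "curv \<kappa> \<psi> u v V w \<ge> - (L * \<bar>b \<bullet> w\<bar>)" unfolding Hw L_def by linarith
        with V(2) show ?thesis by blast
      qed
      then obtain k' where k': "\<And>s. s \<in> {0..1} \<Longrightarrow> (k has_real_derivative k' s) (at s)"
        "\<And>s. s \<in> {0..1} \<Longrightarrow> k' s \<ge> - (L * \<bar>b \<bullet> w\<bar>)" by metis
      \<comment> \<open>As \<open>k 0 = 0\<close> and \<open>s \<le> 1\<close>, the lower bound for \<open>k'\<close> is also one for \<open>k\<close>.\<close>
      have k_lower: "k s \<ge> - (L * \<bar>b \<bullet> w\<bar>)" if s: "s \<in> {0..1}" for s
      proof (cases "s = 0")
        case True
        then show ?thesis using sv(8) pos by simp
      next
        case False
        then have "0 < s" using s by simp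
        have "\<And>z. 0 \<le> z \<Longrightarrow> z \<le> s \<Longrightarrow> (k has_real_derivative k' z) (at z)" using k'(1) s by simp
        from MVT2[OF \<open>0 < s\<close> this] obtain z where z: "0 < z" "z < s" "k s - k 0 = (s - 0) * k' z" by blast
        have "s * k' z \<ge> s * - (L * \<bar>b \<bullet> w\<bar>)"
          using k'(2)[of z] z s by (intro mult_left_mono) auto
        moreover have "s * (L * \<bar>b \<bullet> w\<bar>) \<le> 1 * (L * \<bar>b \<bullet> w\<bar>)"
          using s pos by (intro mult_right_mono) auto
        ultimately show ?thesis using z(3) sv(8) by simp
      qed
      have "continuous_on {0..1} k"
        by (intro continuous_at_imp_continuous_on ballI DERIV_isCont[OF k'(1)])
      then have "k integrable_on {0..1}" by (rule integrable_continuous_interval)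
      moreover have "(\<lambda>s::real. - (L * \<bar>b \<bullet> w\<bar>)) integrable_on {0..1}" by (rule integrable_const_ivl)
      ultimately have "integral {0..1} (\<lambda>s::real. - (L * \<bar>b \<bullet> w\<bar>)) \<le> integral {0..1} k"
        using k_lower by (intro integral_le) auto
      then have D: "integral {0..1} k \<ge> - L * \<bar>f1 1 \<tau>\<bar>" using sv(6)[rule_format, OF oneJ(1)] by simp
      have "(f has_real_derivative f1 1 t) (at t)" if "t \<in> I" for t
        using sv(4)[rule_format, OF oneJ(1) that] unfolding f_def oneJ(2) J(5) .
      then show ?thesis
        using sv(1,2) sv(5)[rule_format, OF zero_less_one J01] D by (intro exI[of _ I] exI[of _ "f1 1"]) blast
    qed
    have "f t - f 0 \<le> exp L * t * max 0 (f 1 - f 0)"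
    proof (rule quasi_convex_growth[of f "deriv f" "deriv (deriv f)"])
      fix \<tau> :: real assume "\<tau> \<in> {0..1}"
      from key[OF this] obtain I f1 D where *: "open I" "\<tau> \<in> I" "\<And>t. t \<in> I \<Longrightarrow> (f has_real_derivative f1 t) (at t)"
        "(f1 has_real_derivative D) (at \<tau>)" "D \<ge> - L * \<bar>f1 \<tau>\<bar>" by blast
      have eq: "f1 t = deriv f t" if "t \<in> I" for t using DERIV_imp_deriv[OF *(3)[OF that]] by simp
      show "(f has_real_derivative deriv f \<tau>) (at \<tau>)" using *(3)[OF *(2)] eq[OF *(2)] by simp
      have d2: "(deriv f has_real_derivative D) (at \<tau>)"
        by (rule has_field_derivative_transform_within_open[OF *(4,1,2) eq])
      then have D: "deriv (deriv f) \<tau> = D" by (rule DERIV_imp_deriv)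
      show "(deriv f has_real_derivative deriv (deriv f) \<tau>) (at \<tau>)" using d2 D by simp
      show "- L * \<bar>deriv f \<tau>\<bar> \<le> deriv (deriv f) \<tau>" using *(5) eq[OF *(2)] D by simp
    qed (use pos t in auto)
    then show ?thesis by (simp add: f_def yt\<delta> I0(5) one(2) algebra_simps)
  qed
  then show ?thesis
    using pos(3) by (intro exI[of _ "exp L"]) (simp add: Let_def)
qed

text \<open>Applied to a segment and to its reverse, the hypothesis says that \<open>f t = c x0 (\<delta> t) - c x (\<delta> t)\<close> does not
exceed the larger of its two end values. A pair of vectors violating the conclusion provides a strict interior maximum.\<close>

lemma curv_nonneg_of_max_principle:
  assumes max: "\<And>x x0 y0 y1 t. x \<in> \<Omega> \<Longrightarrow> x0 \<in> \<Omega> \<Longrightarrow> y0 \<in> \<Omega>' \<Longrightarrow> y1 \<in> \<Omega>' \<Longrightarrow> t \<in> {0..1} \<Longrightarrow>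
      - c x y1 + c x0 y1 \<le> - c x y0 + c x0 y0 \<Longrightarrow>
      - c x (c_segment \<A> (swap_cost c) \<Omega>' x0 y0 y1 t) + c x0 (c_segment \<A> (swap_cost c) \<Omega>' x0 y0 y1 t)
        \<le> - c x y0 + c x0 y0"
  shows curv_nonneg
  unfolding curv_nonneg_def
proof (intro ballI allI impI; rule ccontr)
  fix \<kappa> \<psi> u v V w
  assume dom: "\<kappa> \<in> \<A>" "\<psi> \<in> \<B>" "u \<in> chart_img \<kappa> \<Omega>" "v \<in> chart_img \<psi> \<Omega>'"
    and orth: "V \<bullet> (hess \<kappa> \<psi> u v *v w) = 0" and "\<not> curv \<kappa> \<psi> u v V w \<ge> 0"
  then have neg: "curv \<kappa> \<psi> u v V w < 0" by simp
  interpret sw: cost_domain \<B> \<A> \<Omega>' \<Omega> "swap_cost c" by (rule swapped_domain)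
  obtain x0 y where xy: "x0 \<in> cdom \<kappa> \<inter> \<Omega>" "u = cmap \<kappa> x0" "y \<in> cdom \<psi> \<inter> \<Omega>'" "v = cmap \<psi> y"
    using dom(3,4) by blast
  have \<kappa>: "\<kappa> \<in> charts_at \<A> x0" "x0 \<in> \<Omega>" and \<psi>: "\<psi> \<in> charts_at \<B> y" "y \<in> \<Omega>'"
    using xy dom by (auto simp: charts_at_def)
  define H where "H = hess \<kappa> \<psi> u v"
  define b where "b = - (V v* H)"
  define b' where "b' = - (H *v w)"
  define a' where "a' = pvec \<A> (swap_cost c) y x0 \<kappa>"
  obtain J \<gamma> where J: "open J" "convex J" "0 \<in> J" "c_line y \<psi> (pvec \<B> c x0 y \<psi>) b J \<gamma>" "\<gamma> 0 = x0"
    using c_line_exists[OF \<psi>(2,1) \<kappa>(2), of b] by metis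
  obtain I0 \<delta> where I0: "open I0" "0 \<in> I0" "sw.c_line x0 \<kappa> a' b' I0 \<delta>" "\<delta> 0 = y"
    using sw.c_line_exists[OF \<kappa>(2,1) \<psi>(2), of b'] unfolding a'_def by metis
  have \<delta>: "\<delta> t \<in> \<Omega>'" "pvec \<A> (swap_cost c) (\<delta> t) x0 \<kappa> = a' + t *\<^sub>R b'" if "t \<in> I0" for t
    using I0(3) that by (auto simp: sw.c_line_def)
  have \<kappa>': "\<kappa> \<in> charts_at \<A> (\<gamma> 0)" using \<kappa>(1) J(5) by simp
  have \<delta>': "\<delta> t \<in> \<Omega>' \<and> pvec \<A> (swap_cost c) (\<delta> t) (\<gamma> 0) \<kappa> = a' + t *\<^sub>R b'" if "t \<in> I0" for t
    using \<delta>[OF that] J(5) by simp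
  obtain I f1 k w' where sv: "open I" "0 \<in> I" "I \<subseteq> I0"
    "\<forall>s1\<in>J. \<forall>t\<in>I.
      ((\<lambda>t. - c (\<gamma> s1) (\<delta> t) + c (\<gamma> 0) (\<delta> t)) has_real_derivative f1 s1 t) (at t)"
    "\<forall>s1. 0 < s1 \<longrightarrow> {0..s1} \<subseteq> J \<longrightarrow> (f1 s1 has_real_derivative integral {0..s1} k) (at 0)"
    "\<forall>s1\<in>J. f1 s1 0 = s1 * (b \<bullet> w')"
    "hess \<kappa> \<psi> (cmap \<kappa> (\<gamma> 0)) (cmap \<psi> y) *v w' = - b'"
    "k 0 = 0"
    "\<forall>s\<in>J. \<forall>\<kappa>\<in>charts_at \<A> (\<gamma> s).
      \<exists>V. V v* hess \<kappa> \<psi> (cmap \<kappa> (\<gamma> s)) (cmap \<psi> y) = - b \<and>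
        (k has_real_derivative curv \<kappa> \<psi> (cmap \<kappa> (\<gamma> s)) (cmap \<psi> y) V w') (at s)"
    using second_variation[OF \<psi>(2,1) J(1,3,4) \<kappa>' I0(1,2,4) \<delta>'] by blast
  have "H *v w' = H *v w" using sv(7) by (simp add: J(5) H_def xy b'_def)
  then have w': "w' = w" using hess_inverse(2)[OF dom] unfolding H_def by metis
  obtain V' where V': "V' v* H = V v* H" "(k has_real_derivative curv \<kappa> \<psi> u v V' w) (at 0)"
    using sv(9)[rule_format, OF J(3) \<kappa>'] by (auto simp: J(5) H_def xy b_def w')
  have "V' = V"
  proof -
    have "V' \<bullet> z = V \<bullet> z" for z
      using V'(1) hess_inverse(1)[OF dom, of z] unfolding H_def by (metis dot_lmul_matrix)
    then show ?thesis using vector_eq_rdot by blast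
  qed
  then have dk: "(k has_real_derivative curv \<kappa> \<psi> u v V w) (at 0)" using V'(2) by simp
  \<comment> \<open>Up to some \<open>s1 > 0\<close> the function \<open>k\<close> is negative, hence so is the second derivative of \<open>f\<close> at \<open>0\<close>.\<close>
  obtain d where d: "d > 0" "\<And>h. 0 < h \<Longrightarrow> h < d \<Longrightarrow> k h < 0"
    using DERIV_neg_dec_right[OF dk neg] sv(8) by auto
  obtain r where r: "r > 0" "ball 0 r \<subseteq> J" using J(1,3) openE by blast
  define s1 where "s1 = min d r / 2"
  have s1: "s1 > 0" "s1 < d" "{0..s1} \<subseteq> J"
    using d(1) r by (auto simp: s1_def subset_eq)
  have s1J: "s1 \<in> J" using s1 by auto
  have "isCont k s" if "s \<in> J" for s
  proof -
    obtain \<kappa>' where "\<kappa>' \<in> charts_at \<A> (\<gamma> s)" using charts_at_nonempty[OF mfA] by blast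
    from sv(9)[rule_format, OF that this] show ?thesis using DERIV_isCont by blast
  qed
  then have "continuous_on {0..s1} k"
    using s1(3) by (intro continuous_at_imp_continuous_on) auto
  then have int: "integral {0..s1} k < 0"
    using integral_less_real[of 0 s1 k "\<lambda>_. 0"] s1 d(2) by auto
  have f10: "f1 s1 0 = 0"
    using sv(6)[rule_format, OF s1J] orth by (simp add: w' b_def dot_lmul_matrix H_def)
  define f where "f = (\<lambda>t. - c (\<gamma> s1) (\<delta> t) + c x0 (\<delta> t))"
  have df: "(f has_real_derivative f1 s1 t) (at t)" if "t \<in> I" for t
    using sv(4)[rule_format, OF s1J that] unfolding f_def J(5) .
  have df1: "(f1 s1 has_real_derivative integral {0..s1} k) (at 0)" by (rule sv(5)[rule_format, OF s1(1,3)])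
  obtain e1 where e1: "e1 > 0" "\<And>h. 0 < h \<Longrightarrow> h < e1 \<Longrightarrow> f1 s1 h < 0"
    using DERIV_neg_dec_right[OF df1 int] f10 by auto
  obtain e2 where e2: "e2 > 0" "\<And>h. 0 < h \<Longrightarrow> h < e2 \<Longrightarrow> f1 s1 (- h) > 0"
    using DERIV_neg_dec_left[OF df1 int] f10 by auto
  obtain e3 where e3: "e3 > 0" "ball 0 e3 \<subseteq> I" using sv(1,2) openE by blast
  define \<epsilon> where "\<epsilon> = min e1 (min e2 e3) / 2"
  have \<epsilon>: "\<epsilon> > 0" "\<epsilon> < e1" "\<epsilon> < e2" "\<epsilon> < e3" using e1 e2 e3 by (auto simp: \<epsilon>_def)
  have inI: "t \<in> I" if "\<bar>t\<bar> \<le> \<epsilon>" for t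
    using that e3(2) \<epsilon>(4) by (auto simp: subset_eq)
  have right: "f \<epsilon> < f 0"
  proof -
    have "\<And>t. 0 \<le> t \<Longrightarrow> t \<le> \<epsilon> \<Longrightarrow> (f has_real_derivative f1 s1 t) (at t)" by (intro df inI) auto
    from MVT2[OF \<epsilon>(1) this] obtain z where "0 < z" "z < \<epsilon>" "f \<epsilon> - f 0 = (\<epsilon> - 0) * f1 s1 z" by blast
    then show ?thesis using e1(2)[of z] \<epsilon> mult_pos_neg[of \<epsilon> "f1 s1 z"] by auto
  qed
  have left: "f (- \<epsilon>) < f 0"
  proof -
    have "- \<epsilon> < 0" using \<epsilon> by simp
    have "\<And>t. - \<epsilon> \<le> t \<Longrightarrow> t \<le> 0 \<Longrightarrow> (f has_real_derivative f1 s1 t) (at t)" by (intro df inI) auto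
    from MVT2[OF \<open>- \<epsilon> < 0\<close> this] obtain z where z: "- \<epsilon> < z" "z < 0" "f 0 - f (- \<epsilon>) = (0 - (- \<epsilon>)) * f1 s1 z" by blast
    have "f1 s1 z > 0" using e2(2)[of "- z"] z \<epsilon> by simp
    with \<epsilon>(1) have "\<epsilon> * f1 s1 z > 0" by (rule mult_pos_pos)
    then show ?thesis using z(3) by simp
  qed
  have in0: "\<epsilon> \<in> I0" "- \<epsilon> \<in> I0" using inI[of \<epsilon>] inI[of "- \<epsilon>"] \<epsilon>(1) sv(3) by auto
  \<comment> \<open>The point \<open>y = \<delta> 0\<close> is the midpoint of the segment between \<open>\<delta> (- \<epsilon>)\<close> and \<open>\<delta> \<epsilon>\<close> in either direction.\<close>
  have mid: "c_segment \<A> (swap_cost c) \<Omega>' x0 (\<delta> p) (\<delta> q) (1/2) = y"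
    if "p \<in> I0" "q \<in> I0" "p + q = 0" for p q
  proof (rule sw.c_segment_eqI[OF \<kappa>(2,1) \<psi>(2) \<delta>(1)[OF that(1)] \<delta>(1)[OF that(2)]])
    have "(1 - 1 / 2) *\<^sub>R (a' + p *\<^sub>R b') + (1 / 2) *\<^sub>R (a' + q *\<^sub>R b') = a' + ((p + q) / 2) *\<^sub>R b'"
      by (simp add: vec_eq_iff field_simps)
    then show "pvec \<A> (swap_cost c) y x0 \<kappa> = (1 - 1 / 2) *\<^sub>R pvec \<A> (swap_cost c) (\<delta> p) x0 \<kappa>
        + (1 / 2) *\<^sub>R pvec \<A> (swap_cost c) (\<delta> q) x0 \<kappa>"
      using \<delta>(2)[OF that(1)] \<delta>(2)[OF that(2)] that(3) by (simp add: a'_def)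
  qed
  have x1: "\<gamma> s1 \<in> \<Omega>" using J(4) s1J by (simp add: c_line_def)
  have half: "(1 / 2 :: real) \<in> {0..1}" by simp
  show False
  proof (cases "f \<epsilon> \<le> f (- \<epsilon>)")
    case True
    then have "f 0 \<le> f (- \<epsilon>)"
      using max[OF x1 \<kappa>(2) \<delta>(1)[OF in0(2)] \<delta>(1)[OF in0(1)] half] mid[OF in0(2,1)] I0(4) by (simp add: f_def)
    then show False using left by simp
  next
    case False
    then have "f 0 \<le> f \<epsilon>"
      using max[OF x1 \<kappa>(2) \<delta>(1)[OF in0(1)] \<delta>(1)[OF in0(2)] half] mid[OF in0(1,2)] I0(4) by (simp add: f_def)
    then show False using right by simp
  qed
qed

end


theorem lemma2p23:
  fixes \<A> :: "('a::{t2_space, second_countable_topology}, 'n::finite) chart set"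
    and \<B> :: "('b::{t2_space, second_countable_topology}, 'n) chart set"
    and g :: "('a, 'n) metric" and g' :: "('b, 'n) metric"
    and \<Omega> :: "'a set" and \<Omega>' :: "'b set"
    and \<rho>' :: "'b \<Rightarrow> real" and c :: "'a \<Rightarrow> 'b \<Rightarrow> real"
  assumes "riemannian_manifold \<A> g" and "riemannian_manifold \<B> g'"
    and "bounded_subdomain \<A> g \<Omega>" and "bounded_subdomain \<B> g' \<Omega>'"
    and "probability_density \<B> g' \<rho>'" and "spt \<B> g' \<rho>' \<subseteq> \<Omega>'"
    and "mixed_regular \<A> \<B> \<Omega> \<Omega>' c 2 1" and "mixed_regular \<A> \<B> \<Omega> \<Omega>' c 1 2"
    and "mixed_regular \<A> \<B> \<Omega> \<Omega>' c 2 2"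
    and "twist \<A> \<B> \<Omega> \<Omega>' c"
    and "nondeg \<A> \<B> \<Omega> \<Omega>' c"
    and "dom_conv \<A> \<B> \<Omega> \<Omega>' c g' \<rho>'"
  shows "A3w \<A> \<B> \<Omega> \<Omega>' c \<longleftrightarrow> qq_conv \<A> \<B> \<Omega> \<Omega>' c"
proof -
  interpret cost_domain \<A> \<B> \<Omega> \<Omega>' c
    using assms by unfold_locales (auto simp: riemannian_manifold_def bounded_subdomain_def dom_conv_def)
  interpret sw: cost_domain \<B> \<A> \<Omega>' \<Omega> "swap_cost c" by (rule swapped_domain)
  show ?thesis
    unfolding A3w_iff_curv_nonneg
  proof
    assume cn: curv_nonneg
    obtain M where M: "M \<ge> 1" "\<And>x x0 y0 y1 t yt. x \<in> \<Omega> \<Longrightarrow> x0 \<in> \<Omega> \<Longrightarrow> y0 \<in> \<Omega>' \<Longrightarrow> y1 \<in> \<Omega>' \<Longrightarrow> t \<in> {0..1} \<Longrightarrow>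
      yt = c_segment \<A> (swap_cost c) \<Omega>' x0 y0 y1 t \<Longrightarrow>
      - c x yt + c x y0 - (- c x0 yt + c x0 y0) \<le> M * t * max 0 (- c x y1 + c x y0 - (- c x0 y1 + c x0 y0))"
      using qq_one_sided[OF cn] unfolding Let_def by blast
    obtain M' where M': "M' \<ge> 1" "\<And>y y0 x0 x1 s xs. y \<in> \<Omega>' \<Longrightarrow> y0 \<in> \<Omega>' \<Longrightarrow> x0 \<in> \<Omega> \<Longrightarrow> x1 \<in> \<Omega> \<Longrightarrow> s \<in> {0..1} \<Longrightarrow>
      xs = c_segment \<B> c \<Omega> y0 x0 x1 s \<Longrightarrow>
      - c xs y + c x0 y - (- c xs y0 + c x0 y0) \<le> M' * s * max 0 (- c x1 y + c x0 y - (- c x1 y0 + c x0 y0))"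
      using sw.qq_one_sided[OF curv_nonneg_swap[OF cn]] unfolding Let_def swap_swap_cost
      unfolding swap_cost_def by blast
    define M0 where "M0 = max M M'"
    have grow: "M * t * max 0 z \<le> M0 * t * max 0 z" "M' * t * max 0 z \<le> M0 * t * max 0 z"
      if "t \<in> {0..1}" for t z :: real
      using that by (auto simp: M0_def intro!: mult_right_mono)
    show "qq_conv \<A> \<B> \<Omega> \<Omega>' c"
      unfolding qq_conv_def Let_def
    proof (intro exI[of _ M0] conjI ballI)
      show "M0 \<ge> 1" using M(1) by (simp add: M0_def)
    qed (rule order_trans[OF M(2) grow(1)] order_trans[OF M'(2) grow(2)]; simp)+
  next
    assume "qq_conv \<A> \<B> \<Omega> \<Omega>' c"
    then obtain M0 where "\<forall>x\<in>\<Omega>. \<forall>x0\<in>\<Omega>. \<forall>x1\<in>\<Omega>. \<forall>y\<in>\<Omega>'. \<forall>y0\<in>\<Omega>'. \<forall>y1\<in>\<Omega>'. \<forall>s\<in>{0..1}. \<forall>t\<in>{0..1}.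
        (let yt = c_segment \<A> (swap_cost c) \<Omega>' x0 y0 y1 t in
           - c x yt + c x y0 - (- c x0 yt + c x0 y0)
             \<le> M0 * t * max 0 (- c x y1 + c x y0 - (- c x0 y1 + c x0 y0))) \<and>
        (let xs = c_segment \<B> c \<Omega> y0 x0 x1 s in
           - c xs y + c x0 y - (- c xs y0 + c x0 y0)
             \<le> M0 * s * max 0 (- c x1 y + c x0 y - (- c x1 y0 + c x0 y0)))"
      unfolding qq_conv_def by blast
    then have qq: "- c x yt + c x y0 - (- c x0 yt + c x0 y0)
             \<le> M0 * t * max 0 (- c x y1 + c x y0 - (- c x0 y1 + c x0 y0))"
      if "x \<in> \<Omega>" "x0 \<in> \<Omega>" "y0 \<in> \<Omega>'" "y1 \<in> \<Omega>'" "t \<in> {0..1}" "yt = c_segment \<A> (swap_cost c) \<Omega>' x0 y0 y1 t"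
      for x x0 y0 y1 t yt
      using that unfolding Let_def by blast
    show curv_nonneg
    proof (rule curv_nonneg_of_max_principle)
      fix x x0 y0 y1 and t :: real
      assume *: "x \<in> \<Omega>" "x0 \<in> \<Omega>" "y0 \<in> \<Omega>'" "y1 \<in> \<Omega>'" "t \<in> {0..1}"
        and le: "- c x y1 + c x0 y1 \<le> - c x y0 + c x0 y0"
      have "max 0 (- c x y1 + c x y0 - (- c x0 y1 + c x0 y0)) = 0" using le by simp
      with qq[OF * refl]
      show "- c x (c_segment \<A> (swap_cost c) \<Omega>' x0 y0 y1 t) + c x0 (c_segment \<A> (swap_cost c) \<Omega>' x0 y0 y1 t)
        \<le> - c x y0 + c x0 y0" by simp
    qed
  qed
qed

end
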